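(* For every $n\ge2$, $$\Phi_{(n-1)}(z;n)=\frac{\mathrm{Cat}_{n-1}\,z^{n-1}}{(1-1^2z^2)(1-2^2z^2)\cdots(1-(n-1)^2z^2)},$$ and consequently, for every $N\ge n$, $$\big\langle u_{11}\overline{u_{12}}\,u_{22}\overline{u_{23}}\cdots u_{n-1,n-1}\overline{u_{n-1,n}}\,u_{nn}\overline{u_{n1}}\big\rangle_N=\frac{(-1)^{n-1}\mathrm{Cat}_{n-1}}{N(N^2-1^2)\cdots(N^2-(n-1)^2)}.$$
   Context: $\mathrm{Cat}_r=\frac1{r+1}\binom{2r}r$. $J_k=\sum_{s=1}^{k-1}(s,k)\in\mathbb C[S(n)]$ are the Jucys–Murphy elements; the reduced cycle-type of a permutation with cycle type $\lambda\vdash n$ (fixed points as parts $1$) is obtained by subtracting $1$ from each part; $\mathfrak c_\mu(n)$ is the sum of permutations in $S(n)$ of reduced cycle-type $\mu$. $F^k_\mu(n)$ is defined by $h_k(J_1,\dots,J_n,0,\dots)=\sum_{|\mu|+\ell(\mu)\le n}F^k_\mu(n)\mathfrak c_\mu(n)$ ($h_k$ the complete homogeneous symmetric function), and $\Phi_\mu(z;n)=\sum_{k\ge0}F^k_\mu(n)z^k$ as a formal power series; $(n-1)$ denotes the partition with one part equal to $n-1$ (the reduced cycle-type of an $n$-cycle). $U=(u_{ij})$ is an $N\times N$ Haar-distributed random unitary matrix and $\langle\cdot\rangle_N$ denotes expectation. *)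

theory Defs
  imports
    "HOL-Probability.Probability"
    "HOL-Combinatorics.Orbits"
    "HOL-Computational_Algebra.Formal_Power_Series"
begin

definition catalan :: "nat \<Rightarrow> complex" where
  "catalan r = of_nat ((2 * r) choose r) / of_nat (r + 1)"


text \<open>
  An element of the group algebra of the symmetric group on \<open>{1..n}\<close> is represented by its
  coefficient function; the coefficients off \<open>{p. p permutes {1..n}}\<close> are 0.
\<close>

type_synonym perm_alg = "(nat \<Rightarrow> nat) \<Rightarrow> complex"

definition perm_elem :: "(nat \<Rightarrow> nat) \<Rightarrow> perm_alg" where
  "perm_elem q = (\<lambda>p. if p = q then 1 else 0)"

definition alg_mult :: "nat \<Rightarrow> perm_alg \<Rightarrow> perm_alg \<Rightarrow> perm_alg" where
  "alg_mult n f g =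
    (\<lambda>p. \<Sum>(q, r) \<in> {(q, r). q permutes {1..n} \<and> r permutes {1..n} \<and> q \<circ> r = p}. f q * g r)"

definition jucys_murphy :: "nat \<Rightarrow> perm_alg" where
  "jucys_murphy k = (\<lambda>p. \<Sum>s\<in>{1..<k}. perm_elem (Transposition.transpose s k) p)"

text \<open>
  \<open>complete_hom n k x\<close> is \<open>h\<^sub>k(x\<^sub>1, \<dots>, x\<^sub>n)\<close>, the sum of \<open>x\<^bsub>i\<^sub>1\<^esub> \<cdots> x\<^bsub>i\<^sub>k\<^esub>\<close> over
  \<open>1 \<le> i\<^sub>1 \<le> \<dots> \<le> i\<^sub>k \<le> n\<close>. The factors are multiplied in increasing order of index, which is
  immaterial for commuting elements such as the Jucys--Murphy elements.
\<close>

definition complete_hom :: "nat \<Rightarrow> nat \<Rightarrow> (nat \<Rightarrow> perm_alg) \<Rightarrow> perm_alg" where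
  "complete_hom n k x =
    (\<lambda>p. \<Sum>is \<in> {is. sorted is \<and> length is = k \<and> set is \<subseteq> {1..n}}.
           foldr (alg_mult n) (map x is) (perm_elem id) p)"


text \<open>Partitions are multisets of positive natural numbers.\<close>

definition cycle_type :: "nat \<Rightarrow> (nat \<Rightarrow> nat) \<Rightarrow> nat multiset" where
  "cycle_type n p = image_mset card (mset_set (orbit p ` {1..n}))"

definition reduced_cycle_type :: "nat \<Rightarrow> (nat \<Rightarrow> nat) \<Rightarrow> nat multiset" where
  "reduced_cycle_type n p = filter_mset (\<lambda>m. 0 < m) (image_mset (\<lambda>m. m - 1) (cycle_type n p))"

definition class_sum :: "nat \<Rightarrow> nat multiset \<Rightarrow> perm_alg" where
  "class_sum n \<mu> = (\<lambda>p. if p permutes {1..n} \<and> reduced_cycle_type n p = \<mu> then 1 else 0)"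

definition reduced_partitions :: "nat \<Rightarrow> nat multiset set" where
  "reduced_partitions n = {\<mu>. 0 \<notin># \<mu> \<and> sum_mset \<mu> + size \<mu> \<le> n}"

text \<open>
  \<open>class_coeff n k \<mu>\<close> is \<open>F\<^sup>k\<^sub>\<mu>(n)\<close>. The coefficients are determined only for
  \<open>\<mu> \<in> reduced_partitions n\<close>; they are set to 0 elsewhere so that the description is unique.
\<close>

definition class_coeff :: "nat \<Rightarrow> nat \<Rightarrow> nat multiset \<Rightarrow> complex" where
  "class_coeff n k =
    (THE F. (\<forall>\<mu>. \<mu> \<notin> reduced_partitions n \<longrightarrow> F \<mu> = 0) \<and>
            complete_hom n k jucys_murphy =
              (\<lambda>p. \<Sum>\<mu>\<in>reduced_partitions n. F \<mu> * class_sum n \<mu> p))"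

definition class_gf :: "nat \<Rightarrow> nat multiset \<Rightarrow> complex fps" where
  "class_gf n \<mu> = Abs_fps (\<lambda>k. class_coeff n k \<mu>)"


definition adjoint_matrix :: "complex^'n^'m \<Rightarrow> complex^'m^'n" where
  "adjoint_matrix A = (\<chi> i j. cnj (A $ j $ i))"

definition unitary_matrix :: "complex^'n^'n \<Rightarrow> bool" where
  "unitary_matrix A \<longleftrightarrow> A ** adjoint_matrix A = mat 1 \<and> adjoint_matrix A ** A = mat 1"

text \<open>
  The Haar probability measure of the unitary group, regarded as a Borel measure on the space of all
  matrices that is concentrated on the unitary ones.
\<close>

definition haar_unitary :: "(complex^'n^'n) measure \<Rightarrow> bool" where
  "haar_unitary H \<longleftrightarrow>
    prob_space H \<and> sets H = sets borel \<and> emeasure H {A. unitary_matrix A} = 1 \<and>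
    (\<forall>V. unitary_matrix V \<longrightarrow> distr H borel (\<lambda>A. V ** A) = H)"

definition haar_random_unitary :: "'a measure \<Rightarrow> ('a \<Rightarrow> complex^'n^'n) \<Rightarrow> bool" where
  "haar_random_unitary M U \<longleftrightarrow>
    prob_space M \<and> U \<in> borel_measurable M \<and> haar_unitary (distr M borel U)"

end

theory Submission
  imports Defs
begin

text \<open>
  Both assertions are instances of one statement about the inverse \<open>X\<close> of \<open>(1 - z J\<^sub>1) \<cdots> (1 - z J\<^sub>n)\<close>
  in the group algebra of \<open>S(n)\<close> over an integral domain. The generating function of the \<open>h\<^sub>k(J\<^sub>1, \<dots>, J\<^sub>n)\<close>
  is \<open>X\<close> with \<open>z\<close> the formal variable; and column orthogonality of a unitary matrix together with
  invariance under mixing two rows shows that the moments \<open>\<langle>\<Prod> u\<^sub>i\<^sub>i \<cdot> cnj u\<^sub>i\<^sub>,\<^sub>\<pi>\<^sub>(\<^sub>i\<^sub>)\<rangle>\<close>, scaled by \<open>N\<^sup>n\<close>, are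
  \<open>X\<close> with \<open>z = - 1 / N\<close>.

  By Jucys' formula \<open>(1 - z J\<^sub>1) \<cdots> (1 - z J\<^sub>n) = \<Sum> (- z)\<^bsup>n - cyc \<pi>\<^esup> \<pi>\<close>, so \<open>X\<close> is a class function. For each
  \<open>A\<close> containing 1 there is a functional, a matrix coefficient of a hook representation, on which
  each \<open>J\<^sub>k\<close> acts by a scalar; its value at \<open>X\<close> is therefore \<open>\<plusminus> 1 / \<Prod> (1 - c z)\<close> over the contents \<open>c\<close> of
  the hook. A sign-reversing involution shows that the sum of these functionals over all \<open>A\<close> only sees the
  full cycles. This expresses the coefficient of a full cycle as an alternating binomial sum, which
  the Chu--Vandermonde identity evaluates.
\<close>

section \<open>Orbits of permutations\<close>

text \<open>Hooks suffice because an irreducible character of S(n) vanishes at a full cycle unless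
  its shape is a hook; at the hook of leg length \<open>r\<close> its value is
  \<open>(-1)^r\<close>, whence the alternating signs. The contents of that hook run from
  \<open>- r\<close> to \<open>n - 1 - r\<close>, so the product of
  \<open>1 - i\<^sup>2 z\<^sup>2\<close> over \<open>1 \<le> i \<le> n - 1\<close> is a common
  multiple of the denominators of all hooks. Clearing denominators lets one argument serve a power
  series ring and the complex numbers.

  No inverse is constructed: both applications supply a sequence with
  \<open>X\<^sub>m (1 - z J\<^sub>m) = X\<^sub>m\<^sub>-\<^sub>1\<close>. Splitting off the largest
  variable of a complete homogeneous function gives it in one case, summing over all rows for the
  last factor in the other.

  The functionals are evaluated along this recursion for initial segments \<open>A = {1..k}\<close>,
  which fit the order of the Jucys--Murphy elements. That \<open>X\<^sub>n\<close> is a class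
  function then serves twice: it carries the value over to every \<open>A\<close> of the same size,
  and it gives all full cycles the same coefficient.\<close>

abbreviation swap :: "'a \<Rightarrow> 'a \<Rightarrow> 'a \<Rightarrow> 'a" where
  "swap \<equiv> Transposition.transpose"

section \<open>Cycles of a permutation composed with a transposition\<close>

lemma orbit_eq_if_mem:
  assumes "permutation f" "y \<in> orbit f x"
  shows "orbit f y = orbit f x"
  using orbit_cyclic_eq3[OF cyclic_on_orbit'[OF assms(1)] assms(2)] .

lemma orbit_swap_comp_avoiding:
  assumes "p permutes S" "finite S" "a \<notin> orbit p y" "b \<notin> orbit p y"
  shows "orbit (swap a b \<circ> p) y = orbit p y"
proof (rule orbit_cong)
  show "y \<in> orbit p y"
    using assms by (meson permutation_permutes permutation_self_in_orbit)
  fix s assume "s \<in> orbit p y"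
  then have "p s \<in> orbit p y" by (rule orbit.step)
  then have "p s \<noteq> a" "p s \<noteq> b" using assms by auto
  then show "(swap a b \<circ> p) s = p s" by simp
qed

text \<open>Since \<open>p\<close> fixes \<open>a\<close>, the composite sends the preimage of
  \<open>b\<close> to \<open>a\<close> and \<open>a\<close> to \<open>b\<close>: the new point is
  spliced into the cycle of \<open>b\<close> just before \<open>b\<close>.\<close>

lemma orbit_swap_comp_insert:
  assumes p: "p permutes S" "finite S" and a: "a \<notin> S" and b: "b \<in> S"
  shows "orbit (swap a b \<circ> p) b = insert a (orbit p b)"
    and "orbit (swap a b \<circ> p) a = insert a (orbit p b)"
proof -
  let ?q = "swap a b \<circ> p"
  have pp: "permutation p" using p by (auto simp: permutation_permutes)
  have q: "?q permutes insert a S"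
    using p b by (intro permutes_compose permutes_swap_id) (auto intro: permutes_imp_permutes_insert)
  then have pq: "permutation ?q" using p by (meson finite.insertI permutation_permutes)
  have pa: "p a = a" using p a by (simp add: permutes_not_in)
  have sub: "orbit p b \<subseteq> S" using b by (rule permutes_orbit_subset[OF p(1)])
  have bq: "b \<in> orbit ?q b" using pq by (rule permutation_self_in_orbit)
  have bp: "b \<in> orbit p b" using pp by (rule permutation_self_in_orbit)
  have 1: "x \<in> insert a (orbit p b)" if "x \<in> orbit ?q b" for x
    using that
  proof induction
    case base
    have "p b \<in> orbit p b" by (rule orbit.base)
    then show ?case by (auto simp: Transposition.transpose_def bp)
  next
    case (step y)
    then show ?case
      by (auto simp: Transposition.transpose_def bp pa intro: orbit.step)
  qed
  have 2: "x \<in> orbit ?q b" if "x \<in> orbit p b" for x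
    using that
  proof induction
    case base
    have "p b \<noteq> a" using orbit.base[of p b] sub a by auto
    then have "?q b = p b" if "p b \<noteq> b" using that by simp
    then show ?case
      using bq orbit.base[of ?q b] by metis
  next
    case (step y)
    have "p y \<noteq> a" using orbit.step[OF step.hyps] sub a by auto
    then have "?q y = p y" if "p y \<noteq> b" using that by simp
    then show ?case
      using bq orbit.step[OF step.IH] by metis
  qed
  have "inv p b \<in> orbit p b"
  proof -
    have "inv p b \<in> orbit (inv p) b" by (rule orbit.base)
    then show ?thesis by (simp add: orbit_inv_eq[OF pp])
  qed
  then have "?q (inv p b) \<in> orbit ?q b" by (intro orbit.step 2)
  then have 3: "a \<in> orbit ?q b" using p by (simp add: permutes_inverses)
  show *: "orbit ?q b = insert a (orbit p b)" using 1 2 3 by blast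
  show "orbit ?q a = insert a (orbit p b)"
    using orbit_eq_if_mem[OF pq 3] * by simp
qed

lemma orbits_swap_comp_insert:
  assumes p: "p permutes S" "finite S" and a: "a \<notin> S" and b: "b \<in> S"
  shows "orbit (swap a b \<circ> p) ` insert a S
    = (\<lambda>C. if b \<in> C then insert a C else C) ` (orbit p ` S)"
proof -
  let ?q = "swap a b \<circ> p"
  have pp: "permutation p" using p by (auto simp: permutation_permutes)
  have q: "?q permutes insert a S"
    using p b by (intro permutes_compose permutes_swap_id) (auto intro: permutes_imp_permutes_insert)
  then have pq: "permutation ?q" using p by (meson finite.insertI permutation_permutes)
  have *: "orbit ?q y = (if b \<in> orbit p y then insert a (orbit p y) else orbit p y)" if "y \<in> S" for y
  proof (cases "b \<in> orbit p y")
    case True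
    then have eq: "orbit p y = orbit p b" using orbit_eq_if_mem[OF pp] by metis
    then have "y \<in> orbit ?q b"
      using orbit_swap_comp_insert(1)[OF p a b] permutation_self_in_orbit[OF pp] by blast
    then have "orbit ?q y = orbit ?q b" by (rule orbit_eq_if_mem[OF pq])
    then show ?thesis using True eq orbit_swap_comp_insert(1)[OF p a b] by simp
  next
    case False
    moreover have "a \<notin> orbit p y" using permutes_orbit_subset[OF p(1) that] a by auto
    ultimately show ?thesis by (simp add: orbit_swap_comp_avoiding[OF p])
  qed
  have "b \<in> orbit p b" using pp by (rule permutation_self_in_orbit)
  then have "orbit ?q a = orbit ?q b"
    by (simp add: orbit_swap_comp_insert[OF p a b])
  then have "orbit ?q ` insert a S = orbit ?q ` S" using b by auto
  also have "\<dots> = (\<lambda>y. if b \<in> orbit p y then insert a (orbit p y) else orbit p y) ` S"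
    by (rule image_cong) (use * in auto)
  finally show ?thesis by (simp only: image_image)
qed

lemma card_orbits_swap_comp_insert:
  assumes p: "p permutes S" "finite S" and a: "a \<notin> S" and b: "b \<in> S"
  shows "card (orbit (swap a b \<circ> p) ` insert a S) = card (orbit p ` S)"
proof -
  have "a \<notin> C" if "C \<in> orbit p ` S" for C
    using that permutes_orbit_subset[OF p(1)] a by auto
  then have "inj_on (\<lambda>C. if b \<in> C then insert a C else C) (orbit p ` S)"
    by (intro inj_onI) (metis insertI1 insert_ident)
  then show ?thesis
    unfolding orbits_swap_comp_insert[OF assms] by (rule card_image)
qed

lemma card_orbits_insert_fixpoint:
  assumes p: "p permutes S" "finite S" and a: "a \<notin> S"
  shows "card (orbit p ` insert a S) = Suc (card (orbit p ` S))"
proof -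
  have "orbit p a = {a}" using p a by (simp add: orbit_eq_singleton_iff permutes_not_in)
  moreover have "{a} \<notin> orbit p ` S" using permutes_orbit_subset[OF p(1)] a by blast
  ultimately show ?thesis using p by simp
qed

text \<open>Removing a point \<open>a\<close> of the ground set either deletes a fixed point or
  shortens a cycle; the latter costs a transposition, hence a sign, and keeps the number of
  cycles.\<close>

lemma sign_eq_card_orbits:
  assumes "finite S" "p permutes S"
  shows "sign p * (- 1) ^ card S = (- 1) ^ card (orbit p ` S)"
  using assms
proof (induction S arbitrary: p)
  case empty
  then show ?case by (simp add: permutes_empty)
next
  case (insert a S)
  define b where "b = p a"
  define q where "q = swap a b \<circ> p"
  have q: "q permutes S" unfolding q_def b_def by (rule permutes_insert_lemma[OF insert.prems])
  have pq: "p = swap a b \<circ> q" by (simp add: q_def fun_eq_iff)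
  have IH: "sign q * (- 1) ^ card S = (- 1) ^ card (orbit q ` S)" by (rule insert.IH[OF q])
  have permq: "permutation q" using q insert by (auto simp: permutation_permutes)
  have bS: "b \<in> insert a S" using permutes_in_image[OF insert.prems, of a] unfolding b_def by simp
  show ?case
  proof (cases "b = a")
    case True
    then have "p = q" using pq by simp
    then show ?thesis
      using card_orbits_insert_fixpoint[OF q insert.hyps] IH insert.hyps by simp
  next
    case False
    then have b: "b \<in> S" using bS by simp
    have "sign p = - sign q"
      unfolding pq using False permq by (subst sign_compose) (auto simp: permutation_swap_id sign_swap_id)
    then show ?thesis
      using card_orbits_swap_comp_insert[OF q insert.hyps b, folded pq] IH insert.hyps by simp
  qed
qed

text \<open>Each full cycle on \<open>insert a S\<close> arises exactly once by splicing
  \<open>a\<close> in front of a point \<open>b\<close> of a full cycle on \<open>S\<close>; the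
  choice of \<open>b\<close> gives the factor \<open>card S\<close>.\<close>

lemma card_single_orbit_permutations:
  assumes "finite S" "S \<noteq> {}"
  shows "card {p. p permutes S \<and> card (orbit p ` S) = 1} = fact (card S - 1)"
  using assms
proof (induction rule: finite_ne_induct)
  case (singleton x)
  have "{p. p permutes {x} \<and> card (orbit p ` {x}) = 1} = {id}" by (auto simp: fun_eq_iff)
  then show ?case by simp
next
  case (insert a S)
  let ?C = "\<lambda>S. {p. p permutes S \<and> card (orbit p ` S) = 1}"
  let ?f = "\<lambda>(b, p). swap a b \<circ> p"
  have "?C (insert a S) = ?f ` (S \<times> ?C S)"
  proof (intro set_eqI iffI)
    fix p assume p: "p \<in> ?C (insert a S)"
    define q where "q = swap a (p a) \<circ> p"
    have q: "q permutes S" unfolding q_def using p by (intro permutes_insert_lemma) auto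
    have pq: "p = swap a (p a) \<circ> q" by (simp add: q_def fun_eq_iff)
    have "p a \<noteq> a"
    proof
      assume "p a = a"
      then have "p permutes S" using pq q by simp
      from card_orbits_insert_fixpoint[OF this insert.hyps(1,3)] p
      have "card (orbit p ` S) = 0" by simp
      then show False using insert.hyps by simp
    qed
    moreover have "p a \<in> insert a S" using p permutes_in_image[of p "insert a S" a] by simp
    ultimately have b: "p a \<in> S" by simp
    have "card (orbit q ` S) = 1"
      using card_orbits_swap_comp_insert[OF q insert.hyps(1,3) b] p pq by simp
    then show "p \<in> ?f ` (S \<times> ?C S)"
      using b q pq by (intro image_eqI[of _ _ "(p a, q)"]) auto
  next
    fix p assume "p \<in> ?f ` (S \<times> ?C S)"
    then obtain b q where *: "p = swap a b \<circ> q" "b \<in> S" "q permutes S" "card (orbit q ` S) = 1" by auto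
    then have "p permutes insert a S"
      by (auto intro!: permutes_compose permutes_swap_id intro: permutes_imp_permutes_insert)
    then show "p \<in> ?C (insert a S)"
      using card_orbits_swap_comp_insert[OF *(3) insert.hyps(1,3) *(2)] * by simp
  qed
  moreover have "inj_on ?f (S \<times> ?C S)"
  proof (rule inj_onI, clarify)
    fix b q c r
    assume *: "swap a b \<circ> q = swap a c \<circ> r" "q permutes S" "r permutes S" "b \<in> S" "c \<in> S"
    have "q a = a" "r a = a" using * insert.hyps by (auto simp: permutes_not_in)
    then have "b = c" using fun_cong[OF *(1), of a] by simp
    then have "swap a b \<circ> (swap a b \<circ> q) = swap a b \<circ> (swap a b \<circ> r)" using * by simp
    then show "b = c \<and> q = r" using \<open>b = c\<close> by (simp add: fun_eq_iff)
  qed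
  ultimately have "card (?C (insert a S)) = card S * fact (card S - 1)"
    using insert.IH by (simp add: card_image card_cartesian_product)
  also have "\<dots> = fact (card S)"
    using insert.hyps by (simp add: card_gt_0_iff fact_reduce)
  finally show ?case using insert.hyps by simp
qed

section \<open>Conjugacy and cycle types\<close>

lemma orbits_conjugate:
  assumes r: "r permutes S" and p: "p permutes S" "finite S"
  shows "orbit (r \<circ> p \<circ> inv r) ` S = (`) r ` orbit p ` S"
proof -
  have "orbit (r \<circ> p \<circ> inv r) (r x) = r ` orbit p x" for x
    by (rule orbit_inverse[symmetric])
      (use p r in \<open>auto simp: permutes_inverses permutation_permutes intro!: permutation_self_in_orbit\<close>)
  then have "(\<lambda>x. orbit (r \<circ> p \<circ> inv r) (r x)) ` S = (`) r ` orbit p ` S"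
    by (simp add: image_image)
  then show ?thesis
    by (metis image_image permutes_image[OF r])
qed

lemma card_orbits_conjugate:
  assumes r: "r permutes S" and p: "p permutes S" "finite S"
  shows "card (orbit (r \<circ> p \<circ> inv r) ` S) = card (orbit p ` S)"
  unfolding orbits_conjugate[OF assms]
  by (rule card_image) (use r in \<open>auto intro!: inj_onI dest: permutes_inj simp: inj_image_eq_iff\<close>)

lemma ex_bij_betw_if_image_mset_eq:
  assumes "finite A" "finite B" and eq: "image_mset f (mset_set A) = image_mset f (mset_set B)"
  shows "\<exists>h. bij_betw h A B \<and> (\<forall>x\<in>A. f (h x) = f x)"
proof -
  have "card A = card B" using arg_cong[OF eq, of size] by simp
  then obtain g where g: "bij_betw g A B" using assms finite_same_card_bij by blast
  then have "image_mset g (mset_set A) = mset_set B"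
    by (simp add: bij_betw_def image_mset_mset_set)
  then have "image_mset f (mset_set A) = image_mset (f \<circ> g) (mset_set A)"
    using eq by (simp flip: image_mset.compositionality)
  from image_mset_eq_implies_permutes[OF assms(1) this]
  obtain p where p: "p permutes A" "\<forall>x\<in>A. f x = (f \<circ> g) (p x)" by blast
  have "bij_betw (g \<circ> p) A B" using permutes_imp_bij[OF p(1)] g by (rule bij_betw_trans)
  then show ?thesis using p(2) by (intro exI[of _ "g \<circ> p"]) auto
qed

text \<open>Both orbits consist of the iterates of a base point with exponents below the common
  length. Matching equal exponents commutes with the two permutations.\<close>

lemma ex_orbit_equivariant_bij:
  assumes p: "permutation p" and q: "permutation q" and card: "card (orbit p a) = card (orbit q b)"
  shows "\<exists>f. bij_betw f (orbit p a) (orbit q b) \<and> (\<forall>x\<in>orbit p a. f (p x) = q (f x))"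
proof -
  have *: "bij_betw (\<lambda>i. (f ^^ i) c) {0..<card (orbit f c)} (orbit f c) \<and> (f ^^ card (orbit f c)) c = c"
    if "permutation f" for f :: "'c \<Rightarrow> 'c" and c
  proof -
    have c: "c \<in> orbit f c" using that by (rule permutation_self_in_orbit)
    note inj = inj_on_funpow_dist1[OF c] and im = orbit_conv_funpow_dist1[OF c]
    have "card (orbit f c) = funpow_dist1 f c c"
      using card_image[OF inj] im by simp
    then show ?thesis using inj im funpow_dist1_prop[OF c] by (simp add: bij_betw_def)
  qed
  let ?k = "card (orbit p a)" and ?P = "\<lambda>i. (p ^^ i) a" and ?Q = "\<lambda>i. (q ^^ i) b"
  have P: "bij_betw ?P {0..<?k} (orbit p a)" "?P ?k = a" using *[OF p] by auto
  have Q: "bij_betw ?Q {0..<?k} (orbit q b)" "?Q ?k = b" using *[OF q, of b] card by auto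
  define f where "f = ?Q \<circ> inv_into {0..<?k} ?P"
  have bij: "bij_betw f (orbit p a) (orbit q b)"
    unfolding f_def using bij_betw_inv_into[OF P(1)] Q(1) by (rule bij_betw_trans)
  \<comment> \<open>The end point \<open>i = ?k\<close>, where both iterations close up, is included
    because the last step compares exponent \<open>i\<close> with \<open>Suc i\<close>.\<close>
  have fP: "f (?P i) = ?Q i" if "i \<le> ?k" for i
  proof (cases "i < ?k")
    case True
    then show ?thesis unfolding f_def
      using P(1) inv_into_f_f[of ?P "{0..<?k}" i] by (simp add: bij_betw_def)
  next
    case False
    then have "i = ?k" using that by simp
    moreover have "0 < ?k" using P(1) orbit_nonempty[of p a] by (auto simp: bij_betw_def)
    then have "f (?P 0) = ?Q 0" unfolding f_def
      using P(1) inv_into_f_f[of ?P "{0..<?k}" 0] by (simp add: bij_betw_def)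
    ultimately show ?thesis using P(2) Q(2) by simp
  qed
  have "f (p x) = q (f x)" if "x \<in> orbit p a" for x
  proof -
    have "x \<in> ?P ` {0..<?k}" using that bij_betw_imp_surj_on[OF P(1)] by simp
    then obtain i where "i < ?k" "x = ?P i" by auto
    then show ?thesis using fP[of i] fP[of "Suc i"] by simp
  qed
  then show ?thesis using bij by blast
qed

text \<open>The conjugating permutation is glued from intertwining bijections of single orbits, once
  the orbits of \<open>p\<close> are matched with orbits of \<open>q\<close> of equal size.\<close>

lemma conjugate_if_same_cycle_type:
  assumes S: "finite S" and p: "p permutes S" and q: "q permutes S"
    and type: "image_mset card (mset_set (orbit p ` S)) = image_mset card (mset_set (orbit q ` S))"
  shows "\<exists>r. r permutes S \<and> q = r \<circ> p \<circ> inv r"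
proof -
  have pp: "permutation p" and pq: "permutation q" using S p q by (auto simp: permutation_permutes)
  obtain h where h: "bij_betw h (orbit p ` S) (orbit q ` S)" "\<forall>C\<in>orbit p ` S. card (h C) = card C"
    using ex_bij_betw_if_image_mset_eq[OF _ _ type] S by auto
  have "\<exists>f. bij_betw f C (h C) \<and> (\<forall>x\<in>C. f (p x) = q (f x))" if C: "C \<in> orbit p ` S" for C
  proof -
    obtain a where a: "C = orbit p a" using C by blast
    have "h C \<in> orbit q ` S" using C h(1) unfolding bij_betw_def by blast
    then obtain b where b: "h C = orbit q b" by blast
    show ?thesis using ex_orbit_equivariant_bij[OF pp pq] a b h(2) C by metis
  qed
  then obtain F where F: "\<And>C. C \<in> orbit p ` S \<Longrightarrow> bij_betw (F C) C (h C)"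
    "\<And>C x. C \<in> orbit p ` S \<Longrightarrow> x \<in> C \<Longrightarrow> F C (p x) = q (F C x)" by metis
  define g where "g x = F (orbit p x) x" for x
  have self: "x \<in> orbit p x" for x using pp by (rule permutation_self_in_orbit)
  have gh: "g x \<in> h (orbit p x)" if "x \<in> S" for x
    using F(1)[of "orbit p x"] that self unfolding g_def by (auto simp: bij_betw_def)
  have hq: "h (orbit p x) \<in> orbit q ` S" if "x \<in> S" for x
    using h(1) that by (auto simp: bij_betw_def)
  have "inj_on g S"
  proof (rule inj_onI)
    fix x y assume xy: "x \<in> S" "y \<in> S" "g x = g y"
    have "h (orbit p x) = orbit q (g x)" if "x \<in> S" for x
      using hq[OF that] gh[OF that] orbit_eq_if_mem[OF pq] by (metis imageE)
    then have "h (orbit p x) = h (orbit p y)" using xy by metis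
    then have "orbit p x = orbit p y" using h(1) xy by (auto simp: bij_betw_def dest: inj_onD)
    then show "x = y"
      using xy F(1)[of "orbit p x"] self unfolding g_def bij_betw_def by (metis image_eqI inj_onD)
  qed
  moreover have "g ` S \<subseteq> S"
    using gh hq permutes_orbit_subset[OF q] by blast
  ultimately have bij: "bij_betw g S S"
    using S by (simp add: bij_betw_def endo_inj_surj)
  define r where "r = restrict_id g S"
  have r: "r permutes S" unfolding r_def using bij by (rule permutes_restrict_id)
  have rp: "r (p x) = q (r x)" for x
  proof (cases "x \<in> S")
    case True
    moreover have "orbit p (p x) = orbit p x" using pp by (rule permutation_orbit_step)
    ultimately show ?thesis
      using F(2)[of "orbit p x" x] self permutes_in_image[OF p] unfolding r_def g_def by simp
  next
    case False
    then show ?thesis using p q unfolding r_def by (simp add: permutes_not_in)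
  qed
  have "q = r \<circ> p \<circ> inv r"
    by (rule ext) (simp add: rp permutes_inverses[OF r])
  then show ?thesis using r by blast
qed

lemma single_orbit_iff:
  assumes p: "p permutes S" "finite S" and S: "S \<noteq> {}"
  shows "card (orbit p ` S) = 1 \<longleftrightarrow> orbit p ` S = {S}"
proof
  assume "card (orbit p ` S) = 1"
  then obtain C where C: "orbit p ` S = {C}" by (auto simp: card_1_singleton_iff)
  have "x \<in> orbit p x" for x
    using p by (meson permutation_permutes permutation_self_in_orbit)
  then have "S \<subseteq> C" using C by blast
  moreover have "C \<subseteq> S" using C S permutes_orbit_subset[OF p(1)] by blast
  ultimately show "orbit p ` S = {S}" using C by simp
qed simp

text \<open>A full cycle is put on a block of size \<open>l\<close>, and the remaining parts are
  realised on the complement; the supports are disjoint, so the orbits of the two factors are those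
  of the composite.\<close>

lemma ex_permutation_with_cycle_type:
  fixes \<nu> :: "nat multiset"
  assumes "finite S" "card S = sum_mset \<nu>" "0 \<notin># \<nu>"
  shows "\<exists>p. p permutes S \<and> image_mset card (mset_set (orbit p ` S)) = \<nu>"
  using assms
proof (induction \<nu> arbitrary: S)
  case empty
  then show ?case by (intro exI[of _ id]) auto
next
  case (add l \<nu>)
  obtain T where T: "T \<subseteq> S" "card T = l" "finite T"
    using obtain_subset_with_card_n[of l S] add.prems by auto
  have "T \<noteq> {}" using T add.prems by auto
  have "card (S - T) = sum_mset \<nu>" using T add.prems by (simp add: card_Diff_subset)
  then obtain p where p: "p permutes S - T" "image_mset card (mset_set (orbit p ` (S - T))) = \<nu>"
    using add.IH[of "S - T"] add.prems by auto
  have "card {c. c permutes T \<and> card (orbit c ` T) = 1} \<noteq> 0"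
    using card_single_orbit_permutations[OF T(3) \<open>T \<noteq> {}\<close>] by simp
  then obtain c where c: "c permutes T" "orbit c ` T = {T}"
    using single_orbit_iff[OF _ T(3) \<open>T \<noteq> {}\<close>] by (metis (mono_tags, lifting) card.empty empty_Collect_eq)
  let ?q = "c \<circ> p"
  have q: "?q permutes S"
    using c p T by (intro permutes_compose) (auto intro: permutes_subset)
  have "orbit ?q x = orbit c x" if "x \<in> T" for x
  proof (rule orbit_cong0[symmetric, of _ T])
    show "c \<in> T \<rightarrow> T" using c by (auto simp: permutes_in_image)
    show "c y = ?q y" if "y \<in> T" for y using that p by (simp add: permutes_not_in)
  qed (use that in auto)
  then have 1: "orbit ?q ` T = {T}" using c by (metis image_cong)
  have "orbit ?q x = orbit p x" if "x \<in> S - T" for x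
  proof (rule orbit_cong0[symmetric, of _ "S - T"])
    show "p \<in> S - T \<rightarrow> S - T" using permutes_in_image[OF p(1)] by auto
    show "p y = ?q y" if "y \<in> S - T" for y
      using that permutes_in_image[OF p(1), of y] c by (simp add: permutes_not_in)
  qed (use that in auto)
  then have 2: "orbit ?q ` (S - T) = orbit p ` (S - T)" by (metis image_cong)
  have "orbit ?q ` S = orbit ?q ` T \<union> orbit ?q ` (S - T)" using T by blast
  then have "orbit ?q ` S = insert T (orbit p ` (S - T))" using 1 2 by simp
  moreover have "T \<notin> orbit p ` (S - T)"
    using permutes_orbit_subset[OF p(1)] \<open>T \<noteq> {}\<close> by blast
  ultimately have "image_mset card (mset_set (orbit ?q ` S)) = add_mset l \<nu>"
    using p T add.prems by simp
  then show ?case using q by blast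
qed

section \<open>Inverses in the group algebra and Jucys' formula\<close>

lemma sum_swap_comp:
  assumes "a \<in> S" "b \<in> S"
  shows "(\<Sum>p | p permutes S. f (swap a b \<circ> p)) = (\<Sum>p | p permutes S. f p)"
  using setum_permutations_compose_left[OF permutes_swap_id[OF assms], of f] by simp

lemma sum_mult_diff_sum:
  fixes f g :: "'a \<Rightarrow> 'r :: comm_ring_1"
  shows "(\<Sum>q\<in>P. f q * (g q - z * (\<Sum>s\<in>T. h s q)))
    = (\<Sum>q\<in>P. f q * g q) - z * (\<Sum>s\<in>T. \<Sum>q\<in>P. f q * h s q)"
proof -
  have "(\<Sum>q\<in>P. f q * (z * (\<Sum>s\<in>T. h s q))) = z * (\<Sum>q\<in>P. \<Sum>s\<in>T. f q * h s q)"
    by (simp add: sum_distrib_left mult_ac)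
  then show ?thesis by (simp add: right_diff_distrib sum_subtractf sum.swap[of _ T])
qed

text \<open>In convolution notation the hypothesis is \<open>X * G = 1\<close>. A class function is
  central, so \<open>G * X = 1\<close> too; and conjugating the hypothesis shows
  \<open>X' * G = 1\<close> for the conjugate \<open>X'\<close> of \<open>X\<close>. Hence
  \<open>X' = X' * (G * X) = (X' * G) * X = X\<close>.\<close>

lemma class_function_if_inverse:
  fixes X G :: "('a \<Rightarrow> 'a) \<Rightarrow> 'r :: comm_ring_1"
  assumes S: "finite S"
    and G: "\<And>p r. p permutes S \<Longrightarrow> r permutes S \<Longrightarrow> G (r \<circ> p \<circ> inv r) = G p"
    and XG: "\<And>p. p permutes S \<Longrightarrow> (\<Sum>q | q permutes S. X (p \<circ> inv q) * G q) = of_bool (p = id)"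
    and r: "r permutes S" and p: "p permutes S"
  shows "X (r \<circ> p \<circ> inv r) = X p"
proof -
  let ?P = "{q. q permutes S}"
  have fin: "finite ?P" using S by (rule finite_permutations)
  define X' where "X' p = X (r \<circ> p \<circ> inv r)" for p
  have X'G: "(\<Sum>q\<in>?P. X' (p \<circ> inv q) * G q) = of_bool (p = id)" if p: "p permutes S" for p
  proof -
    have "(\<Sum>q\<in>?P. X' (p \<circ> inv q) * G q)
        = (\<Sum>q\<in>?P. X ((r \<circ> p \<circ> inv r) \<circ> inv q) * G q)"
    proof (rule sum.reindex_bij_witness[of _ "\<lambda>q. inv r \<circ> q \<circ> r" "\<lambda>q. r \<circ> q \<circ> inv r"])
      fix q assume "q \<in> ?P"
      then have q: "q permutes S" by simp
      show "inv r \<circ> (r \<circ> q \<circ> inv r) \<circ> r = q" "r \<circ> (inv r \<circ> q \<circ> r) \<circ> inv r = q"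
        by (simp_all add: fun_eq_iff permutes_inverses[OF r])
      show "r \<circ> q \<circ> inv r \<in> ?P" "inv r \<circ> q \<circ> r \<in> ?P"
        using q r by (simp_all add: permutes_compose permutes_inv)
      have "inv (r \<circ> q \<circ> inv r) = r \<circ> inv q \<circ> inv r"
        using q r by (simp add: o_inv_distrib permutes_bij bij_comp bij_imp_bij_inv inv_inv_eq fun_eq_iff)
      then have "X (r \<circ> p \<circ> inv r \<circ> inv (r \<circ> q \<circ> inv r)) = X' (p \<circ> inv q)"
        unfolding X'_def by (intro arg_cong[where f = X]) (simp add: fun_eq_iff permutes_inverses[OF r])
      then show "X (r \<circ> p \<circ> inv r \<circ> inv (r \<circ> q \<circ> inv r)) * G (r \<circ> q \<circ> inv r) = X' (p \<circ> inv q) * G q"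
        using G[OF q r] by simp
    qed
    also have "\<dots> = of_bool (r \<circ> p \<circ> inv r = id)"
      using p r by (intro XG permutes_compose permutes_inv)
    also have "r \<circ> p \<circ> inv r = id \<longleftrightarrow> p = id"
    proof
      assume *: "r \<circ> p \<circ> inv r = id"
      have "p = inv r \<circ> (r \<circ> p \<circ> inv r) \<circ> r" by (simp add: fun_eq_iff permutes_inverses[OF r])
      also have "\<dots> = id" unfolding * by (simp add: fun_eq_iff permutes_inverses[OF r])
      finally show "p = id" .
    qed (simp add: fun_eq_iff permutes_inverses[OF r])
    finally show ?thesis .
  qed
  \<comment> \<open>Centrality of \<open>G\<close>: it takes the same value at
    \<open>p \<circ> inv q\<close> and at the conjugate \<open>inv q \<circ> p\<close>.\<close>
  have GX: "(\<Sum>q\<in>?P. G (p \<circ> inv q) * X q) = of_bool (p = id)" if p: "p permutes S" for p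
  proof -
    have "(\<Sum>q\<in>?P. G (p \<circ> inv q) * X q) = (\<Sum>q\<in>?P. X (p \<circ> inv q) * G q)"
    proof (rule sum.reindex_bij_witness[of _ "\<lambda>q. p \<circ> inv q" "\<lambda>q. inv q \<circ> p"])
      fix q assume "q \<in> ?P"
      then have q: "q permutes S" by simp
      show "p \<circ> inv q \<in> ?P" "inv q \<circ> p \<in> ?P"
        using p q by (simp_all add: permutes_compose permutes_inv)
      have iq: "inv (p \<circ> inv q) = q \<circ> inv p"  "inv (inv q \<circ> p) = inv p \<circ> q"
        using p q by (simp_all add: o_inv_distrib permutes_bij bij_imp_bij_inv inv_inv_eq)
      show "inv (p \<circ> inv q) \<circ> p = q" "p \<circ> inv (inv q \<circ> p) = q"
        unfolding iq by (simp_all add: fun_eq_iff permutes_inverses[OF p])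
      then have "X (p \<circ> inv (inv q \<circ> p)) = X q" by simp
      moreover have "G (inv q \<circ> (p \<circ> inv q) \<circ> inv (inv q)) = G (p \<circ> inv q)"
        using p q by (intro G permutes_compose permutes_inv)
      moreover have "inv q \<circ> (p \<circ> inv q) \<circ> inv (inv q) = inv q \<circ> p"
        by (simp add: permutes_inv_inv[OF q] fun_eq_iff permutes_inverses[OF q])
      ultimately show "X (p \<circ> inv (inv q \<circ> p)) * G (inv q \<circ> p) = G (p \<circ> inv q) * X q"
        by simp
    qed
    also have "\<dots> = of_bool (p = id)" using p by (rule XG)
    finally show ?thesis .
  qed
  have "X' p = (\<Sum>q\<in>?P. X' (p \<circ> inv q) * of_bool (q = id))"
  proof -
    have "(\<Sum>q\<in>?P. X' (p \<circ> inv q) * of_bool (q = id)) = (\<Sum>q\<in>{id}. X' (p \<circ> inv q) * of_bool (q = id))"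
      using fin by (intro sum.mono_neutral_right) auto
    then show ?thesis by simp
  qed
  also have "\<dots> = (\<Sum>q\<in>?P. X' (p \<circ> inv q) * (\<Sum>u\<in>?P. G (q \<circ> inv u) * X u))"
    using GX by (intro sum.cong) auto
  also have "\<dots> = (\<Sum>u\<in>?P. X u * (\<Sum>q\<in>?P. X' (p \<circ> inv q) * G (q \<circ> inv u)))"
    unfolding sum_distrib_left by (subst sum.swap) (simp add: mult_ac)
  also have "\<dots> = (\<Sum>u\<in>?P. X u * of_bool (p \<circ> inv u = id))"
  proof (rule sum.cong[OF refl])
    fix u assume "u \<in> ?P"
    then have u: "u permutes S" by simp
    have "(\<Sum>q\<in>?P. X' (p \<circ> inv q) * G (q \<circ> inv u))
        = (\<Sum>q\<in>?P. X' (p \<circ> inv (q \<circ> u)) * G (q \<circ> u \<circ> inv u))"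
      by (rule sum_permutations_compose_right[OF u])
    also have "\<dots> = (\<Sum>q\<in>?P. X' (p \<circ> inv u \<circ> inv q) * G q)"
    proof (rule sum.cong[OF refl])
      fix q assume "q \<in> ?P"
      then have q: "q permutes S" by simp
      have "inv (q \<circ> u) = inv u \<circ> inv q"
        using q u by (simp add: o_inv_distrib permutes_bij)
      moreover have "q \<circ> u \<circ> inv u = q" by (simp add: fun_eq_iff permutes_inverses[OF u])
      ultimately show "X' (p \<circ> inv (q \<circ> u)) * G (q \<circ> u \<circ> inv u) = X' (p \<circ> inv u \<circ> inv q) * G q"
        by (simp add: comp_assoc)
    qed
    also have "\<dots> = of_bool (p \<circ> inv u = id)"
      using p u by (intro X'G permutes_compose permutes_inv)
    finally show "X u * (\<Sum>q\<in>?P. X' (p \<circ> inv q) * G (q \<circ> inv u)) = X u * of_bool (p \<circ> inv u = id)"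
      by simp
  qed
  also have "\<dots> = (\<Sum>u\<in>{p}. X u * of_bool (p \<circ> inv u = id))"
  proof (intro sum.mono_neutral_right ballI)
    fix u assume "u \<in> ?P - {p}"
    then have u: "u permutes S" "u \<noteq> p" by auto
    have "p \<circ> inv u \<noteq> id"
    proof
      assume *: "p \<circ> inv u = id"
      have "p = p \<circ> inv u \<circ> u" by (simp add: fun_eq_iff permutes_inverses[OF u(1)])
      then show False using * u by simp
    qed
    then show "X u * of_bool (p \<circ> inv u = id) = 0" by simp
  qed (use p fin in auto)
  also have "\<dots> = X p" using permutes_inv_o[OF p] by simp
  finally show ?thesis unfolding X'_def .
qed

text \<open>
  The sequence \<open>X\<close> is \<open>X\<^sub>m = ((1 - z J\<^sub>m) \<cdots> (1 - z J\<^sub>1))\<^sup>-\<^sup>1\<close> in the group algebra of the symmetric group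
  on \<open>{1..n}\<close>.
\<close>

locale jm_inverse =
  fixes n :: nat and z :: "'r :: {idom, semiring_char_0}" and X :: "nat \<Rightarrow> (nat \<Rightarrow> nat) \<Rightarrow> 'r"
  assumes X_0: "p permutes {1..n} \<Longrightarrow> X 0 p = of_bool (p = id)"
    and X_step: "m \<in> {1..n} \<Longrightarrow> p permutes {1..n} \<Longrightarrow>
      X m p - z * (\<Sum>s\<in>{1..<m}. X m (p \<circ> swap s m)) = X (m - 1) p"
begin

text \<open>The right-hand side of Jucys' formula for the product of the
  \<open>1 - z J\<^sub>k\<close> with \<open>k \<le> m\<close>. Starting from the closed form makes
  invariance under conjugation evident.\<close>

definition jucys_prod :: "nat \<Rightarrow> (nat \<Rightarrow> nat) \<Rightarrow> 'r" where
  "jucys_prod m p = (if p permutes {1..m} then (- z) ^ (m - card (orbit p ` {1..m})) else 0)"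

text \<open>This is left multiplication by \<open>1 - z J\<^sub>m\<close>. A permutation of
  \<open>{1..m}\<close> that moves \<open>m\<close> is in one way \<open>(s, m)\<close> times a
  permutation of \<open>{1..m-1}\<close>, namely with \<open>s\<close> the image of
  \<open>m\<close>. The splicing keeps the number of cycles, so the exponent of \<open>- z\<close>
  grows by one.\<close>

lemma jucys_prod_step:
  assumes m: "m \<in> {1..n}"
  shows "jucys_prod m p = jucys_prod (m - 1) p - z * (\<Sum>s\<in>{1..<m}. jucys_prod (m - 1) (swap s m \<circ> p))"
proof -
  have ins: "{1..m} = insert m {1..m-1}" using m by auto
  have m_notin: "m \<notin> {1..m-1}" using m by auto
  have zero: "jucys_prod (m - 1) (swap s m \<circ> p) = 0" if "s \<noteq> p m" "s \<in> {1..<m}" for s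
  proof -
    have "(swap s m \<circ> p) m \<noteq> m"
      using that by (auto simp: Transposition.transpose_def)
    then have "\<not> (swap s m \<circ> p) permutes {1..m-1}" using m_notin permutes_not_in by metis
    then show ?thesis by (simp add: jucys_prod_def)
  qed
  have up: "q permutes {1..m}" if "q permutes {1..m-1}" for q
    using that by (rule permutes_subset) auto
  consider "p permutes {1..m}" "p m = m" | "p permutes {1..m}" "p m \<noteq> m" | "\<not> p permutes {1..m}" by blast
  then show ?thesis
  proof cases
    case 1
    have p: "p permutes {1..m-1}"
      using permutes_insert_lemma[of p m "{1..m-1}"] 1 ins by simp
    have "card (orbit p ` {1..m}) = Suc (card (orbit p ` {1..m-1}))"
      unfolding ins by (rule card_orbits_insert_fixpoint[OF p _ m_notin]) simp
    then have "jucys_prod m p = jucys_prod (m - 1) p"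
      using 1 p m unfolding jucys_prod_def by simp
    moreover have "(\<Sum>s\<in>{1..<m}. jucys_prod (m - 1) (swap s m \<circ> p)) = 0"
      using 1 by (intro sum.neutral ballI zero) auto
    ultimately show ?thesis by simp
  next
    case 2
    let ?q = "swap (p m) m \<circ> p"
    have pm: "p m \<in> {1..m}" using permutes_in_image[OF 2(1), of m] m by simp
    then have pm': "p m \<in> {1..m-1}" using 2 by auto
    have q: "?q permutes {1..m-1}"
      using permutes_insert_lemma[of p m "{1..m-1}"] 2 ins by (simp add: transpose_commute)
    have pq: "p = swap m (p m) \<circ> ?q" by (simp add: fun_eq_iff transpose_commute)
    have "card (orbit p ` insert m {1..m-1}) = card (orbit ?q ` {1..m-1})"
      using card_orbits_swap_comp_insert[OF q _ m_notin pm'] unfolding pq[symmetric] by simp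
    then have card: "card (orbit p ` {1..m}) = card (orbit ?q ` {1..m-1})" unfolding ins .
    have "card (orbit ?q ` {1..m-1}) \<le> m - 1" using card_image_le[of "{1..m-1}" "orbit ?q"] by simp
    then have "m - card (orbit p ` {1..m}) = Suc (m - 1 - card (orbit ?q ` {1..m-1}))"
      unfolding card using m by auto
    then have "jucys_prod m p = - z * jucys_prod (m - 1) ?q"
      using 2 q unfolding jucys_prod_def by simp
    moreover have "\<not> p permutes {1..m-1}" using 2 m_notin by (auto simp: permutes_def)
    then have "jucys_prod (m - 1) p = 0" by (simp add: jucys_prod_def)
    moreover have "(\<Sum>s\<in>{1..<m}. jucys_prod (m - 1) (swap s m \<circ> p))
        = (\<Sum>s\<in>{p m}. jucys_prod (m - 1) (swap s m \<circ> p))"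
      using pm' zero by (intro sum.mono_neutral_right) auto
    ultimately show ?thesis by simp
  next
    case 3
    then have "\<not> p permutes {1..m-1}" using up by blast
    moreover have "\<not> (swap s m \<circ> p) permutes {1..m-1}" if "s \<in> {1..<m}" for s
    proof
      assume "(swap s m \<circ> p) permutes {1..m-1}"
      then have "swap s m \<circ> (swap s m \<circ> p) permutes {1..m}"
        using that m by (intro permutes_compose[OF up] permutes_swap_id) auto
      then show False using 3 by (simp flip: comp_assoc)
    qed
    ultimately show ?thesis using 3 by (simp add: jucys_prod_def)
  qed
qed

text \<open>The factor \<open>1 - z J\<^sub>m\<close> split off from \<open>jucys_prod m\<close> is
  moved over to \<open>X m\<close>, which turns the sum for \<open>m\<close> into the one for
  \<open>m - 1\<close>.\<close>

lemma convolution_jucys_prod: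
  assumes "m \<le> n" "p permutes {1..n}"
  shows "(\<Sum>q | q permutes {1..n}. X m (p \<circ> inv q) * jucys_prod m q) = of_bool (p = id)"
  using assms(1)
proof (induction m)
  case 0
  have "(\<Sum>q | q permutes {1..n}. X 0 (p \<circ> inv q) * jucys_prod 0 q)
     = (\<Sum>q\<in>{id}. X 0 (p \<circ> inv q) * jucys_prod 0 q)"
    by (intro sum.mono_neutral_right) (auto simp: finite_permutations jucys_prod_def)
  also have "\<dots> = X 0 p" by (simp add: jucys_prod_def)
  also have "\<dots> = of_bool (p = id)" by (rule X_0[OF assms(2)])
  finally show ?case .
next
  case (Suc m)
  let ?P = "{q. q permutes {1..n}}" and ?G = "jucys_prod m" and ?m = "Suc m"
  have "(\<Sum>q\<in>?P. X ?m (p \<circ> inv q) * jucys_prod ?m q)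
     = (\<Sum>q\<in>?P. X ?m (p \<circ> inv q) * ?G q)
       - z * (\<Sum>s\<in>{1..<?m}. \<Sum>q\<in>?P. X ?m (p \<circ> inv q) * ?G (swap s ?m \<circ> q))"
    unfolding sum_mult_diff_sum[symmetric]
    using Suc.prems jucys_prod_step[of ?m] by (intro sum.cong refl) simp
  also have "(\<Sum>s\<in>{1..<?m}. \<Sum>q\<in>?P. X ?m (p \<circ> inv q) * ?G (swap s ?m \<circ> q))
     = (\<Sum>s\<in>{1..<?m}. \<Sum>q\<in>?P. X ?m (p \<circ> inv q \<circ> swap s ?m) * ?G q)"
  proof (rule sum.cong[OF refl])
    fix s assume s: "s \<in> {1..<?m}"
    have "(\<Sum>q\<in>?P. X ?m (p \<circ> inv q) * ?G (swap s ?m \<circ> q))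
      = (\<Sum>q\<in>?P. X ?m (p \<circ> inv (swap s ?m \<circ> q)) * ?G (swap s ?m \<circ> (swap s ?m \<circ> q)))"
      using s Suc.prems by (intro sum_swap_comp[symmetric]) auto
    also have "\<dots> = (\<Sum>q\<in>?P. X ?m (p \<circ> inv q \<circ> swap s ?m) * ?G q)"
      by (intro sum.cong refl) (auto simp: o_inv_distrib permutes_bij simp flip: comp_assoc)
    finally show "(\<Sum>q\<in>?P. X ?m (p \<circ> inv q) * ?G (swap s ?m \<circ> q))
      = (\<Sum>q\<in>?P. X ?m (p \<circ> inv q \<circ> swap s ?m) * ?G q)" .
  qed
  also have "(\<Sum>q\<in>?P. X ?m (p \<circ> inv q) * ?G q) - z * \<dots>
     = (\<Sum>q\<in>?P. (X ?m (p \<circ> inv q) - z * (\<Sum>s\<in>{1..<?m}. X ?m (p \<circ> inv q \<circ> swap s ?m))) * ?G q)"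
    unfolding mult.commute[of _ "?G _"] sum_mult_diff_sum ..
  also have "\<dots> = (\<Sum>q\<in>?P. X m (p \<circ> inv q) * ?G q)"
    using Suc.prems assms X_step[of ?m]
    by (intro sum.cong refl) (auto simp: permutes_compose permutes_inv)
  also have "\<dots> = of_bool (p = id)" by (rule Suc.IH) (use Suc.prems in simp)
  finally show ?case .
qed

text \<open>The index is \<open>n\<close> because for smaller \<open>m\<close> the support of
  \<open>jucys_prod m\<close> is contained in the permutations of \<open>{1..m}\<close>, which in
  general are not stable under conjugation by permutations of \<open>{1..n}\<close>.\<close>

lemma X_class_function:
  assumes "r permutes {1..n}" "p permutes {1..n}"
  shows "X n (r \<circ> p \<circ> inv r) = X n p"
proof (rule class_function_if_inverse[OF _ _ _ assms])
  show "jucys_prod n (r \<circ> p \<circ> inv r) = jucys_prod n p" if "p permutes {1..n}" "r permutes {1..n}" for p r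
    unfolding jucys_prod_def using that card_orbits_conjugate[OF that(2,1)]
    by (simp add: permutes_compose permutes_inv)
qed (rule finite_atLeastAtMost, rule convolution_jucys_prod[OF le_refl])

lemma X_eq_if_same_cycle_type:
  assumes "p permutes {1..n}" "q permutes {1..n}"
    and "image_mset card (mset_set (orbit p ` {1..n})) = image_mset card (mset_set (orbit q ` {1..n}))"
  shows "X n p = X n q"
  using conjugate_if_same_cycle_type[OF _ assms] X_class_function assms by auto

end

section \<open>Hook functionals\<close>

definition stabilizer :: "'a set \<Rightarrow> 'a set \<Rightarrow> ('a \<Rightarrow> 'a) set" where
  "stabilizer S A = {t. t permutes S \<and> t ` A = A}"

text \<open>On the stabilizer of a finite \<open>A\<close> this is the sign of \<open>t\<close> on
  \<open>A\<close> times \<open>(-1) ^ card A\<close>. In the form of an orbit count, joining a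
  further orbit to \<open>A\<close> visibly flips the value; the cancellation over \<open>A\<close>
  rests on this.\<close>

definition orbit_sign :: "'a set \<Rightarrow> ('a \<Rightarrow> 'a) \<Rightarrow> 'r :: comm_ring_1" where
  "orbit_sign A t = (- 1) ^ card (orbit t ` A)"

text \<open>
  Up to the factor \<open>(-1)\<^bsup>|A|\<^esup>\<close>, this is the matrix coefficient at a Young vector of the hook
  representation with leg length \<open>|A| - 1\<close>, so the Jucys--Murphy elements act on it by the contents of
  the hook.
\<close>

definition hook_functional :: "'a set \<Rightarrow> 'a \<Rightarrow> 'a set \<Rightarrow> (('a \<Rightarrow> 'a) \<Rightarrow> 'r) \<Rightarrow> 'r :: comm_ring_1" where
  "hook_functional S a A Y =
    (\<Sum>t\<in>stabilizer S A. orbit_sign A t * (Y t + (\<Sum>x\<in>S - A. Y (swap a x \<circ> t))))"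

lemma finite_stabilizer: "finite S \<Longrightarrow> finite (stabilizer S A)"
  unfolding stabilizer_def by (rule finite_subset[OF _ finite_permutations]) auto

lemma stabilizer_comp: "t \<in> stabilizer S A \<Longrightarrow> u \<in> stabilizer S A \<Longrightarrow> t \<circ> u \<in> stabilizer S A"
  unfolding stabilizer_def by (metis (mono_tags, lifting) image_comp mem_Collect_eq permutes_compose)

lemma stabilizer_bij_betw: "t \<in> stabilizer S A \<Longrightarrow> bij_betw t A A"
  by (auto simp: stabilizer_def bij_betw_def intro: permutes_inj_on)

lemma stabilizer_mem_iff: "t \<in> stabilizer S A \<Longrightarrow> t x \<in> A \<longleftrightarrow> x \<in> A"
  unfolding stabilizer_def by (metis (mono_tags, lifting) inj_image_mem_iff mem_Collect_eq permutes_inj)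

lemma stabilizer_permutes: "t \<in> stabilizer S A \<Longrightarrow> t permutes S"
  by (simp add: stabilizer_def)

lemma orbit_sign_eq_sign_on:
  assumes "finite A" and t: "t \<in> stabilizer S A"
  shows "orbit_sign A t = of_int (sign_on A t) * (- 1) ^ card A"
proof -
  let ?r = "restrict_id t A"
  have r: "?r permutes A" using stabilizer_bij_betw[OF t] by (rule permutes_restrict_id)
  have "orbit ?r x = orbit t x" if "x \<in> A" for x
  proof (rule orbit_cong0[of _ A])
    show "?r \<in> A \<rightarrow> A" using permutes_in_image[OF r] by auto
  qed (use that in auto)
  then have "orbit ?r ` A = orbit t ` A" by (rule image_cong[OF refl])
  then have "(- 1) ^ card (orbit t ` A) = sign_on A t * (- 1) ^ card A"
    using sign_eq_card_orbits[OF assms(1) r] by (simp add: sign_on_def)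
  then have "of_int ((- 1) ^ card (orbit t ` A)) = (of_int (sign_on A t * (- 1) ^ card A) :: 'b)"
    by simp
  then show ?thesis by (simp add: orbit_sign_def)
qed

text \<open>Read with \<open>c = t k\<close>: the map taking \<open>(t, x)\<close> to
  \<open>(swap a y \<circ> (swap x c \<circ> t), c)\<close> is an involution, and it preserves the
  permutation \<open>swap a x \<circ> swap y c \<circ> t\<close>. This pairs off the terms with four
  distinct points in the sum over \<open>(s, k)\<close>.\<close>

lemma swap_involution:
  assumes "distinct [a, y, x, c]"
  shows "swap a y \<circ> (swap c x \<circ> (swap a y \<circ> (swap x c \<circ> t))) = t"
    and "swap a c \<circ> swap y x \<circ> (swap a y \<circ> (swap x c \<circ> t)) = swap a x \<circ> swap y c \<circ> t"
proof -
  have "swap a y (swap c x (swap a y (swap x c v))) = v"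
    "swap a c (swap y x (swap a y (swap x c v))) = swap a x (swap y c v)" for v
    using assms by (cases "v \<in> {a, y, x, c}"; auto)+
  then show "swap a y \<circ> (swap c x \<circ> (swap a y \<circ> (swap x c \<circ> t))) = t"
    "swap a c \<circ> swap y x \<circ> (swap a y \<circ> (swap x c \<circ> t)) = swap a x \<circ> swap y c \<circ> t"
    by (simp_all add: fun_eq_iff)
qed

lemma swap_swap_comp:
  assumes "a \<noteq> c" "a \<noteq> x" "x \<noteq> c"
  shows "swap a c \<circ> (swap x c \<circ> t) = swap a x \<circ> swap a c \<circ> t"
proof -
  have "swap a c (swap x c v) = swap a x (swap a c v)" for v
    using assms by (cases "v \<in> {a, x, c}") auto
  then show ?thesis by (simp add: fun_eq_iff)
qed

section \<open>The action of transpositions on a hook functional\<close>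

locale hook =
  fixes S :: "'a set" and A :: "'a set" and a :: 'a
  assumes finite_S: "finite S" and A_subset: "A \<subseteq> S" and a_mem: "a \<in> A"
begin

lemma finite_A: "finite A"
  using finite_S A_subset by (rule rev_finite_subset)

lemma swap_mem_stabilizer:
  assumes "x \<in> S" "y \<in> S" "x \<in> A \<longleftrightarrow> y \<in> A"
  shows "swap x y \<in> stabilizer S A"
  using assms by (simp add: stabilizer_def permutes_swap_id)

lemma swap_sign:
  assumes "x \<in> S" "y \<in> S" "x \<in> A \<longleftrightarrow> y \<in> A" and t: "t \<in> stabilizer S A"
  shows "orbit_sign A (swap x y \<circ> t) = (if x \<in> A \<and> x \<noteq> y then - orbit_sign A t else orbit_sign A t)"
    and "orbit_sign A (t \<circ> swap x y) = (if x \<in> A \<and> x \<noteq> y then - orbit_sign A t else orbit_sign A t)"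
proof -
  have sw: "swap x y \<in> stabilizer S A" using assms by (intro swap_mem_stabilizer)
  have "sign_on A (swap x y) = (if x \<in> A \<and> x \<noteq> y then - 1 else 1)"
  proof (cases "x \<in> A \<and> x \<noteq> y")
    case True
    then show ?thesis using assms(3) sign_on_transpose[of x A y] by metis
  next
    case False
    have "swap x y c = id c" if "c \<in> A" for c
      using that False assms(3) by (cases "c = x \<or> c = y") auto
    then have "sign_on A (swap x y) = sign_on A id"
      by (rule sign_on_cong[OF refl])
    then show ?thesis using False by (metis sign_on_id)
  qed
  note sign = this
  show "orbit_sign A (swap x y \<circ> t) = (if x \<in> A \<and> x \<noteq> y then - orbit_sign A t else orbit_sign A t)"
    unfolding orbit_sign_eq_sign_on[OF finite_A t] orbit_sign_eq_sign_on[OF finite_A stabilizer_comp[OF sw t]]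
      sign_on_compose[OF stabilizer_bij_betw[OF sw] stabilizer_bij_betw[OF t] finite_A] sign
    by simp
  show "orbit_sign A (t \<circ> swap x y) = (if x \<in> A \<and> x \<noteq> y then - orbit_sign A t else orbit_sign A t)"
    unfolding orbit_sign_eq_sign_on[OF finite_A t] orbit_sign_eq_sign_on[OF finite_A stabilizer_comp[OF t sw]]
      sign_on_compose[OF stabilizer_bij_betw[OF t] stabilizer_bij_betw[OF sw] finite_A] sign
    by simp
qed

lemma sum_stabilizer_swap:
  assumes "x \<in> S" "y \<in> S" "x \<in> A \<longleftrightarrow> y \<in> A"
  shows "(\<Sum>t\<in>stabilizer S A. f (swap x y \<circ> t)) = (\<Sum>t\<in>stabilizer S A. f t)"
    and "(\<Sum>t\<in>stabilizer S A. f (t \<circ> swap x y)) = (\<Sum>t\<in>stabilizer S A. f t)"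
proof -
  note st = stabilizer_comp[OF swap_mem_stabilizer[OF assms]] stabilizer_comp[OF _ swap_mem_stabilizer[OF assms]]
  show "(\<Sum>t\<in>stabilizer S A. f (swap x y \<circ> t)) = (\<Sum>t\<in>stabilizer S A. f t)"
    by (rule sum.reindex_bij_witness[of _ "\<lambda>t. swap x y \<circ> t" "\<lambda>t. swap x y \<circ> t"])
      (auto simp: st simp flip: comp_assoc)
  show "(\<Sum>t\<in>stabilizer S A. f (t \<circ> swap x y)) = (\<Sum>t\<in>stabilizer S A. f t)"
    by (rule sum.reindex_bij_witness[of _ "\<lambda>t. t \<circ> swap x y" "\<lambda>t. t \<circ> swap x y"])
      (auto simp: st comp_assoc)
qed

text \<open>A transposition in the stabilizer is absorbed on the right by reindexing
  \<open>t\<close>, without touching the left factors \<open>swap a x\<close>. What remains is its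
  sign on \<open>A\<close>.\<close>

lemma hook_functional_swap:
  assumes "x \<in> S" "y \<in> S" "x \<in> A \<longleftrightarrow> y \<in> A"
  shows "hook_functional S a A (\<lambda>p. Y (p \<circ> swap x y))
    = (if x \<in> A \<and> x \<noteq> y then - hook_functional S a A Y else hook_functional S a A Y)"
proof -
  let ?f = "\<lambda>t. orbit_sign A (t \<circ> swap x y) * (Y t + (\<Sum>x\<in>S - A. Y (swap a x \<circ> t)))"
  have "hook_functional S a A (\<lambda>p. Y (p \<circ> swap x y)) = (\<Sum>t\<in>stabilizer S A. ?f (t \<circ> swap x y))"
    unfolding hook_functional_def by (simp add: comp_assoc)
  also have "\<dots> = (\<Sum>t\<in>stabilizer S A. ?f t)" by (rule sum_stabilizer_swap[OF assms])
  also have "\<dots> = (\<Sum>t\<in>stabilizer S A. (if x \<in> A \<and> x \<noteq> y then - 1 else 1) *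
      (orbit_sign A t * (Y t + (\<Sum>x\<in>S - A. Y (swap a x \<circ> t)))))"
    by (intro sum.cong refl) (simp add: swap_sign[OF assms])
  also have "\<dots> = (if x \<in> A \<and> x \<noteq> y then - 1 else 1) * hook_functional S a A Y"
    unfolding hook_functional_def by (rule sum_distrib_left[symmetric])
  finally show ?thesis by simp
qed

text \<open>Sign symmetry on \<open>A\<close> and trivial symmetry off \<open>A\<close> are shared
  by two neighbouring hooks; this relation selects one of them. The transposition is moved to the
  left of \<open>t\<close>, where \<open>(s, k)\<close> becomes \<open>(t s, t k)\<close>. The terms
  with \<open>t s = a\<close> reproduce the functional, all others cancel.\<close>

lemma hook_functional_sum_swap:
  fixes Y :: "('a \<Rightarrow> 'a) \<Rightarrow> 'r :: {idom, semiring_char_0}"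
  assumes k: "k \<in> S - A"
  shows "(\<Sum>s\<in>A. hook_functional S a A (\<lambda>p. Y (p \<circ> swap s k))) = hook_functional S a A Y"
proof -
  let ?B = "S - A" and ?T = "stabilizer S A" and ?e = "orbit_sign A :: _ \<Rightarrow> 'r"
  have finB: "finite ?B" and finT: "finite ?T" using finite_S finite_stabilizer by auto
  have aS: "a \<in> S" using a_mem A_subset by auto
  have tk: "t k \<in> ?B" if "t \<in> ?T" for t
    using that k permutes_in_image[OF stabilizer_permutes[OF that], of k] stabilizer_mem_iff[OF that, of k] by auto
  define P where "P t y = ?e t * (Y (swap y (t k) \<circ> t) + (\<Sum>x\<in>?B. Y (swap a x \<circ> swap y (t k) \<circ> t)))" for t y
  have "(\<Sum>s\<in>A. hook_functional S a A (\<lambda>p. Y (p \<circ> swap s k)))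
     = (\<Sum>t\<in>?T. \<Sum>s\<in>A. ?e t * (Y (t \<circ> swap s k) + (\<Sum>x\<in>?B. Y (swap a x \<circ> t \<circ> swap s k))))"
    unfolding hook_functional_def by (rule sum.swap)
  also have "\<dots> = (\<Sum>t\<in>?T. \<Sum>s\<in>A. P t (t s))"
  proof (intro sum.cong refl)
    fix t s assume t: "t \<in> ?T" and s: "s \<in> A"
    have "inj t" using stabilizer_permutes[OF t] by (rule permutes_inj)
    then have "t \<circ> swap s k = swap (t s) (t k) \<circ> t"
      by (auto simp: fun_eq_iff Transposition.transpose_def dest: injD)
    then show "?e t * (Y (t \<circ> swap s k) + (\<Sum>x\<in>?B. Y (swap a x \<circ> t \<circ> swap s k))) = P t (t s)"
      unfolding P_def by (simp add: comp_assoc)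
  qed
  also have "\<dots> = (\<Sum>t\<in>?T. \<Sum>y\<in>A. P t y)"
    using stabilizer_bij_betw by (intro sum.cong refl sum.reindex_bij_betw)
  also have "\<dots> = (\<Sum>t\<in>?T. P t a) + (\<Sum>y\<in>A - {a}. \<Sum>t\<in>?T. P t y)"
    using sum.remove[OF finite_A a_mem, of "P _"] by (simp add: sum.distrib sum.swap[of _ ?T])
  \<comment> \<open>For \<open>y \<noteq> a\<close>, replacing \<open>t\<close> by
    \<open>swap a y \<circ> t\<close> shows that the term \<open>x = t k\<close> of the inner sum
    cancels the isolated term; the other \<open>x\<close> cancel in pairs.\<close>
  also have "(\<Sum>y\<in>A - {a}. \<Sum>t\<in>?T. P t y) = 0"
  proof (rule sum.neutral, rule ballI)
    fix y assume "y \<in> A - {a}"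
    then have y: "y \<in> A" "y \<noteq> a" "y \<in> S" using A_subset by auto
    let ?Q = "\<lambda>t x. ?e t * Y (swap a x \<circ> swap y (t k) \<circ> t)"
    have "P t y = ?e t * Y (swap y (t k) \<circ> t) + ?Q t (t k) + (\<Sum>x\<in>?B - {t k}. ?Q t x)" if "t \<in> ?T" for t
      unfolding P_def using sum.remove[OF finB tk[OF that], of "?Q t"]
      by (simp add: distrib_left sum_distrib_left add.assoc)
    then have "(\<Sum>t\<in>?T. P t y) = (\<Sum>t\<in>?T. ?e t * Y (swap y (t k) \<circ> t)) + (\<Sum>t\<in>?T. ?Q t (t k))
      + (\<Sum>t\<in>?T. \<Sum>x\<in>?B - {t k}. ?Q t x)"
      by (simp add: sum.distrib)
    also have "(\<Sum>t\<in>?T. ?Q t (t k)) = - (\<Sum>t\<in>?T. ?e t * Y (swap y (t k) \<circ> t))"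
    proof -
      let ?f = "\<lambda>t. ?e (swap a y \<circ> t) * Y (swap y (t k) \<circ> t)"
      have "(\<Sum>t\<in>?T. ?Q t (t k)) = (\<Sum>t\<in>?T. ?f (swap a y \<circ> t))"
      proof (intro sum.cong refl)
        fix t assume t: "t \<in> ?T"
        have ne: "t k \<noteq> a" "t k \<noteq> y" using tk[OF t] y a_mem by auto
        then have "swap a (t k) \<circ> swap y (t k) = swap y (t k) \<circ> swap a y"
          using y by (auto simp: fun_eq_iff Transposition.transpose_def)
        then have 1: "swap a (t k) \<circ> swap y (t k) \<circ> t = swap y (t k) \<circ> (swap a y \<circ> t)"
          by (simp add: comp_assoc)
        have 2: "(swap a y \<circ> t) k = t k" using ne by simp
        have 3: "swap a y \<circ> (swap a y \<circ> t) = t" by (simp flip: comp_assoc)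
        show "?Q t (t k) = ?f (swap a y \<circ> t)" unfolding 1 2 3 ..
      qed
      also have "\<dots> = (\<Sum>t\<in>?T. ?f t)"
        using y a_mem aS by (intro sum_stabilizer_swap) auto
      also have "\<dots> = (\<Sum>t\<in>?T. - (?e t * Y (swap y (t k) \<circ> t)))"
        using y a_mem aS by (intro sum.cong refl) (simp add: swap_sign)
      finally show ?thesis by (simp add: sum_negf)
    qed
    also have "(\<Sum>t\<in>?T. \<Sum>x\<in>?B - {t k}. ?Q t x) = 0"
    proof -
      let ?G = "Sigma ?T (\<lambda>t. ?B - {t k})"
      let ?w = "\<lambda>(t, x). (swap a y \<circ> (swap x (t k) \<circ> t), t k)"
      have *: "(\<Sum>(t, x)\<in>?G. ?Q t x) = (\<Sum>(t, x)\<in>?G. - ?Q t x)"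
      proof (rule sum.reindex_bij_witness[of _ ?w ?w])
        fix w assume "w \<in> ?G"
        then obtain t x where w: "w = (t, x)" "t \<in> ?T" "x \<in> ?B" "x \<noteq> t k" by auto
        let ?t = "swap a y \<circ> (swap x (t k) \<circ> t)"
        note tkB = tk[OF w(2)]
        have ne: "t k \<noteq> a" "t k \<noteq> y" "x \<noteq> a" "x \<noteq> y" using tkB y a_mem w by auto
        have t': "swap x (t k) \<circ> t \<in> ?T"
          using w tkB by (intro stabilizer_comp swap_mem_stabilizer) auto
        have t'': "?t \<in> ?T"
          using y a_mem aS by (intro stabilizer_comp[OF _ t'] swap_mem_stabilizer) auto
        have k': "?t k = x" using ne by (simp add: Transposition.transpose_def)
        have dist: "distinct [a, y, x, t k]" using ne y w by auto
        show "?w (?w w) = w" "?w (?w w) = w"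
          unfolding w prod.case k' swap_involution(1)[OF dist] by (rule refl)+
        show "?w w \<in> ?G" "?w w \<in> ?G"
          unfolding w prod.case mem_Sigma_iff k' using t'' tkB w by auto
        note swap_involution(2)[OF dist, of t]
        moreover have "?e ?t = - ?e t"
          using w tkB y a_mem aS t' by (simp add: swap_sign)
        ultimately show "(case ?w w of (t, x) \<Rightarrow> - ?Q t x) = (case w of (t, x) \<Rightarrow> ?Q t x)"
          unfolding w prod.case k' by (simp only: mult_minus_left minus_minus)
      qed
      \<comment> \<open>The involution shows that the sum is its own negative, so division by 2 is
        where the assumptions on the ring enter.\<close>
      then have "2 * (\<Sum>(t, x)\<in>?G. ?Q t x) = 0"
        by (simp add: split_def sum_negf)
      then have "(\<Sum>(t, x)\<in>?G. ?Q t x) = 0" by simp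
      then show ?thesis using finT finB by (subst sum.Sigma) auto
    qed
    finally show "(\<Sum>t\<in>?T. P t y) = 0" by simp
  qed
  \<comment> \<open>For \<open>y = a\<close> the term \<open>x = t k\<close> collapses to
    \<open>Y t\<close>, and the isolated term supplies the summand \<open>x = t k\<close> of the
    functional. The other summands match after \<open>t\<close> is replaced by
    \<open>swap x (t k) \<circ> t\<close>.\<close>
  also have "(\<Sum>t\<in>?T. P t a) + 0 = hook_functional S a A Y"
  proof -
    let ?Q = "\<lambda>t x. ?e t * Y (swap a x \<circ> swap a (t k) \<circ> t)"
    have Q: "?Q t (t k) = ?e t * Y t" for t by simp
    have "P t a = ?e t * Y (swap a (t k) \<circ> t) + ?e t * Y t + (\<Sum>x\<in>?B - {t k}. ?Q t x)" if "t \<in> ?T" for t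
      unfolding P_def using sum.remove[OF finB tk[OF that], of "?Q t"] Q[of t]
      by (simp add: distrib_left sum_distrib_left add.assoc)
    then have "(\<Sum>t\<in>?T. P t a) = (\<Sum>t\<in>?T. ?e t * Y (swap a (t k) \<circ> t)) + (\<Sum>t\<in>?T. ?e t * Y t)
      + (\<Sum>t\<in>?T. \<Sum>x\<in>?B - {t k}. ?Q t x)"
      by (simp add: sum.distrib)
    also have "(\<Sum>t\<in>?T. \<Sum>x\<in>?B - {t k}. ?Q t x) = (\<Sum>t\<in>?T. \<Sum>x\<in>?B - {t k}. ?e t * Y (swap a x \<circ> t))"
    proof -
      let ?G = "Sigma ?T (\<lambda>t. ?B - {t k})"
      let ?w = "\<lambda>(t, x). (swap x (t k) \<circ> t, t k)"
      have *: "(\<Sum>(t, x)\<in>?G. ?Q t x) = (\<Sum>(t, x)\<in>?G. ?e t * Y (swap a x \<circ> t))"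
      proof (rule sum.reindex_bij_witness[of _ ?w ?w])
        fix w assume "w \<in> ?G"
        then obtain t x where w: "w = (t, x)" "t \<in> ?T" "x \<in> ?B" "x \<noteq> t k" by auto
        let ?t = "swap x (t k) \<circ> t"
        note tkB = tk[OF w(2)]
        have ne: "t k \<noteq> a" "x \<noteq> a" using tkB a_mem w by auto
        have t': "?t \<in> ?T"
          using w tkB by (intro stabilizer_comp swap_mem_stabilizer) auto
        have k': "?t k = x" by simp
        have inv: "swap (t k) x \<circ> (swap x (t k) \<circ> t) = t"
          by (simp add: fun_eq_iff transpose_commute[of x "t k"])
        show "?w (?w w) = w" "?w (?w w) = w"
          unfolding w prod.case k' inv by (rule refl)+
        show "?w w \<in> ?G" "?w w \<in> ?G"
          unfolding w prod.case mem_Sigma_iff k' using t' tkB w by auto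
        have "swap a (t k) \<circ> ?t = swap a x \<circ> swap a (t k) \<circ> t"
          using ne w by (intro swap_swap_comp) auto
        moreover have "?e ?t = ?e t"
          using w tkB by (simp add: swap_sign)
        ultimately show "(case ?w w of (t, x) \<Rightarrow> ?e t * Y (swap a x \<circ> t)) = (case w of (t, x) \<Rightarrow> ?Q t x)"
          unfolding w prod.case by simp
      qed
      then show ?thesis using finT finB by (subst (1 2) sum.Sigma) auto
    qed
    also have "(\<Sum>t\<in>?T. ?e t * Y (swap a (t k) \<circ> t)) + (\<Sum>t\<in>?T. ?e t * Y t)
        + (\<Sum>t\<in>?T. \<Sum>x\<in>?B - {t k}. ?e t * Y (swap a x \<circ> t))
      = (\<Sum>t\<in>?T. ?e t * Y t + (?e t * Y (swap a (t k) \<circ> t) + (\<Sum>x\<in>?B - {t k}. ?e t * Y (swap a x \<circ> t))))"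
      by (simp add: sum.distrib)
    also have "\<dots> = hook_functional S a A Y"
      unfolding hook_functional_def
    proof (intro sum.cong refl)
      fix t assume "t \<in> ?T"
      then show "?e t * Y t + (?e t * Y (swap a (t k) \<circ> t) + (\<Sum>x\<in>?B - {t k}. ?e t * Y (swap a x \<circ> t)))
        = ?e t * (Y t + (\<Sum>x\<in>?B. Y (swap a x \<circ> t)))"
        using sum.remove[OF finB tk, of t "\<lambda>x. ?e t * Y (swap a x \<circ> t)"]
        by (simp add: distrib_left sum_distrib_left)
    qed
    finally show ?thesis by simp
  qed
  finally show ?thesis .
qed

text \<open>Only \<open>t = id\<close> contributes: \<open>swap a x \<circ> t = id\<close> would
  force \<open>t x = a\<close>, but \<open>t\<close> preserves the complement of \<open>A\<close>,
  which contains \<open>x\<close>.\<close>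

lemma hook_functional_delta:
  "hook_functional S a A (\<lambda>p. of_bool (p = id)) = ((- 1) ^ card A :: 'r :: comm_ring_1)"
proof -
  have "hook_functional S a A (\<lambda>p. of_bool (p = id) :: 'r)
     = (\<Sum>t\<in>stabilizer S A. orbit_sign A t * of_bool (t = id))"
    unfolding hook_functional_def
  proof (intro sum.cong refl)
    fix t assume t: "t \<in> stabilizer S A"
    have "swap a x \<circ> t \<noteq> id" if "x \<in> S - A" for x
    proof
      assume *: "swap a x \<circ> t = id"
      have "t x \<notin> A" using stabilizer_mem_iff[OF t, of x] that by simp
      then have "t x \<noteq> a" using a_mem by auto
      moreover have "swap a x (t x) = x" using fun_cong[OF *, of x] by simp
      ultimately show False using that a_mem by (auto simp: Transposition.transpose_def split: if_splits)
    qed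
    then have "(\<Sum>x\<in>S - A. of_bool (swap a x \<circ> t = id) :: 'r) = 0"
      by (intro sum.neutral) auto
    then show "orbit_sign A t * (of_bool (t = id) + (\<Sum>x\<in>S - A. of_bool (swap a x \<circ> t = id)))
      = orbit_sign A t * (of_bool (t = id) :: 'r)" by simp
  qed
  also have "\<dots> = (\<Sum>t\<in>{id}. orbit_sign A t * of_bool (t = id))"
    by (intro sum.mono_neutral_right) (use finite_stabilizer[OF finite_S, of A] in \<open>auto simp: stabilizer_def\<close>)
  also have "\<dots> = (- 1) ^ card A"
    using orbit_sign_eq_sign_on[OF finite_A, of id S] by (simp add: stabilizer_def)
  finally show ?thesis .
qed

lemma hook_functional_cong:
  assumes "\<And>p. p permutes S \<Longrightarrow> Y p = Y' p"
  shows "hook_functional S a A Y = hook_functional S a A Y'"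
proof -
  have "swap a x \<circ> t permutes S" if "x \<in> S" "t \<in> stabilizer S A" for x t
    using that a_mem A_subset by (intro permutes_compose permutes_swap_id) (auto simp: stabilizer_def)
  then show ?thesis
    unfolding hook_functional_def
    using assms by (intro sum.cong refl arg_cong2[where f = times] arg_cong2[where f = plus])
      (auto simp: stabilizer_def)
qed

lemma hook_functional_diff_sum:
  "hook_functional S a A (\<lambda>p. Y p - z * (\<Sum>s\<in>T. h s p))
    = hook_functional S a A Y - z * (\<Sum>s\<in>T. hook_functional S a A (h s))"
proof -
  have "Y t - z * (\<Sum>s\<in>T. h s t) + (\<Sum>x\<in>S - A. Y (swap a x \<circ> t) - z * (\<Sum>s\<in>T. h s (swap a x \<circ> t)))
     = (Y t + (\<Sum>x\<in>S - A. Y (swap a x \<circ> t))) - z * (\<Sum>s\<in>T. h s t + (\<Sum>x\<in>S - A. h s (swap a x \<circ> t)))" for t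
    by (simp add: sum_subtractf sum_distrib_left sum.distrib sum.swap[of _ T] algebra_simps)
  then show ?thesis unfolding hook_functional_def by (simp only: sum_mult_diff_sum)
qed

end

section \<open>Summing the hook functionals over all \<open>A\<close>\<close>

lemma orbit_subset_invariant:
  assumes "t ` A = A" "y \<in> A"
  shows "orbit t y \<subseteq> A"
proof
  fix x assume "x \<in> orbit t y"
  then show "x \<in> A" by induction (use assms in auto)
qed

lemma orbit_image_self:
  assumes "permutation t"
  shows "t ` orbit t y = orbit t y"
proof
  show "t ` orbit t y \<subseteq> orbit t y" by (auto intro: orbit.step)
  show "orbit t y \<subseteq> t ` orbit t y"
  proof
    fix x assume "x \<in> orbit t y"
    then show "x \<in> t ` orbit t y"
      by cases (use permutation_self_in_orbit[OF assms] in auto)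
  qed
qed

lemma eq_singletonI: "b \<in> F \<Longrightarrow> (\<And>A. A \<in> F \<Longrightarrow> A = b) \<Longrightarrow> F = {b}"
  by blast

text \<open>If an orbit of \<open>t\<close> avoids \<open>a\<close> and \<open>x\<close>, then
  toggling it in \<open>A\<close> reverses the sign, and it is an orbit of \<open>p\<close> as well,
  so both sides vanish. Otherwise the orbits of \<open>a\<close> and \<open>x\<close> exhaust
  \<open>S\<close>, and the only candidate for \<open>A\<close> is the orbit of \<open>a\<close>. It
  is admissible exactly if \<open>x = a\<close> or \<open>x\<close> lies in the other orbit, which
  means that \<open>p\<close> is a full cycle.\<close>

lemma sum_orbit_sign_invariant_sets:
  fixes S :: "'a set"
  assumes S: "finite S" and a: "a \<in> S" and x: "x \<in> S" and p: "p permutes S"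
  defines "t \<equiv> swap a x \<circ> p"
  shows "(\<Sum>A | A \<subseteq> S \<and> a \<in> A \<and> t ` A = A \<and> (x = a \<or> x \<notin> A). orbit_sign A t)
    = (- of_bool (card (orbit p ` S) = 1) :: 'r :: {idom, semiring_char_0})"
    (is "sum _ ?F = _")
proof -
  have t: "t permutes S" unfolding t_def using a x p by (intro permutes_compose permutes_swap_id)
  have pt: "permutation t" and pp: "permutation p" using t p S by (auto simp: permutation_permutes)
  have p_eq: "p = swap a x \<circ> t" unfolding t_def by (simp add: fun_eq_iff)
  have finF: "finite ?F" using S by (intro finite_subset[of ?F "Pow S"]) auto
  have self: "y \<in> orbit t y" "y \<in> orbit p y" for y
    using pt pp by (auto intro: permutation_self_in_orbit)
  have sub: "orbit t y \<subseteq> S" "orbit p y \<subseteq> S" if "y \<in> S" for y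
    using that t p by (auto dest: permutes_orbit_subset)
  have orbits_on_orbit: "orbit t ` orbit t y = {orbit t y}" for y
  proof -
    have "orbit t v = orbit t y" if "v \<in> orbit t y" for v using orbit_eq_if_mem[OF pt that] .
    then have "orbit t ` orbit t y = (\<lambda>v. orbit t y) ` orbit t y" by (rule image_cong[OF refl])
    then show ?thesis using orbit_nonempty[of t y] by auto
  qed
  have avoid: "orbit p y = orbit t y" if "a \<notin> orbit t y" "x \<notin> orbit t y" for y
    unfolding p_eq using that by (rule orbit_swap_comp_avoiding[OF t S])
  have avoid': "orbit t y = orbit p y" if "a \<notin> orbit p y" "x \<notin> orbit p y" for y
    unfolding t_def using that by (rule orbit_swap_comp_avoiding[OF p S])
  show ?thesis
  proof (cases "\<exists>y\<in>S. a \<notin> orbit t y \<and> x \<notin> orbit t y")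
    case True
    then obtain y where y: "y \<in> S" "a \<notin> orbit t y" "x \<notin> orbit t y" by blast
    let ?C = "orbit t y"
    have "orbit p y = ?C" using avoid y by simp
    then have "orbit p a \<noteq> orbit p y" using y self(2)[of a] by auto
    then have not1: "card (orbit p ` S) \<noteq> 1"
      using a y by (metis card_1_singletonE image_eqI singletonD)
    have tC: "t ` ?C = ?C" using pt by (rule orbit_image_self)
    have flip: "orbit_sign (A \<union> ?C) t = (- orbit_sign A t :: 'r)"
      if "A \<subseteq> S" "A \<inter> ?C = {}" for A
    proof -
      have "orbit t ` ?C = {?C}" by (rule orbits_on_orbit)
      then have "orbit t ` (A \<union> ?C) = insert ?C (orbit t ` A)" by (simp add: image_Un)
      moreover have "?C \<notin> orbit t ` A"
      proof
        assume "?C \<in> orbit t ` A"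
        then obtain v where "v \<in> A" "?C = orbit t v" by blast
        then show False using that(2) self(1)[of v] by blast
      qed
      moreover have "finite A" using that S by (auto intro: finite_subset)
      ultimately show ?thesis by (simp add: orbit_sign_def)
    qed
    let ?Fdisj = "{A \<in> ?F. A \<inter> ?C = {}}" and ?Fsup = "{A \<in> ?F. ?C \<subseteq> A}"
    have split: "?F = ?Fdisj \<union> ?Fsup"
    proof -
      have "?C \<subseteq> A" if A: "A \<in> ?F" "A \<inter> ?C \<noteq> {}" for A
      proof -
        obtain v where v: "v \<in> A" "v \<in> ?C" using A(2) by blast
        have "t ` A = A" using A(1) by simp
        then show ?thesis
          using orbit_subset_invariant[of t A v] v(1) orbit_eq_if_mem[OF pt v(2)] by simp
      qed
      then have "?F \<subseteq> ?Fdisj \<union> ?Fsup" by (smt (verit) UnCI mem_Collect_eq subsetI)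
      moreover have "?Fdisj \<union> ?Fsup \<subseteq> ?F" by (intro Un_least Collect_restrict)
      ultimately show ?thesis by (rule equalityI)
    qed
    have "sum (\<lambda>A. orbit_sign A t) ?Fsup = (\<Sum>A\<in>?Fdisj. orbit_sign (A \<union> ?C) t :: 'r)"
    proof (rule sum.reindex_bij_witness[of _ "\<lambda>A. A \<union> ?C" "\<lambda>A. A - ?C"])
      fix A assume A: "A \<in> ?Fdisj"
      then show "A \<union> ?C - ?C = A" by blast
      show "A \<union> ?C \<in> ?Fsup" using A tC y sub(1)[OF y(1)] by (auto simp: image_Un)
    next
      fix A assume A: "A \<in> ?Fsup"
      then show *: "A - ?C \<union> ?C = A" by blast
      have "t ` (A - ?C) = t ` A - t ` ?C" using permutes_inj[OF t] by (rule image_set_diff)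
      then have "t ` (A - ?C) = A - ?C" using A tC by simp
      then show "A - ?C \<in> ?Fdisj" using A y by auto
      show "orbit_sign (A - ?C \<union> ?C) t = (orbit_sign A t :: 'r)" unfolding * ..
    qed
    also have "\<dots> = (\<Sum>A\<in>?Fdisj. - orbit_sign A t)"
      by (intro sum.cong refl flip) auto
    finally have F1: "sum (\<lambda>A. orbit_sign A t) ?Fsup = (- sum (\<lambda>A. orbit_sign A t) ?Fdisj :: 'r)"
      by (simp add: sum_negf)
    have "?Fdisj \<inter> ?Fsup = {}" using self(1)[of y] by auto
    then have "sum (\<lambda>A. orbit_sign A t) (?Fdisj \<union> ?Fsup)
        = (sum (\<lambda>A. orbit_sign A t) ?Fdisj + sum (\<lambda>A. orbit_sign A t) ?Fsup :: 'r)"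
      by (intro sum.union_disjoint finite_subset[OF Collect_restrict finF])
    then have "sum (\<lambda>A. orbit_sign A t) ?F = (0 :: 'r)"
      unfolding F1 split[symmetric] by (simp only: add.right_inverse)
    then show ?thesis using not1 by simp
  next
    case False
    have orb: "orbit t y = orbit t a \<or> orbit t y = orbit t x" if "y \<in> S" for y
    proof -
      have "a \<in> orbit t y \<or> x \<in> orbit t y" using False that by blast
      then show ?thesis using orbit_eq_if_mem[OF pt, of a y] orbit_eq_if_mem[OF pt, of x y] by auto
    qed
    then have "orbit t ` S \<subseteq> {orbit t a, orbit t x}" by (intro image_subsetI) simp
    then have orbs: "orbit t ` S = {orbit t a, orbit t x}"
      using imageI[OF a, of "orbit t"] imageI[OF x, of "orbit t"] by (intro equalityI) simp_all
    have "v \<in> orbit t a \<union> orbit t x" if "v \<in> S" for v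
      using orb[OF that] self(1)[of v] by auto
    then have S_eq: "S = orbit t a \<union> orbit t x" using sub(1)[OF a] sub(1)[OF x] by blast
    have invA: "orbit t a \<subseteq> A \<and> A \<inter> orbit t x = {}" if "A \<in> ?F" "x \<noteq> a" for A
    proof
      show "orbit t a \<subseteq> A" using that orbit_subset_invariant[of t A a] by auto
      show "A \<inter> orbit t x = {}"
      proof (rule ccontr)
        assume "A \<inter> orbit t x \<noteq> {}"
        then obtain v where v: "v \<in> A" "v \<in> orbit t x" by blast
        have "orbit t v \<subseteq> A" using that v orbit_subset_invariant[of t A v] by auto
        then show False using that orbit_eq_if_mem[OF pt v(2)] self(1)[of x] by auto
      qed
    qed
    have sgn1: "orbit_sign (orbit t a) t = (- 1 :: 'r)"
    proof -
      have "orbit t ` orbit t a = {orbit t a}" by (rule orbits_on_orbit)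
      then show ?thesis by (simp add: orbit_sign_def)
    qed
    have mem: "orbit t a \<in> ?F" if "x = a \<or> x \<notin> orbit t a"
      using that self(1) sub(1)[OF a] orbit_image_self[OF pt] by auto
    show ?thesis
    proof (cases "x = a")
      case True
      then have "t = p" unfolding t_def by simp
      have "A = orbit t a" if "A \<in> ?F" for A
      proof
        have A: "t ` A = A" "a \<in> A" "A \<subseteq> S" using that by simp_all
        show "orbit t a \<subseteq> A" using A(1,2) by (rule orbit_subset_invariant)
        show "A \<subseteq> orbit t a" using A(3) S_eq True by simp
      qed
      with mem True have "?F = {orbit t a}" by (intro eq_singletonI) blast+
      moreover have "card (orbit p ` S) = 1" using orbs True \<open>t = p\<close> by simp
      ultimately show ?thesis using sgn1 by simp
    next
      case ne: False
      \<comment> \<open>The sign stands in for an analysis of how cycles split and merge: the orbit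
        counts of \<open>p\<close> and \<open>t\<close> differ in parity, and this decides both
        cases below.\<close>
      have parity: "even (card (orbit p ` S)) \<longleftrightarrow> odd (card (orbit t ` S))"
      proof -
        have "sign t = - sign p"
          unfolding t_def using ne pp by (subst sign_compose) (auto simp: permutation_swap_id sign_swap_id)
        then have "(- 1) ^ card (orbit t ` S) = - ((- 1) ^ card (orbit p ` S) :: int)"
          using sign_eq_card_orbits[OF S t] sign_eq_card_orbits[OF S p] by simp
        then show ?thesis by (cases "even (card (orbit p ` S))"; cases "even (card (orbit t ` S))") auto
      qed
      show ?thesis
      proof (cases "orbit t a = orbit t x")
        case True
        then have "card (orbit t ` S) = 1" using orbs by simp
        then have "card (orbit p ` S) \<noteq> 1" using parity by auto
        moreover have False if "A \<in> ?F" for A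
          using invA[OF that ne] True self(1)[of x] by auto
        then have "?F = {}" by (rule equals0I)
        then have "sum (\<lambda>A. orbit_sign A t) ?F = (0 :: 'r)" by (simp only: sum.empty)
        ultimately show ?thesis by simp
      next
        case distinct: False
        then have "card (orbit t ` S) = 2" using orbs by simp
        then have odd: "odd (card (orbit p ` S))" using parity by auto
        have "orbit p y = orbit p a \<or> orbit p y = orbit p x" if y: "y \<in> S" for y
        proof -
          have "a \<in> orbit p y \<or> x \<in> orbit p y"
            using avoid'[of y] False y by auto
          then show ?thesis using orbit_eq_if_mem[OF pp, of a y] orbit_eq_if_mem[OF pp, of x y] by auto
        qed
        then have "orbit p ` S \<subseteq> {orbit p a, orbit p x}" by blast
        then have "card (orbit p ` S) \<le> card {orbit p a, orbit p x}" by (intro card_mono) auto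
        also have "\<dots> \<le> 2" by (simp add: card_insert_if)
        finally have card1: "card (orbit p ` S) = 1"
          using odd by (auto simp: le_Suc_eq numeral_2_eq_2)
        have "x \<notin> orbit t a" using distinct orbit_eq_if_mem[OF pt, of x a] by auto
        then have "orbit t a \<in> ?F" using mem by blast
        moreover have "A = orbit t a" if "A \<in> ?F" for A
          using invA[OF that ne] that S_eq by auto
        ultimately have "?F = {orbit t a}" by (rule eq_singletonI)
        then show ?thesis using sgn1 card1 by simp
      qed
    qed
  qed
qed

text \<open>The counterpart of a character identity: the alternating sum of the hook characters
  vanishes off the full cycles and equals \<open>n\<close> on them. Here the factor
  \<open>card S\<close> arises because every \<open>x\<close> contributes the same amount.\<close>

lemma sum_hook_functional:
  fixes S :: "'a set" and Y :: "('a \<Rightarrow> 'a) \<Rightarrow> 'r :: {idom, semiring_char_0}"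
  assumes S: "finite S" and a: "a \<in> S"
  shows "(\<Sum>A | A \<subseteq> S \<and> a \<in> A. hook_functional S a A Y)
    = - of_nat (card S) * (\<Sum>p | p permutes S \<and> card (orbit p ` S) = 1. Y p)"
proof -
  let ?P = "{p. p permutes S}" and ?PA = "{A. A \<subseteq> S \<and> a \<in> A}"
  let ?c = "\<lambda>A t x. t ` A = A \<and> (x = a \<or> x \<notin> A)"
  have finP: "finite ?P" using S by (rule finite_permutations)
  have finPA: "finite ?PA" using S by (intro finite_subset[of ?PA "Pow S"]) auto
  \<comment> \<open>\<open>E x t\<close> is the total coefficient of
    \<open>Y (swap a x \<circ> t)\<close>. Admitting \<open>x = a\<close>, where the transposition
    is the identity, accounts for the plain term \<open>Y t\<close>.\<close>
  define E where "E x t = (\<Sum>A\<in>?PA. if ?c A t x then orbit_sign A t else 0 :: 'r)" for x t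
  have E: "E x (swap a x \<circ> p) = - of_bool (card (orbit p ` S) = 1)" if "x \<in> S" "p \<in> ?P" for x p
  proof -
    have "E x (swap a x \<circ> p) = (\<Sum>A | A \<in> ?PA \<and> ?c A (swap a x \<circ> p) x. orbit_sign A (swap a x \<circ> p))"
      unfolding E_def by (rule sum.inter_filter[OF finPA, symmetric])
    also have "{A. A \<in> ?PA \<and> ?c A (swap a x \<circ> p) x}
      = {A. A \<subseteq> S \<and> a \<in> A \<and> (swap a x \<circ> p) ` A = A \<and> (x = a \<or> x \<notin> A)}" by blast
    also have "(\<Sum>A | A \<subseteq> S \<and> a \<in> A \<and> (swap a x \<circ> p) ` A = A \<and> (x = a \<or> x \<notin> A). orbit_sign A (swap a x \<circ> p))
      = (- of_bool (card (orbit p ` S) = 1) :: 'r)"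
      using that by (intro sum_orbit_sign_invariant_sets[OF S a]) auto
    finally show ?thesis .
  qed
  have "(\<Sum>A\<in>?PA. hook_functional S a A Y)
     = (\<Sum>A\<in>?PA. \<Sum>t\<in>?P. \<Sum>x\<in>S. Y (swap a x \<circ> t) * (if ?c A t x then orbit_sign A t else 0))"
  proof (intro sum.cong refl)
    fix A assume "A \<in> ?PA"
    then have A: "A \<subseteq> S" "a \<in> A" by auto
    have "hook_functional S a A Y
      = (\<Sum>t\<in>stabilizer S A. \<Sum>x\<in>S. Y (swap a x \<circ> t) * (if ?c A t x then orbit_sign A t else 0))"
      unfolding hook_functional_def
    proof (intro sum.cong refl)
      fix t assume t: "t \<in> stabilizer S A"
      have "(\<Sum>x\<in>S. Y (swap a x \<circ> t) * (if ?c A t x then orbit_sign A t else 0))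
        = (\<Sum>x\<in>insert a (S - A). Y (swap a x \<circ> t) * orbit_sign A t)"
        using t A S by (intro sum.mono_neutral_cong_right) (auto simp: stabilizer_def)
      also have "\<dots> = Y t * orbit_sign A t + (\<Sum>x\<in>S - A. Y (swap a x \<circ> t) * orbit_sign A t)"
        using S A by (subst sum.insert) auto
      finally show "orbit_sign A t * (Y t + (\<Sum>x\<in>S - A. Y (swap a x \<circ> t)))
        = (\<Sum>x\<in>S. Y (swap a x \<circ> t) * (if ?c A t x then orbit_sign A t else 0))"
        by (simp add: distrib_left sum_distrib_left mult.commute)
    qed
    also have "\<dots> = (\<Sum>t\<in>?P. \<Sum>x\<in>S. Y (swap a x \<circ> t) * (if ?c A t x then orbit_sign A t else 0))"
      using finP by (intro sum.mono_neutral_left) (auto simp: stabilizer_def)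
    finally show "hook_functional S a A Y
      = (\<Sum>t\<in>?P. \<Sum>x\<in>S. Y (swap a x \<circ> t) * (if ?c A t x then orbit_sign A t else 0))" .
  qed
  also have "\<dots> = (\<Sum>t\<in>?P. \<Sum>A\<in>?PA. \<Sum>x\<in>S. Y (swap a x \<circ> t) * (if ?c A t x then orbit_sign A t else 0))"
    by (rule sum.swap)
  also have "\<dots> = (\<Sum>t\<in>?P. \<Sum>x\<in>S. Y (swap a x \<circ> t) * E x t)"
    unfolding E_def sum_distrib_left by (intro sum.cong refl sum.swap)
  also have "\<dots> = (\<Sum>x\<in>S. \<Sum>t\<in>?P. Y (swap a x \<circ> t) * E x t)" by (rule sum.swap)
  also have "\<dots> = (\<Sum>x\<in>S. \<Sum>p\<in>?P. Y p * - of_bool (card (orbit p ` S) = 1))"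
  proof (rule sum.cong[OF refl])
    fix x assume x: "x \<in> S"
    have "(\<Sum>t\<in>?P. Y (swap a x \<circ> t) * E x t)
      = (\<Sum>p\<in>?P. Y (swap a x \<circ> (swap a x \<circ> p)) * E x (swap a x \<circ> p))"
      using a x by (intro sum_swap_comp[symmetric])
    also have "\<dots> = (\<Sum>p\<in>?P. Y p * - of_bool (card (orbit p ` S) = 1))"
    proof (rule sum.cong[OF refl])
      fix p assume p: "p \<in> ?P"
      have "swap a x \<circ> (swap a x \<circ> p) = p" by (simp add: fun_eq_iff)
      then show "Y (swap a x \<circ> (swap a x \<circ> p)) * E x (swap a x \<circ> p) = Y p * - of_bool (card (orbit p ` S) = 1)"
        unfolding E[OF x p] by (rule arg_cong)
    qed
    finally show "(\<Sum>t\<in>?P. Y (swap a x \<circ> t) * E x t) = (\<Sum>p\<in>?P. Y p * - of_bool (card (orbit p ` S) = 1))" .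
  qed
  also have "\<dots> = - of_nat (card S) * (\<Sum>p\<in>?P. Y p * of_bool (card (orbit p ` S) = 1))"
    by (simp add: sum_negf)
  also have "(\<Sum>p\<in>?P. Y p * of_bool (card (orbit p ` S) = 1)) = (\<Sum>p | p permutes S \<and> card (orbit p ` S) = 1. Y p)"
    using finP by (intro sum.mono_neutral_cong_right) auto
  finally show ?thesis .
qed

lemma ex_permutation_fixing_mapping:
  assumes S: "finite S" and A: "A \<subseteq> S" "a \<in> A" and B: "B \<subseteq> S" "a \<in> B" and card: "card A = card B"
  shows "\<exists>r. r permutes S \<and> r a = a \<and> r ` A = B"
proof -
  have fin: "finite A" "finite B" using S A B by (auto intro: finite_subset)
  obtain f where f: "bij_betw f (A - {a}) (B - {a})"
    using fin A B card finite_same_card_bij[of "A - {a}" "B - {a}"] by auto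
  obtain g where g: "bij_betw g (S - A) (S - B)"
    using S A B card fin finite_same_card_bij[of "S - A" "S - B"] by (auto simp: card_Diff_subset)
  define r where "r v = (if v \<in> A - {a} then f v else if v \<in> S - A then g v else v)" for v
  have r1: "bij_betw r (A - {a}) (B - {a})"
    using f by (rule bij_betw_cong[THEN iffD1, rotated]) (simp add: r_def)
  have r2: "bij_betw r {a} {a}" using A by (simp add: r_def bij_betw_def)
  have r3: "bij_betw r (S - A) (S - B)"
    using g by (rule bij_betw_cong[THEN iffD1, rotated]) (auto simp: r_def)
  have rA: "bij_betw r (A - {a} \<union> {a}) (B - {a} \<union> {a})"
    using r1 r2 by (rule bij_betw_combine) auto
  then have rA: "bij_betw r A B" using A B by (simp add: insert_absorb)
  have "bij_betw r (A \<union> (S - A)) (B \<union> (S - B))"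
    using rA r3 by (rule bij_betw_combine) auto
  then have "bij_betw r S S" using A B by (simp add: Un_absorb1)
  then have "r permutes S"
    by (rule bij_imp_permutes) (use A in \<open>auto simp: r_def\<close>)
  then show ?thesis using rA A by (intro exI[of _ r]) (auto simp: r_def bij_betw_def)
qed

text \<open>Conjugation by a permutation that fixes \<open>a\<close> and carries \<open>A\<close> to
  \<open>B\<close> matches the two sums term by term. Every \<open>A\<close> is thereby reduced to
  an initial segment.\<close>

lemma hook_functional_class_function:
  fixes Y :: "('a \<Rightarrow> 'a) \<Rightarrow> 'r :: comm_ring_1"
  assumes S: "finite S" and A: "A \<subseteq> S" "a \<in> A" and B: "B \<subseteq> S" "a \<in> B" and card: "card A = card B"
    and Y: "\<And>p r. p permutes S \<Longrightarrow> r permutes S \<Longrightarrow> Y (r \<circ> p \<circ> inv r) = Y p"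
  shows "hook_functional S a A Y = hook_functional S a B Y"
proof -
  obtain r where r: "r permutes S" "r a = a" "r ` A = B"
    using ex_permutation_fixing_mapping[OF S A B card] by blast
  have B_eq: "B = r ` A" using r by simp
  have iB: "inv r ` B = A" unfolding B_eq by (simp add: image_image permutes_inverses[OF r(1)])
  note rinv = permutes_inverses[OF r(1)]
  show ?thesis
    unfolding hook_functional_def
  proof (rule sum.reindex_bij_witness[of _ "\<lambda>t. inv r \<circ> t \<circ> r" "\<lambda>t. r \<circ> t \<circ> inv r"])
    fix t assume t: "t \<in> stabilizer S A"
    then have tp: "t permutes S" "t ` A = A" by (auto simp: stabilizer_def)
    show "inv r \<circ> (r \<circ> t \<circ> inv r) \<circ> r = t" by (simp add: fun_eq_iff rinv)
    have "(r \<circ> t \<circ> inv r) ` B = r ` t ` inv r ` B" by (simp add: image_comp comp_assoc)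
    then show "r \<circ> t \<circ> inv r \<in> stabilizer S B"
      using tp r iB by (simp add: stabilizer_def permutes_compose permutes_inv)
    have "permutation t" using tp(1) S by (auto simp: permutation_permutes)
    then have "orbit (r \<circ> t \<circ> inv r) (r v) = r ` orbit t v" for v
      by (intro orbit_inverse[symmetric] permutation_self_in_orbit) (simp_all add: rinv)
    then have "orbit (r \<circ> t \<circ> inv r) ` B = (`) r ` orbit t ` A"
      unfolding B_eq image_image by simp
    moreover have "inj_on ((`) r) (orbit t ` A)"
      using permutes_inj[OF r(1)] by (auto intro!: inj_onI simp: inj_image_eq_iff)
    ultimately have sgn: "orbit_sign B (r \<circ> t \<circ> inv r) = (orbit_sign A t :: 'r)"
      by (simp add: orbit_sign_def card_image)
    have bij: "bij_betw r (S - A) (S - B)"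
      using image_set_diff[OF permutes_inj[OF r(1)], of S A] permutes_image[OF r(1)]
      unfolding B_eq by (simp add: bij_betw_def permutes_inj_on[OF r(1)])
    have "(\<Sum>x\<in>S - B. Y (swap a x \<circ> (r \<circ> t \<circ> inv r))) = (\<Sum>x\<in>S - A. Y (swap a (r x) \<circ> (r \<circ> t \<circ> inv r)))"
      by (rule sum.reindex_bij_betw[OF bij, symmetric])
    also have "\<dots> = (\<Sum>x\<in>S - A. Y (swap a x \<circ> t))"
    proof (rule sum.cong[OF refl])
      fix x assume x: "x \<in> S - A"
      have "swap a (r x) (r v) = r (swap a x v)" for v
        using r(2) inj_eq[OF permutes_inj[OF r(1)]] by (metis Transposition.transpose_def)
      then have "swap a (r x) \<circ> (r \<circ> t \<circ> inv r) = r \<circ> (swap a x \<circ> t) \<circ> inv r"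
        by (simp add: fun_eq_iff)
      then have "Y (swap a (r x) \<circ> (r \<circ> t \<circ> inv r)) = Y (r \<circ> (swap a x \<circ> t) \<circ> inv r)"
        by (rule arg_cong)
      also have "\<dots> = Y (swap a x \<circ> t)"
      proof (rule Y[OF _ r(1)])
        have "a \<in> S" using A by auto
        then show "swap a x \<circ> t permutes S"
          using x by (intro permutes_compose[OF tp(1)] permutes_swap_id) auto
      qed
      finally show "Y (swap a (r x) \<circ> (r \<circ> t \<circ> inv r)) = Y (swap a x \<circ> t)" .
    qed
    finally show "orbit_sign B (r \<circ> t \<circ> inv r) * (Y (r \<circ> t \<circ> inv r) + (\<Sum>x\<in>S - B. Y (swap a x \<circ> (r \<circ> t \<circ> inv r))))
      = orbit_sign A t * (Y t + (\<Sum>x\<in>S - A. Y (swap a x \<circ> t)))"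
      unfolding sgn Y[OF tp(1) r(1)] by (rule arg_cong)
  next
    fix t assume t: "t \<in> stabilizer S B"
    then have tp: "t permutes S" "t ` B = B" by (auto simp: stabilizer_def)
    show "r \<circ> (inv r \<circ> t \<circ> r) \<circ> inv r = t" by (simp add: fun_eq_iff rinv)
    have "(inv r \<circ> t \<circ> r) ` A = inv r ` t ` r ` A" by (simp add: image_comp comp_assoc)
    then show "inv r \<circ> t \<circ> r \<in> stabilizer S A"
      using tp r iB by (simp add: stabilizer_def permutes_compose permutes_inv)
  qed
qed

lemma sum_supersets_of_point:
  fixes f :: "nat \<Rightarrow> 'r :: comm_ring_1"
  assumes S: "finite S" and a: "a \<in> S"
  shows "(\<Sum>A | A \<subseteq> S \<and> a \<in> A. f (card A))
    = (\<Sum>r\<le>card S - 1. of_nat ((card S - 1) choose r) * f (Suc r))"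
proof -
  let ?T = "S - {a}"
  have T: "finite ?T" "card ?T = card S - 1" using S a by auto
  have "(\<Sum>A | A \<subseteq> S \<and> a \<in> A. f (card A)) = (\<Sum>A\<in>Pow ?T. f (Suc (card A)))"
  proof (rule sum.reindex_bij_witness[of _ "insert a" "\<lambda>A. A - {a}"])
    fix A assume A: "A \<in> {A. A \<subseteq> S \<and> a \<in> A}"
    then have "finite A" using S by (auto intro: finite_subset)
    then have "card A = Suc (card (A - {a}))" using A card.remove[of A a] by simp
    then show "f (Suc (card (A - {a}))) = f (card A)" by simp
  qed (use a in auto)
  also have "\<dots> = (\<Sum>r\<le>card S - 1. \<Sum>A | A \<in> Pow ?T \<and> card A = r. f (Suc (card A)))"
  proof (rule sum.group[symmetric])
    show "card ` Pow ?T \<subseteq> {..card S - 1}" using card_mono[OF T(1)] T(2) by force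
  qed (use T in simp_all)
  also have "\<dots> = (\<Sum>r\<le>card S - 1. of_nat ((card S - 1) choose r) * f (Suc r))"
  proof (rule sum.cong[OF refl])
    fix r
    have "(\<Sum>A | A \<in> Pow ?T \<and> card A = r. f (Suc (card A))) = (\<Sum>A | A \<in> Pow ?T \<and> card A = r. f (Suc r))"
      by (intro sum.cong) auto
    also have "\<dots> = of_nat (card {A. A \<subseteq> ?T \<and> card A = r}) * f (Suc r)" by simp
    finally show "(\<Sum>A | A \<in> Pow ?T \<and> card A = r. f (Suc (card A))) = of_nat ((card S - 1) choose r) * f (Suc r)"
      using n_subsets[OF T(1), of r] T(2) by simp
  qed
  finally show ?thesis .
qed

section \<open>The coefficient of a full cycle\<close>

text \<open>The rising factorial with step \<open>z\<close>, that is, \<open>z ^ k\<close> times the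
  Pochhammer symbol of \<open>a / z\<close>, in a form that makes sense when \<open>z\<close> is a
  formal variable.\<close>

definition scaled_rising :: "'r \<Rightarrow> 'r \<Rightarrow> nat \<Rightarrow> 'r :: comm_ring_1" where
  "scaled_rising z a k = (\<Prod>j<k. a + of_nat j * z)"

lemma scaled_rising_Suc: "scaled_rising z a (Suc k) = scaled_rising z a k * (a + of_nat k * z)"
  by (simp add: scaled_rising_def)

text \<open>Chu--Vandermonde in homogeneous form. The new factor splits as
  \<open>(a + k z) + (b + (n - k) z)\<close>, and Pascal's rule collects the two halves.\<close>

lemma scaled_rising_binomial_sum:
  "scaled_rising z (a + b) n
    = (\<Sum>k\<le>n. of_nat (n choose k) * scaled_rising z a k * scaled_rising z b (n - k))"
proof (induction n)
  case 0
  then show ?case by (simp add: scaled_rising_def)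
next
  case (Suc n)
  let ?R = "scaled_rising z"
  let ?f = "\<lambda>k. of_nat (n choose k) * ?R a k * ?R b (Suc n - k)"
  let ?g = "\<lambda>k. of_nat (n choose k) * ?R a (Suc k) * ?R b (n - k)"
  have "?R (a + b) (Suc n) = (\<Sum>k\<le>n. of_nat (n choose k) * ?R a k * ?R b (n - k) * (a + b + of_nat n * z))"
    unfolding scaled_rising_Suc Suc.IH by (rule sum_distrib_right)
  also have "\<dots> = (\<Sum>k\<le>n. ?g k + ?f k)"
  proof (rule sum.cong[OF refl])
    fix k assume "k \<in> {..n}"
    then have k: "k \<le> n" by simp
    then have "a + b + of_nat n * z = (a + of_nat k * z) + (b + of_nat (n - k) * z)"
      by (simp add: algebra_simps flip: of_nat_add distrib_right)
    moreover have "?R b (Suc n - k) = ?R b (n - k) * (b + of_nat (n - k) * z)"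
      using k by (simp add: Suc_diff_le scaled_rising_Suc)
    ultimately show "of_nat (n choose k) * ?R a k * ?R b (n - k) * (a + b + of_nat n * z) = ?g k + ?f k"
      by (simp add: scaled_rising_Suc algebra_simps)
  qed
  also have "\<dots> = (\<Sum>k\<le>n. ?g k) + (\<Sum>k\<le>Suc n. ?f k)"
    by (simp add: sum.distrib binomial_eq_0)
  also have "(\<Sum>k\<le>Suc n. ?f k) = ?R b (Suc n) + (\<Sum>k\<le>n. of_nat (n choose Suc k) * ?R a (Suc k) * ?R b (n - k))"
    by (subst sum.atMost_Suc_shift) (simp add: scaled_rising_def)
  also have "(\<Sum>k\<le>n. ?g k) + \<dots>
    = ?R b (Suc n) + (\<Sum>k\<le>n. of_nat (Suc n choose Suc k) * ?R a (Suc k) * ?R b (n - k))"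
    by (simp add: sum.distrib algebra_simps)
  also have "\<dots> = (\<Sum>k\<le>Suc n. of_nat (Suc n choose k) * ?R a k * ?R b (Suc n - k))"
    by (subst sum.atMost_Suc_shift) (simp add: scaled_rising_def)
  finally show ?case .
qed

text \<open>Up to sign the two products are rising factorials based at \<open>b = - 1 - m z\<close>
  and \<open>a = 1 - m z\<close>, of lengths \<open>m - r\<close> and \<open>r\<close>. In
  \<open>a + b = - 2 m z\<close> the constants cancel, which is why the sum collapses to one
  monomial; its factors \<open>2 m, ..., m + 1\<close> amount to \<open>(2 m)! / m!\<close>.\<close>

lemma alternating_binomial_content_sum:
  fixes z :: "'r :: comm_ring_1"
  shows "of_nat (fact m) * (\<Sum>r\<le>m. of_nat (m choose r) * ((- 1) ^ r *
      ((\<Prod>j\<in>{Suc r..m}. 1 + of_nat j * z) * (\<Prod>j\<in>{Suc (m - r)..m}. 1 - of_nat j * z))))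
    = of_nat (fact (2 * m)) * z ^ m"
proof -
  let ?R = "scaled_rising z"
  have q: "(- 1) ^ r * ((\<Prod>j\<in>{Suc r..m}. 1 + of_nat j * z) * (\<Prod>j\<in>{Suc (m - r)..m}. 1 - of_nat j * z))
    = (- 1) ^ m * (?R (1 - of_nat m * z) r * ?R (- 1 - of_nat m * z) (m - r))" if "r \<le> m" for r
  proof -
    have N: "(\<Prod>j\<in>{Suc (m - r)..m}. 1 - of_nat j * z) = ?R (1 - of_nat m * z) r"
      unfolding scaled_rising_def
      by (rule prod.reindex_bij_witness[of _ "\<lambda>i. m - i" "\<lambda>j. m - j"])
        (use that in \<open>auto simp: of_nat_diff algebra_simps\<close>)
    have "(\<Prod>j\<in>{Suc r..m}. - (1 + of_nat j * z)) = ?R (- 1 - of_nat m * z) (m - r)"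
      unfolding scaled_rising_def
      by (rule prod.reindex_bij_witness[of _ "\<lambda>i. m - i" "\<lambda>j. m - j"])
        (use that in \<open>auto simp: of_nat_diff algebra_simps\<close>)
    then have P: "?R (- 1 - of_nat m * z) (m - r) = (- 1) ^ (m - r) * (\<Prod>j\<in>{Suc r..m}. 1 + of_nat j * z)"
      by (subst (asm) prod_uminus) simp
    have sgn: "(- 1 :: 'r) ^ m * ((- 1) ^ (m - r) * v) = (- 1) ^ r * v" for v
    proof -
      have "(- 1 :: 'r) ^ m = (- 1) ^ (m - r) * (- 1) ^ r"
        unfolding power_add[symmetric] using that by simp
      then show ?thesis by (simp add: mult.assoc mult.left_commute[of _ "(- 1) ^ r"])
    qed
    show ?thesis
      unfolding P N[symmetric] sgn[symmetric] by (simp only: mult_ac)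
  qed
  have "(\<Sum>r\<le>m. of_nat (m choose r) * ((- 1) ^ r *
      ((\<Prod>j\<in>{Suc r..m}. 1 + of_nat j * z) * (\<Prod>j\<in>{Suc (m - r)..m}. 1 - of_nat j * z))))
    = (\<Sum>r\<le>m. (- 1) ^ m * (of_nat (m choose r) * ?R (1 - of_nat m * z) r * ?R (- 1 - of_nat m * z) (m - r)))"
    using q by (intro sum.cong refl) (simp add: mult_ac)
  also have "\<dots> = (- 1) ^ m * ?R ((1 - of_nat m * z) + (- 1 - of_nat m * z)) m"
    unfolding scaled_rising_binomial_sum by (rule sum_distrib_left[symmetric])
  also have "?R ((1 - of_nat m * z) + (- 1 - of_nat m * z)) m = (\<Prod>j<m. - (of_nat (2 * m - j) * z))"
    unfolding scaled_rising_def by (intro prod.cong refl) (auto simp: of_nat_diff algebra_simps)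
  also have "(- 1) ^ m * \<dots> = (\<Prod>j<m. of_nat (2 * m - j) * z)"
    by (subst prod_uminus) simp
  also have "\<dots> = of_nat (\<Prod>j<m. 2 * m - j) * z ^ m" by (simp add: prod.distrib)
  finally have *: "(\<Sum>r\<le>m. of_nat (m choose r) * ((- 1) ^ r *
      ((\<Prod>j\<in>{Suc r..m}. 1 + of_nat j * z) * (\<Prod>j\<in>{Suc (m - r)..m}. 1 - of_nat j * z))))
    = of_nat (\<Prod>j<m. 2 * m - j) * z ^ m" .
  have "(\<Prod>j<m. 2 * m - j) = (\<Prod>j\<in>{Suc m..2 * m}. j)"
    by (rule prod.reindex_bij_witness[of _ "\<lambda>j. 2 * m - j" "\<lambda>j. 2 * m - j"]) auto
  moreover have "fact m * (\<Prod>j\<in>{Suc m..2 * m}. j) = fact (2 * m)"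
    using fact_eq_fact_times[of m "2 * m"] by simp
  ultimately have "fact m * (\<Prod>j<m. 2 * m - j) = fact (2 * m)" by simp
  then have "(of_nat (fact m) :: 'r) * of_nat (\<Prod>j<m. 2 * m - j) = of_nat (fact (2 * m))"
    by (simp only: of_nat_mult[symmetric])
  then show ?thesis unfolding * by (subst mult.assoc[symmetric]) (rule arg_cong)
qed

section \<open>Hook values of the inverse and its coefficient at a full cycle\<close>

context jm_inverse
begin

text \<open>Going from \<open>X m\<close> to \<open>X (m - 1)\<close> multiplies the value by
  \<open>1 - c z\<close>, where \<open>c\<close> is the content of the box of \<open>m\<close>:
  \<open>- (m - 1)\<close> while \<open>m \<le> Suc r\<close> runs down the first column, then
  \<open>m - Suc r\<close> along the first row.\<close>

lemma hook_functional_X: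
  assumes "Suc r \<le> n"
  shows "hook_functional {1..n} 1 {1..Suc r} (X n)
      * ((\<Prod>j\<in>{1..r}. 1 + of_nat j * z) * (\<Prod>j\<in>{1..n - Suc r}. 1 - of_nat j * z)) = (- 1) ^ Suc r"
proof -
  interpret hook "{1..n}" "{1..Suc r}" 1
    by unfold_locales (use assms in auto)
  let ?M = "hook_functional {1..n} 1 {1..Suc r}"
  have step_in: "?M (X (m - 1)) = (1 + of_nat (m - 1) * z) * ?M (X m)" if "m \<in> {1..Suc r}" for m
  proof -
    have "?M (X (m - 1)) = ?M (\<lambda>p. X m p - z * (\<Sum>s\<in>{1..<m}. X m (p \<circ> swap s m)))"
      using X_step[of m] that assms by (intro hook_functional_cong) auto
    also have "\<dots> = ?M (X m) - z * (\<Sum>s\<in>{1..<m}. ?M (\<lambda>p. X m (p \<circ> swap s m)))"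
      by (rule hook_functional_diff_sum)
    also have "(\<Sum>s\<in>{1..<m}. ?M (\<lambda>p. X m (p \<circ> swap s m))) = (\<Sum>s\<in>{1..<m}. - ?M (X m))"
      using that assms by (intro sum.cong refl) (subst hook_functional_swap, auto)
    also have "\<dots> = - (of_nat (m - 1) * ?M (X m))" by simp
    finally show ?thesis by (simp add: algebra_simps)
  qed
  have step_out: "?M (X (m - 1)) = (1 - of_nat (m - Suc r) * z) * ?M (X m)"
    if "m \<in> {Suc (Suc r)..n}" for m
  proof -
    have m: "m \<in> {1..n} - {1..Suc r}" using that by auto
    have "?M (X (m - 1)) = ?M (\<lambda>p. X m p - z * (\<Sum>s\<in>{1..<m}. X m (p \<circ> swap s m)))"
      using X_step[of m] m by (intro hook_functional_cong) auto
    also have "\<dots> = ?M (X m) - z * (\<Sum>s\<in>{1..<m}. ?M (\<lambda>p. X m (p \<circ> swap s m)))"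
      by (rule hook_functional_diff_sum)
    also have "{1..<m} = {1..Suc r} \<union> {Suc (Suc r)..<m}" using that by auto
    also have "(\<Sum>s\<in>\<dots>. ?M (\<lambda>p. X m (p \<circ> swap s m)))
      = (\<Sum>s\<in>{1..Suc r}. ?M (\<lambda>p. X m (p \<circ> swap s m))) + (\<Sum>s\<in>{Suc (Suc r)..<m}. ?M (\<lambda>p. X m (p \<circ> swap s m)))"
      by (rule sum.union_disjoint) auto
    also have "(\<Sum>s\<in>{1..Suc r}. ?M (\<lambda>p. X m (p \<circ> swap s m))) = ?M (X m)"
      by (rule hook_functional_sum_swap[OF m])
    also have "(\<Sum>s\<in>{Suc (Suc r)..<m}. ?M (\<lambda>p. X m (p \<circ> swap s m))) = (\<Sum>s\<in>{Suc (Suc r)..<m}. ?M (X m))"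
      using m by (intro sum.cong refl) (subst hook_functional_swap, auto)
    also have "\<dots> = of_nat (m - Suc (Suc r)) * ?M (X m)" by simp
    \<comment> \<open>The transpositions linking \<open>m\<close> to \<open>{1..Suc r}\<close>
      contribute 1 altogether, those linking it to the later points 1 each; together they make up
      the content.\<close>
    also have "?M (X m) + of_nat (m - Suc (Suc r)) * ?M (X m) = of_nat (m - Suc r) * ?M (X m)"
    proof -
      have "m - Suc r = Suc (m - Suc (Suc r))" using that by auto
      then have "(of_nat (m - Suc r) :: 'r) = 1 + of_nat (m - Suc (Suc r))" by simp
      then show ?thesis by (simp add: distrib_right)
    qed
    finally show ?thesis by (simp add: algebra_simps)
  qed
  have 1: "?M (X 0) = (\<Prod>j\<in>{1..k}. 1 + of_nat j * z) * ?M (X (Suc k))" if "k \<le> r" for k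
    using that
  proof (induction k)
    case 0
    then show ?case using step_in[of 1] by simp
  next
    case (Suc k)
    then show ?case using step_in[of "Suc (Suc k)"] by (simp add: mult.assoc)
  qed
  have 2: "?M (X (Suc r)) = (\<Prod>j\<in>{1..k}. 1 - of_nat j * z) * ?M (X (Suc r + k))" if "Suc r + k \<le> n" for k
    using that
  proof (induction k)
    case (Suc k)
    then show ?case using step_out[of "Suc r + Suc k"] by (simp add: mult.assoc)
  qed simp
  have "?M (X 0) = ?M (\<lambda>p. of_bool (p = id))"
    using X_0 by (intro hook_functional_cong)
  also have "\<dots> = (- 1) ^ Suc r"
    unfolding hook_functional_delta by simp
  finally show ?thesis
    using 1[of r] 2[of "n - Suc r"] assms by (simp add: mult_ac)
qed

text \<open>The sum of \<open>X n\<close> over the full cycles is known in two ways: there are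
  \<open>fact (n - 1)\<close> of them with a common value, and the hook values give \<open>n\<close>
  times the sum as an alternating binomial sum.\<close>

theorem X_single_orbit:
  assumes n: "1 \<le> n" and c: "c permutes {1..n}" "card (orbit c ` {1..n}) = 1"
  shows "of_nat (fact n * fact (n - 1)) * (X n c * (\<Prod>i=1..n - 1. 1 - of_nat i ^ 2 * z ^ 2))
    = of_nat (fact (2 * (n - 1))) * z ^ (n - 1)"
proof -
  define m where "m = n - 1"
  have n_eq: "n = Suc m" using n by (simp add: m_def)
  let ?S = "{1..n}" and ?D = "\<Prod>i=1..m. 1 - of_nat i ^ 2 * z ^ 2"
  define M where "M k = hook_functional ?S 1 {1..k} (X n)" for k
  have hooks: "(\<Sum>A | A \<subseteq> ?S \<and> 1 \<in> A. hook_functional ?S 1 A (X n)) = (\<Sum>A | A \<subseteq> ?S \<and> 1 \<in> A. M (card A))"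
  proof (rule sum.cong[OF refl])
    fix A assume "A \<in> {A. A \<subseteq> ?S \<and> 1 \<in> A}"
    then have A: "A \<subseteq> ?S" "1 \<in> A" by auto
    have "finite A" using A by (auto intro: finite_subset)
    then have "0 < card A" using A by (auto simp: card_gt_0_iff)
    moreover have "card A \<le> n" using card_mono[OF _ A(1)] by simp
    ultimately show "hook_functional ?S 1 A (X n) = M (card A)"
      unfolding M_def by (intro hook_functional_class_function[OF _ A] X_class_function) auto
  qed
  have "- of_nat (card ?S) * (\<Sum>p | p permutes ?S \<and> card (orbit p ` ?S) = 1. X n p)
    = (\<Sum>r\<le>m. of_nat (m choose r) * M (Suc r))"
    using sum_hook_functional[of ?S 1 "X n"] sum_supersets_of_point[of ?S 1 M] hooks n_eq by simp
  also have "(\<Sum>p | p permutes ?S \<and> card (orbit p ` ?S) = 1. X n p)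
    = (\<Sum>p | p permutes ?S \<and> card (orbit p ` ?S) = 1. X n c)"
  proof (rule sum.cong[OF refl])
    fix p assume "p \<in> {p. p permutes ?S \<and> card (orbit p ` ?S) = 1}"
    then have p: "p permutes ?S" "card (orbit p ` ?S) = 1" by auto
    have "?S \<noteq> {}" using n by auto
    then have "orbit p ` ?S = {?S}" "orbit c ` ?S = {?S}"
      using p c single_orbit_iff[of _ ?S] by auto
    then show "X n p = X n c" by (intro X_eq_if_same_cycle_type[OF p(1) c(1)]) simp
  qed
  also have "\<dots> = of_nat (fact m) * X n c"
    using card_single_orbit_permutations[of ?S] n_eq by simp
  finally have sum_eq: "- of_nat (card ?S) * (of_nat (fact m) * X n c) = (\<Sum>r\<le>m. of_nat (m choose r) * M (Suc r))" .
  have "(of_nat (fact n) :: 'r) = of_nat (card ?S) * of_nat (fact m)" using n_eq by (simp add: distrib_right)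
  then have count: "of_nat (fact n) * X n c = - (\<Sum>r\<le>m. of_nat (m choose r) * M (Suc r))"
    unfolding sum_eq[symmetric] by (simp add: mult.assoc)
  \<comment> \<open>The cofactor left of the product of all \<open>1 - i\<^sup>2 z\<^sup>2\<close>
    when the denominator of the hook of leg length \<open>r\<close> is cancelled.\<close>
  let ?q = "\<lambda>r. (\<Prod>j\<in>{Suc r..m}. 1 + of_nat j * z) * (\<Prod>j\<in>{Suc (m - r)..m}. 1 - of_nat j * z)"
  have D: "M (Suc r) * ?D = (- 1) ^ Suc r * ?q r" if "r \<le> m" for r
  proof -
    have split: "(\<Prod>j\<in>{1..m}. f j) = (\<Prod>j\<in>{1..k}. f j) * (\<Prod>j\<in>{Suc k..m}. f j)"
      if "k \<le> m" for k and f :: "nat \<Rightarrow> 'r"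
    proof -
      have "{1..m} = {1..k} \<union> {Suc k..m}" using that by auto
      then show ?thesis by (simp add: prod.union_disjoint)
    qed
    have "?D = (\<Prod>j\<in>{1..m}. 1 + of_nat j * z) * (\<Prod>j\<in>{1..m}. 1 - of_nat j * z)"
      unfolding prod.distrib[symmetric] by (intro prod.cong refl) (simp add: algebra_simps power2_eq_square)
    also have "\<dots> = ((\<Prod>j\<in>{1..r}. 1 + of_nat j * z) * (\<Prod>j\<in>{1..n - Suc r}. 1 - of_nat j * z)) * ?q r"
      using split[of r "\<lambda>j. 1 + of_nat j * z"] split[of "m - r" "\<lambda>j. 1 - of_nat j * z"] that n_eq by (simp add: mult_ac)
    finally show ?thesis
      using hook_functional_X[of r] that n_eq unfolding M_def by (simp flip: mult.assoc)
  qed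
  have "of_nat (fact n) * (X n c * ?D) = - (\<Sum>r\<le>m. of_nat (m choose r) * M (Suc r)) * ?D"
    using count by (simp flip: mult.assoc)
  also have "\<dots> = (\<Sum>r\<le>m. of_nat (m choose r) * ((- 1) ^ r * ?q r))"
    unfolding sum_negf[symmetric] sum_distrib_right
    using D by (intro sum.cong refl) (simp add: mult.assoc)
  finally have "of_nat (fact m) * (of_nat (fact n) * (X n c * ?D)) = of_nat (fact (2 * m)) * z ^ m"
    by (simp only: alternating_binomial_content_sum)
  then show ?thesis unfolding m_def by (simp add: mult_ac)
qed

end

section \<open>Complete homogeneous functions of Jucys--Murphy elements\<close>

lemma alg_mult_eq:
  assumes "p permutes {1..n}"
  shows "alg_mult n f g p = (\<Sum>q | q permutes {1..n}. f q * g (inv q \<circ> p))"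
  unfolding alg_mult_def
proof (rule sum.reindex_bij_witness[of _ "\<lambda>q. (q, inv q \<circ> p)" fst])
  fix w :: "(nat \<Rightarrow> nat) \<times> (nat \<Rightarrow> nat)"
  assume "w \<in> {(q, r). q permutes {1..n} \<and> r permutes {1..n} \<and> q \<circ> r = p}"
  then obtain q r where w: "w = (q, r)" "q permutes {1..n}" "p = q \<circ> r" by auto
  then have "inv q \<circ> p = r" by (simp add: fun_eq_iff permutes_inverses)
  then show "(fst w, inv (fst w) \<circ> p) = w" "fst w \<in> {q. q permutes {1..n}}"
    "f (fst w) * g (inv (fst w) \<circ> p) = (case w of (q, r) \<Rightarrow> f q * g r)" using w by simp_all
next
  fix q assume "q \<in> {q. q permutes {1..n}}"
  then have q: "q permutes {1..n}" by simp
  then have "q \<circ> (inv q \<circ> p) = p" by (simp add: fun_eq_iff permutes_inverses)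
  moreover have "inv q \<circ> p permutes {1..n}" using q assms by (intro permutes_compose permutes_inv)
  ultimately show "(q, inv q \<circ> p) \<in> {(q, r). q permutes {1..n} \<and> r permutes {1..n} \<and> q \<circ> r = p}"
    using q by simp
qed simp

lemma alg_mult_outside:
  assumes "\<not> p permutes {1..n}"
  shows "alg_mult n f g p = 0"
proof -
  have "{(q, r). q permutes {1..n} \<and> r permutes {1..n} \<and> q \<circ> r = p} = {}"
    using assms by (auto intro: permutes_compose)
  then show ?thesis by (simp only: alg_mult_def sum.empty)
qed

definition jm_word :: "nat \<Rightarrow> nat list \<Rightarrow> perm_alg" where
  "jm_word n is = foldr (alg_mult n) (map jucys_murphy is) (perm_elem id)"

text \<open>Words are multiplied out from the left, whereas the recursion of
  \<open>jm_inverse\<close> acts on the last factor. The induction is associativity of the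
  product.\<close>

lemma jm_word_snoc:
  assumes m: "m \<in> {1..n}" and "p permutes {1..n}"
  shows "jm_word n (is @ [m]) p = (\<Sum>s\<in>{1..<m}. jm_word n is (p \<circ> swap s m))"
  using assms(2)
proof (induction "is" arbitrary: p)
  case Nil
  have eq: "inv q \<circ> p = id \<longleftrightarrow> q = p" if q: "q permutes {1..n}" for q
  proof
    assume *: "inv q \<circ> p = id"
    have "p = q \<circ> (inv q \<circ> p)" by (simp add: fun_eq_iff permutes_inverses[OF q])
    then show "q = p" unfolding * by simp
  qed (use permutes_inv_o[OF Nil] in simp)
  have "jm_word n ([] @ [m]) p = (\<Sum>q | q permutes {1..n}. jucys_murphy m q * perm_elem id (inv q \<circ> p))"
    unfolding jm_word_def by (simp add: alg_mult_eq[OF Nil])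
  also have "\<dots> = (\<Sum>q\<in>{p}. jucys_murphy m q * perm_elem id (inv q \<circ> p))"
    using Nil eq by (intro sum.mono_neutral_right) (auto simp: finite_permutations perm_elem_def)
  also have "\<dots> = jucys_murphy m p" using eq[OF Nil] by (simp add: perm_elem_def)
  also have "\<dots> = (\<Sum>s\<in>{1..<m}. perm_elem id (p \<circ> swap s m))"
    unfolding jucys_murphy_def
  proof (rule sum.cong[OF refl])
    fix s
    have "p = swap s m \<longleftrightarrow> p \<circ> swap s m = id"
    proof
      assume *: "p \<circ> swap s m = id"
      have "p = (p \<circ> swap s m) \<circ> swap s m" by (simp add: fun_eq_iff)
      then show "p = swap s m" unfolding * by simp
    qed simp
    then show "perm_elem (swap s m) p = perm_elem id (p \<circ> swap s m)" by (simp add: perm_elem_def)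
  qed
  also have "perm_elem id = jm_word n []" by (simp add: jm_word_def)
  finally show ?case .
next
  case (Cons i "is")
  let ?P = "{q. q permutes {1..n}}"
  have "jm_word n ((i # is) @ [m]) p = (\<Sum>q\<in>?P. jucys_murphy i q * jm_word n (is @ [m]) (inv q \<circ> p))"
    using alg_mult_eq[OF Cons.prems] by (simp add: jm_word_def)
  also have "\<dots> = (\<Sum>q\<in>?P. \<Sum>s\<in>{1..<m}. jucys_murphy i q * jm_word n is (inv q \<circ> p \<circ> swap s m))"
  proof (rule sum.cong[OF refl])
    fix q assume "q \<in> ?P"
    then have "inv q \<circ> p permutes {1..n}" using Cons.prems by (auto intro: permutes_compose permutes_inv)
    then show "jucys_murphy i q * jm_word n (is @ [m]) (inv q \<circ> p)
      = (\<Sum>s\<in>{1..<m}. jucys_murphy i q * jm_word n is (inv q \<circ> p \<circ> swap s m))"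
      using Cons.IH[of "inv q \<circ> p"] by (simp only: sum_distrib_left)
  qed
  also have "\<dots> = (\<Sum>s\<in>{1..<m}. \<Sum>q\<in>?P. jucys_murphy i q * jm_word n is (inv q \<circ> (p \<circ> swap s m)))"
    by (subst sum.swap) (simp only: comp_assoc)
  also have "\<dots> = (\<Sum>s\<in>{1..<m}. jm_word n (i # is) (p \<circ> swap s m))"
  proof (rule sum.cong[OF refl])
    fix s assume s: "s \<in> {1..<m}"
    have "p \<circ> swap s m permutes {1..n}"
      using s m by (intro permutes_compose[OF _ Cons.prems] permutes_swap_id) auto
    from alg_mult_eq[OF this, of "jucys_murphy i" "jm_word n is"]
    show "(\<Sum>q\<in>?P. jucys_murphy i q * jm_word n is (inv q \<circ> (p \<circ> swap s m))) = jm_word n (i # is) (p \<circ> swap s m)"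
      by (simp only: jm_word_def list.map foldr.simps comp_apply)
  qed
  finally show ?case .
qed

definition sorted_words :: "nat \<Rightarrow> nat \<Rightarrow> nat list set" where
  "sorted_words m k = {is. sorted is \<and> length is = k \<and> set is \<subseteq> {1..m}}"

lemma finite_sorted_words: "finite (sorted_words m k)"
  unfolding sorted_words_def
  by (rule finite_subset[OF _ finite_lists_length_eq[of "{1..m}" k]]) auto

text \<open>The last letter of a sorted word is its largest, so the words are split according to
  whether it is \<open>m\<close>.\<close>

lemma sorted_words_Suc:
  assumes "1 \<le> m"
  shows "sorted_words m (Suc k) = sorted_words (m - 1) (Suc k) \<union> (\<lambda>is. is @ [m]) ` sorted_words m k"
proof (intro equalityI subsetI)
  fix js assume js: "js \<in> sorted_words m (Suc k)"
  then have "js \<noteq> []" by (auto simp: sorted_words_def)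
  then obtain "is" i where eq: "js = is @ [i]" by (metis append_butlast_last_id)
  show "js \<in> sorted_words (m - 1) (Suc k) \<union> (\<lambda>is. is @ [m]) ` sorted_words m k"
  proof (cases "i = m")
    case True
    then show ?thesis using js eq by (auto simp: sorted_words_def sorted_append)
  next
    case False
    then have "i \<le> m - 1" using js eq by (auto simp: sorted_words_def)
    then have "js \<in> sorted_words (m - 1) (Suc k)"
      using js eq by (auto simp: sorted_words_def sorted_append subset_iff intro: order_trans)
    then show ?thesis by simp
  qed
next
  fix js assume "js \<in> sorted_words (m - 1) (Suc k) \<union> (\<lambda>is. is @ [m]) ` sorted_words m k"
  then show "js \<in> sorted_words m (Suc k)"
    using assms by (fastforce simp: sorted_words_def sorted_append)
qed

definition hom_jm :: "nat \<Rightarrow> nat \<Rightarrow> nat \<Rightarrow> perm_alg" where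
  "hom_jm n m k p = (\<Sum>is\<in>sorted_words m k. jm_word n is p)"

lemma complete_hom_eq_hom_jm: "complete_hom n k jucys_murphy = hom_jm n n k"
  by (simp add: complete_hom_def hom_jm_def sorted_words_def jm_word_def fun_eq_iff)

lemma hom_jm_Suc:
  assumes m: "m \<in> {1..n}" and p: "p permutes {1..n}"
  shows "hom_jm n m (Suc k) p = hom_jm n (m - 1) (Suc k) p + (\<Sum>s\<in>{1..<m}. hom_jm n m k (p \<circ> swap s m))"
proof -
  have "hom_jm n m (Suc k) p
    = hom_jm n (m - 1) (Suc k) p + (\<Sum>is\<in>(\<lambda>is. is @ [m]) ` sorted_words m k. jm_word n is p)"
    unfolding hom_jm_def sorted_words_Suc[of m k, OF m[unfolded atLeastAtMost_iff, THEN conjunct1]]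
    by (rule sum.union_disjoint) (use m in \<open>auto simp: finite_sorted_words, auto simp: sorted_words_def\<close>)
  also have "(\<Sum>is\<in>(\<lambda>is. is @ [m]) ` sorted_words m k. jm_word n is p) = (\<Sum>is\<in>sorted_words m k. jm_word n (is @ [m]) p)"
    by (subst sum.reindex) (auto simp: inj_on_def)
  also have "\<dots> = (\<Sum>is\<in>sorted_words m k. \<Sum>s\<in>{1..<m}. jm_word n is (p \<circ> swap s m))"
    by (intro sum.cong refl jm_word_snoc[OF m p])
  also have "\<dots> = (\<Sum>s\<in>{1..<m}. hom_jm n m k (p \<circ> swap s m))"
    unfolding hom_jm_def by (rule sum.swap)
  finally show ?thesis .
qed

lemma hom_jm_0: "hom_jm n m 0 p = of_bool (p = id)"
proof -
  have "sorted_words m 0 = {[]}" by (auto simp: sorted_words_def)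
  then show ?thesis by (simp add: hom_jm_def jm_word_def perm_elem_def)
qed

lemma hom_jm_outside:
  assumes "\<not> p permutes {1..n}"
  shows "hom_jm n m k p = 0"
proof -
  have "p \<noteq> id" using assms by auto
  then have "jm_word n is p = 0" for "is"
    using alg_mult_outside[OF assms] by (cases "is") (simp_all add: jm_word_def perm_elem_def)
  then show ?thesis by (simp add: hom_jm_def)
qed

definition hom_jm_gf :: "nat \<Rightarrow> nat \<Rightarrow> (nat \<Rightarrow> nat) \<Rightarrow> complex fps" where
  "hom_jm_gf n m p = Abs_fps (\<lambda>k. hom_jm n m k p)"

text \<open>Coefficientwise the recursion is \<open>h\<^sub>k\<^sub>+\<^sub>1(x\<^sub>1, ...,
  x\<^sub>m) - h\<^sub>k(x\<^sub>1, ..., x\<^sub>m) x\<^sub>m = h\<^sub>k\<^sub>+\<^sub>1(x\<^sub>1,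
  ..., x\<^sub>m\<^sub>-\<^sub>1)\<close> at the Jucys--Murphy elements.\<close>

lemma jm_inverse_hom_jm_gf: "jm_inverse n fps_X (hom_jm_gf n)"
proof
  fix p assume p: "p permutes {1..n}"
  have "sorted_words 0 (Suc k) = {}" for k by (auto simp: sorted_words_def length_Suc_conv)
  then have *: "hom_jm n 0 k p = of_bool (k = 0) * of_bool (p = id)" for k
    by (cases k) (simp_all add: hom_jm_0 hom_jm_def[of n 0 "Suc _"])
  show "hom_jm_gf n 0 p = of_bool (p = id)"
    by (rule fps_ext) (simp add: hom_jm_gf_def *)
  fix m assume m: "m \<in> {1..n}"
  show "hom_jm_gf n m p - fps_X * (\<Sum>s\<in>{1..<m}. hom_jm_gf n m (p \<circ> swap s m)) = hom_jm_gf n (m - 1) p"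
  proof (rule fps_ext)
    fix k
    show "fps_nth (hom_jm_gf n m p - fps_X * (\<Sum>s\<in>{1..<m}. hom_jm_gf n m (p \<circ> swap s m))) k
      = fps_nth (hom_jm_gf n (m - 1) p) k"
      using hom_jm_Suc[OF m p] by (cases k) (simp_all add: hom_jm_gf_def hom_jm_0 fps_sum_nth)
  qed
qed

section \<open>Reduced cycle types and the expansion in class sums\<close>

lemma sum_cycle_type:
  assumes p: "p permutes {1..n}"
  shows "sum_mset (cycle_type n p) = n" "0 \<notin># cycle_type n p"
proof -
  have pp: "permutation p" using p by (auto simp: permutation_permutes)
  have fin: "finite C" if "C \<in> orbit p ` {1..n}" for C
    using that finite_orbit[OF permutation_self_in_orbit[OF pp]] by auto
  have "disjoint (orbit p ` {1..n})"
  proof (rule disjointI)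
    fix C C' assume C: "C \<in> orbit p ` {1..n}" "C' \<in> orbit p ` {1..n}" "C \<noteq> C'"
    have "orbit p v = D" if "D \<in> orbit p ` {1..n}" "v \<in> D" for v D
      using that orbit_eq_if_mem[OF pp] by (metis imageE)
    then show "C \<inter> C' = {}" using C by (metis disjoint_iff)
  qed
  then have "card (\<Union>(orbit p ` {1..n})) = (\<Sum>C\<in>orbit p ` {1..n}. card C)"
    using fin by (rule card_Union_disjoint)
  moreover have "\<Union>(orbit p ` {1..n}) = {1..n}"
  proof
    show "\<Union>(orbit p ` {1..n}) \<subseteq> {1..n}" using permutes_orbit_subset[OF p] by (rule UN_least)
    show "{1..n} \<subseteq> \<Union>(orbit p ` {1..n})" using permutation_self_in_orbit[OF pp] by (intro subsetI UN_I)
  qed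
  ultimately show "sum_mset (cycle_type n p) = n"
    by (simp add: cycle_type_def sum_unfold_sum_mset)
  have no_zero: "card (orbit p x) = 0 \<longleftrightarrow> False" for x
    using finite_orbit[OF permutation_self_in_orbit[OF pp]] orbit_nonempty[of p x] by simp
  show "0 \<notin># cycle_type n p" by (auto simp: cycle_type_def no_zero)
qed

text \<open>Reduction loses only the parts equal to 1, and their number is recovered from the total.
  For fixed \<open>n\<close> the reduced cycle type therefore determines the cycle type.\<close>

lemma unreduce_partition:
  fixes \<nu> :: "nat multiset"
  assumes "0 \<notin># \<nu>"
  defines "\<rho> \<equiv> filter_mset (\<lambda>m. 0 < m) (image_mset (\<lambda>m. m - 1) \<nu>)"
  shows "\<exists>c. image_mset Suc \<rho> + replicate_mset c 1 = \<nu> \<and> sum_mset \<nu> = sum_mset \<rho> + size \<rho> + c"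
  using assms(1) unfolding \<rho>_def
proof (induction \<nu>)
  case empty
  then show ?case by simp
next
  case (add l \<nu>)
  then obtain c where c: "image_mset Suc (filter_mset (\<lambda>m. 0 < m) (image_mset (\<lambda>m. m - 1) \<nu>)) + replicate_mset c 1 = \<nu>"
    "sum_mset \<nu> = sum_mset (filter_mset (\<lambda>m. 0 < m) (image_mset (\<lambda>m. m - 1) \<nu>))
      + size (filter_mset (\<lambda>m. 0 < m) (image_mset (\<lambda>m. m - 1) \<nu>)) + c" by auto
  show ?case
  proof (cases "l = 1")
    case True
    then show ?thesis using c by (intro exI[of _ "Suc c"]) simp
  next
    case False
    then have "0 < l - 1" "Suc (l - 1) = l" using add.prems by auto
    then show ?thesis using c by (intro exI[of _ c]) simp
  qed
qed

lemma cycle_type_eq: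
  assumes p: "p permutes {1..n}"
  shows "cycle_type n p = image_mset Suc (reduced_cycle_type n p)
      + replicate_mset (n - (sum_mset (reduced_cycle_type n p) + size (reduced_cycle_type n p))) 1"
    and "reduced_cycle_type n p \<in> reduced_partitions n"
proof -
  let ?\<rho> = "reduced_cycle_type n p"
  obtain c where c: "image_mset Suc ?\<rho> + replicate_mset c 1 = cycle_type n p"
    "sum_mset (cycle_type n p) = sum_mset ?\<rho> + size ?\<rho> + c"
    using unreduce_partition[OF sum_cycle_type(2)[OF p]] unfolding reduced_cycle_type_def by blast
  then have "n = sum_mset ?\<rho> + size ?\<rho> + c" using sum_cycle_type(1)[OF p] by simp
  then have n: "c = n - (sum_mset ?\<rho> + size ?\<rho>)" "sum_mset ?\<rho> + size ?\<rho> \<le> n" by simp_all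
  show "cycle_type n p = image_mset Suc ?\<rho> + replicate_mset (n - (sum_mset ?\<rho> + size ?\<rho>)) 1"
    using c(1) unfolding n(1) by (rule sym)
  have "0 \<notin># ?\<rho>" by (simp add: reduced_cycle_type_def)
  then show "?\<rho> \<in> reduced_partitions n"
    using n(2) by (simp add: reduced_partitions_def)
qed

lemma reduce_unreduced_partition:
  assumes "0 \<notin># \<mu>"
  shows "filter_mset (\<lambda>m. 0 < m) (image_mset (\<lambda>m. m - 1) (image_mset Suc \<mu> + replicate_mset k 1)) = \<mu>"
proof -
  have "filter_mset (\<lambda>m. 0 < m) (image_mset (\<lambda>m. m - 1) (image_mset Suc \<mu>)) = \<mu>"
    using assms
  proof (induction \<mu>)
    case (add l \<mu>)
    then have "0 < l" by (cases l) simp_all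
    then show ?case using add by simp
  qed simp
  moreover have "filter_mset (\<lambda>m. 0 < m) (image_mset (\<lambda>m. m - 1) (replicate_mset k (1 :: nat))) = {#}"
    by (rule multiset_eqI) (simp add: count_eq_zero_iff)
  ultimately show ?thesis by (simp only: image_mset_union filter_union_mset add_0_right)
qed

lemma ex_permutation_with_reduced_cycle_type:
  assumes "\<mu> \<in> reduced_partitions n"
  shows "\<exists>p. p permutes {1..n} \<and> reduced_cycle_type n p = \<mu>"
proof -
  define \<nu> where "\<nu> = image_mset Suc \<mu> + replicate_mset (n - (sum_mset \<mu> + size \<mu>)) 1"
  have le: "sum_mset \<mu> + size \<mu> \<le> n" using assms by (simp add: reduced_partitions_def)
  have "sum_mset (image_mset Suc \<kappa>) = sum_mset \<kappa> + size \<kappa>" for \<kappa> :: "nat multiset"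
    by (induction \<kappa>) auto
  then have "sum_mset \<nu> = n" "0 \<notin># \<nu>"
    using le unfolding \<nu>_def by auto
  then have "\<exists>p. p permutes {1..n} \<and> cycle_type n p = \<nu>"
    unfolding cycle_type_def using ex_permutation_with_cycle_type[of "{1..n}" \<nu>] by simp
  then obtain p where p: "p permutes {1..n}" "cycle_type n p = \<nu>" by blast
  have "reduced_cycle_type n p = \<mu>"
    unfolding reduced_cycle_type_def p(2) \<nu>_def
    using assms by (intro reduce_unreduced_partition) (simp add: reduced_partitions_def)
  then show ?thesis using p(1) by blast
qed

lemma finite_reduced_partitions: "finite (reduced_partitions n)"
proof (rule finite_subset)
  show "reduced_partitions n \<subseteq> reduced_cycle_type n ` {p. p permutes {1..n}}"
    using ex_permutation_with_reduced_cycle_type by blast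
qed (simp add: finite_permutations)

lemma sum_class_sum:
  assumes p: "p permutes {1..n}"
  shows "(\<Sum>\<mu>\<in>reduced_partitions n. F \<mu> * class_sum n \<mu> p) = F (reduced_cycle_type n p)"
proof -
  have "(\<Sum>\<mu>\<in>reduced_partitions n. F \<mu> * class_sum n \<mu> p)
    = (\<Sum>\<mu>\<in>{reduced_cycle_type n p}. F \<mu> * class_sum n \<mu> p)"
    using cycle_type_eq(2)[OF p]
    by (intro sum.mono_neutral_right) (auto simp: finite_reduced_partitions class_sum_def)
  then show ?thesis using p by (simp add: class_sum_def)
qed

lemma hom_jm_eq_if_same_type:
  assumes p: "p permutes {1..n}" and q: "q permutes {1..n}"
    and eq: "reduced_cycle_type n p = reduced_cycle_type n q"
  shows "hom_jm n n k p = hom_jm n n k q"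
proof -
  interpret jm_inverse n fps_X "hom_jm_gf n" by (rule jm_inverse_hom_jm_gf)
  have "cycle_type n p = cycle_type n q"
    using cycle_type_eq(1)[OF p] cycle_type_eq(1)[OF q] eq by simp
  then have "hom_jm_gf n n p = hom_jm_gf n n q"
    using p q by (intro X_eq_if_same_cycle_type) (simp_all add: cycle_type_def)
  then have "fps_nth (hom_jm_gf n n p) k = fps_nth (hom_jm_gf n n q) k" by simp
  then show ?thesis by (simp add: hom_jm_gf_def)
qed

text \<open>The definite description needs existence and uniqueness. Existence holds because
  \<open>hom_jm n n k\<close> is a class function; uniqueness, because every admissible
  \<open>\<mu>\<close> is the type of some permutation and the class sums have disjoint
  supports.\<close>

lemma class_coeff_reduced_cycle_type:
  assumes p: "p permutes {1..n}"
  shows "class_coeff n k (reduced_cycle_type n p) = hom_jm n n k p"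
proof -
  define rep where "rep \<mu> = (SOME q. q permutes {1..n} \<and> reduced_cycle_type n q = \<mu>)" for \<mu>
  have rep: "rep \<mu> permutes {1..n} \<and> reduced_cycle_type n (rep \<mu>) = \<mu>" if "\<mu> \<in> reduced_partitions n" for \<mu>
    unfolding rep_def using ex_permutation_with_reduced_cycle_type[OF that] by (rule someI_ex)
  define F where "F \<mu> = (if \<mu> \<in> reduced_partitions n then hom_jm n n k (rep \<mu>) else 0)" for \<mu>
  have F: "F (reduced_cycle_type n q) = hom_jm n n k q" if "q permutes {1..n}" for q
  proof -
    have "reduced_cycle_type n q \<in> reduced_partitions n" using that by (rule cycle_type_eq(2))
    then show ?thesis
      unfolding F_def using rep[of "reduced_cycle_type n q"] that
      by (auto intro: hom_jm_eq_if_same_type)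
  qed
  have "class_coeff n k = F"
    unfolding class_coeff_def
  proof (rule the_equality)
    show "(\<forall>\<mu>. \<mu> \<notin> reduced_partitions n \<longrightarrow> F \<mu> = 0) \<and>
      complete_hom n k jucys_murphy = (\<lambda>p. \<Sum>\<mu>\<in>reduced_partitions n. F \<mu> * class_sum n \<mu> p)"
    proof (intro conjI allI impI ext)
      fix q
      show "complete_hom n k jucys_murphy q = (\<Sum>\<mu>\<in>reduced_partitions n. F \<mu> * class_sum n \<mu> q)"
      proof (cases "q permutes {1..n}")
        case True
        then show ?thesis unfolding complete_hom_eq_hom_jm sum_class_sum[OF True] by (rule F[symmetric])
      next
        case False
        then show ?thesis unfolding complete_hom_eq_hom_jm hom_jm_outside[OF False] by (simp add: class_sum_def)
      qed
    qed (simp add: F_def)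
  next
    fix F' assume F': "(\<forall>\<mu>. \<mu> \<notin> reduced_partitions n \<longrightarrow> F' \<mu> = 0) \<and>
      complete_hom n k jucys_murphy = (\<lambda>p. \<Sum>\<mu>\<in>reduced_partitions n. F' \<mu> * class_sum n \<mu> p)"
    show "F' = F"
    proof
      fix \<mu>
      show "F' \<mu> = F \<mu>"
      proof (cases "\<mu> \<in> reduced_partitions n")
        case True
        then have r: "rep \<mu> permutes {1..n}" "reduced_cycle_type n (rep \<mu>) = \<mu>" using rep by auto
        have "hom_jm n n k (rep \<mu>) = (\<Sum>\<nu>\<in>reduced_partitions n. F' \<nu> * class_sum n \<nu> (rep \<mu>))"
          using F' fun_cong[of "hom_jm n n k" _ "rep \<mu>"] unfolding complete_hom_eq_hom_jm by auto
        then show ?thesis using sum_class_sum[OF r(1), of F'] r(2) True by (simp add: F_def)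
      next
        case False
        then show ?thesis using F' by (simp add: F_def)
      qed
    qed
  qed
  then show ?thesis using F[OF p] by simp
qed

lemma reduced_cycle_type_single_orbit:
  assumes "2 \<le> n" "p permutes {1..n}" "card (orbit p ` {1..n}) = 1"
  shows "reduced_cycle_type n p = {#n - 1#}"
proof -
  have "orbit p ` {1..n} = {{1..n}}" using single_orbit_iff[of p "{1..n}"] assms by simp
  then show ?thesis using assms(1) by (simp add: reduced_cycle_type_def cycle_type_def)
qed

text \<open>With \<open>m = n - 1\<close> this is the Catalan number as
  \<open>(2 m)! / (m! (m + 1)!)\<close>, the shape in which the hook sum produces it.\<close>

lemma of_nat_fact_mult_catalan:
  assumes "1 \<le> n"
  shows "of_nat (fact n * fact (n - 1)) * catalan (n - 1) = of_nat (fact (2 * (n - 1)))"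
proof -
  define m where "m = n - 1"
  have "fact m * fact m * ((2 * m) choose m) = (fact (2 * m) :: nat)"
    using binomial_fact_lemma[of m "2 * m"] by simp
  then have "of_nat (fact m * fact m * ((2 * m) choose m)) = (of_nat (fact (2 * m)) :: complex)" by simp
  moreover have "n = Suc m" using assms by (simp add: m_def)
  then have "fact n * fact m = (m + 1) * (fact m * fact m :: nat)" by (simp add: algebra_simps)
  then have "of_nat (fact n * fact m) = (of_nat (m + 1) * of_nat (fact m * fact m) :: complex)"
    by (simp only: of_nat_mult)
  moreover have "of_nat (m + 1) \<noteq> (0 :: complex)" by (simp only: of_nat_eq_0_iff)
  ultimately show ?thesis
    unfolding m_def[symmetric] catalan_def by (simp only: of_nat_mult mult.assoc) simp
qed

lemma class_gf_single_cycle: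
  assumes n: "2 \<le> n"
  shows "class_gf n {#n - 1#} =
           fps_const (catalan (n - 1)) * fps_X ^ (n - 1) /
             (\<Prod>i=1..n - 1. 1 - fps_const (of_nat i ^ 2) * fps_X ^ 2)"
proof -
  interpret jm_inverse n fps_X "hom_jm_gf n" by (rule jm_inverse_hom_jm_gf)
  let ?D = "\<Prod>i=1..n - 1. 1 - fps_const (of_nat i ^ 2 :: complex) * fps_X ^ 2"
  have "card {p. p permutes {1..n} \<and> card (orbit p ` {1..n}) = 1} \<noteq> 0"
    using card_single_orbit_permutations[of "{1..n}"] n by simp
  then have "{p. p permutes {1..n} \<and> card (orbit p ` {1..n}) = 1} \<noteq> {}" by (metis card.empty)
  then obtain c where c: "c permutes {1..n}" "card (orbit c ` {1..n}) = 1" by blast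
  have gf: "class_gf n {#n - 1#} = hom_jm_gf n n c"
    using class_coeff_reduced_cycle_type[OF c(1)] reduced_cycle_type_single_orbit[OF n c]
    by (simp add: class_gf_def hom_jm_gf_def)
  let ?K = "fact n * fact (n - 1) :: nat"
  have of_nat_eq: "of_nat k = fps_const (of_nat k :: complex)" for k :: nat by (simp add: fps_of_nat)
  have "of_nat ?K * (hom_jm_gf n n c * ?D) = of_nat (fact (2 * (n - 1))) * fps_X ^ (n - 1)"
    using X_single_orbit[OF _ c] n by (simp add: of_nat_eq fps_const_power del: of_nat_fact of_nat_mult)
  also have "(of_nat (fact (2 * (n - 1))) :: complex fps) = of_nat ?K * fps_const (catalan (n - 1))"
    unfolding of_nat_eq using of_nat_fact_mult_catalan[of n] n by simp
  finally have "of_nat ?K * (hom_jm_gf n n c * ?D) = of_nat ?K * (fps_const (catalan (n - 1)) * fps_X ^ (n - 1))"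
    by (simp only: mult.assoc)
  then have "hom_jm_gf n n c * ?D = fps_const (catalan (n - 1)) * fps_X ^ (n - 1)"
    by (subst (asm) mult_cancel_left) simp
  moreover have "?D \<noteq> 0"
  proof
    assume "?D = 0"
    then obtain i where "1 - fps_const (of_nat i ^ 2 :: complex) * fps_X ^ 2 = 0"
      by (auto simp only: prod_zero_iff finite_atLeastAtMost)
    then have "fps_nth (1 - fps_const (of_nat i ^ 2 :: complex) * fps_X ^ 2) 0 = fps_nth 0 0" by (rule arg_cong)
    moreover have "fps_nth (1 - fps_const (of_nat i ^ 2 :: complex) * fps_X ^ 2) 0 = 1" by simp
    ultimately show False by (simp only: fps_zero_nth one_neq_zero)
  qed
  ultimately show ?thesis unfolding gf by (metis nonzero_mult_div_cancel_right)
qed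

section \<open>Haar moments\<close>

lemma norm_unitary_le:
  fixes A :: "complex^'N^'N"
  assumes "unitary_matrix A"
  shows "norm A \<le> real CARD('N)"
proof -
  have "norm (A $ i) \<le> 1" for i
  proof -
    have "(\<Sum>k\<in>UNIV. A $ i $ k * cnj (A $ i $ k)) = (A ** adjoint_matrix A) $ i $ i"
      by (simp add: matrix_matrix_mult_def adjoint_matrix_def)
    also have "\<dots> = 1" using assms by (simp add: unitary_matrix_def mat_def)
    finally have "complex_of_real (\<Sum>k\<in>UNIV. (norm (A $ i $ k))\<^sup>2) = complex_of_real 1"
      by (simp only: complex_norm_square of_real_sum of_real_1)
    then have "(\<Sum>k\<in>UNIV. (norm (A $ i $ k))\<^sup>2) = 1" by (simp only: of_real_eq_iff)
    then show ?thesis by (simp add: norm_vec_def L2_set_def)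
  qed
  then have "(\<Sum>i\<in>UNIV. norm (A $ i)) \<le> (\<Sum>i\<in>(UNIV :: 'N set). 1)" by (intro sum_mono)
  moreover have "norm A \<le> (\<Sum>i\<in>UNIV. norm (A $ i))"
    unfolding norm_vec_def by (rule L2_set_le_sum) simp
  ultimately show ?thesis by simp
qed

lemma unitary_matrix_column_orthogonality:
  fixes A :: "complex^'N^'N"
  assumes "unitary_matrix A"
  shows "(\<Sum>r\<in>UNIV. A $ r $ j * cnj (A $ r $ k)) = of_bool (j = k)"
proof -
  have "(\<Sum>r\<in>UNIV. A $ r $ j * cnj (A $ r $ k)) = (adjoint_matrix A ** A) $ k $ j"
    by (simp add: matrix_matrix_mult_def adjoint_matrix_def mult.commute)
  then show ?thesis using assms by (auto simp: unitary_matrix_def mat_def)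
qed

definition mix_rows :: "'N \<Rightarrow> 'N \<Rightarrow> complex \<Rightarrow> complex \<Rightarrow> complex \<Rightarrow> complex \<Rightarrow> complex^'M^'N \<Rightarrow> complex^'M^'N" where
  "mix_rows a b \<alpha> \<beta> \<gamma> \<delta> A = (\<chi> i j.
    if i = a then \<alpha> * A $ a $ j + \<beta> * A $ b $ j else if i = b then \<gamma> * A $ a $ j + \<delta> * A $ b $ j else A $ i $ j)"

text \<open>The conditions say that the 2 by 2 block has orthonormal rows. The matrix is found by
  applying the row operation to the identity, and a one-sided inverse of a square matrix is
  two-sided.\<close>

lemma mix_rows_unitary:
  fixes a b :: "'N :: finite"
  assumes ab: "a \<noteq> b" and 1: "\<alpha> * cnj \<alpha> + \<beta> * cnj \<beta> = 1" and 2: "\<gamma> * cnj \<gamma> + \<delta> * cnj \<delta> = 1"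
    and 3: "\<alpha> * cnj \<gamma> + \<beta> * cnj \<delta> = 0"
  shows "\<exists>V :: complex^'N^'N. unitary_matrix V \<and> (\<forall>A :: complex^'N^'N. V ** A = mix_rows a b \<alpha> \<beta> \<gamma> \<delta> A)"
proof -
  define V :: "complex^'N^'N" where "V = mix_rows a b \<alpha> \<beta> \<gamma> \<delta> (mat 1)"
  have Vent: "V $ i $ j = (if i = a then \<alpha> * of_bool (j = a) + \<beta> * of_bool (j = b)
      else if i = b then \<gamma> * of_bool (j = a) + \<delta> * of_bool (j = b) else of_bool (j = i))" for i j
    unfolding V_def mix_rows_def by (auto simp: mat_def)
  have delta: "(\<Sum>k\<in>UNIV. of_bool (k = c) * f k) = f c" for c :: 'N and f :: "'N \<Rightarrow> complex"
    by (subst sum.mono_neutral_right[of UNIV "{c}"]) auto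
  have V_mult: "V ** A = mix_rows a b \<alpha> \<beta> \<gamma> \<delta> A" for A :: "complex^'N^'N"
  proof -
    have "(V ** A) $ i $ j = mix_rows a b \<alpha> \<beta> \<gamma> \<delta> A $ i $ j" for i j
    proof -
      have "(V ** A) $ i $ j = (\<Sum>k\<in>UNIV. V $ i $ k * A $ k $ j)"
        by (simp add: matrix_matrix_mult_def)
      also have "\<dots> = mix_rows a b \<alpha> \<beta> \<gamma> \<delta> A $ i $ j"
        unfolding Vent mix_rows_def
        by (auto simp: distrib_right sum.distrib mult.assoc delta simp flip: sum_distrib_left)
      finally show ?thesis .
    qed
    then show ?thesis by (simp add: vec_eq_iff)
  qed
  have orth: "\<gamma> * cnj \<alpha> + \<delta> * cnj \<beta> = 0" using arg_cong[OF 3, of cnj] by (simp add: mult.commute)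
  have "V ** adjoint_matrix V = mat 1"
    unfolding V_mult mix_rows_def adjoint_matrix_def vec_eq_iff
    using ab 1 2 3 orth by (auto simp: Vent mat_def)
  then have "unitary_matrix V"
    unfolding unitary_matrix_def using matrix_left_right_inverse by blast
  then show ?thesis using V_mult by blast
qed

text \<open>\<open>\<theta>'\<close> is the conjugate of \<open>\<theta>\<close>. Summation over the
  fourth roots of unity removes each monomial with unequal numbers of factors
  \<open>\<theta>\<close> and \<open>\<theta>'\<close>; six of the sixteen monomials are
  balanced.\<close>

lemma sum_four_phases:
  fixes x1 x2 x3 x4 y1 y2 y3 y4 :: complex
  shows "(\<Sum>(\<theta>, \<theta>')\<leftarrow>[(1, 1), (- 1, - 1), (\<i>, - \<i>), (- \<i>, \<i>)].
      ((x1 + \<theta> * y1) * (x3 + \<theta>' * y3)) * ((x2 + \<theta> * y2) * (x4 + \<theta>' * y4)))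
    = 4 * (x1 * x3 * (x2 * x4) + y1 * y3 * (y2 * y4) + x1 * x3 * (y2 * y4) + x1 * y3 * (y2 * x4)
      + y1 * x3 * (x2 * y4) + y1 * y3 * (x2 * x4))"
  by (simp add: algebra_simps)

section \<open>Expectations under the Haar measure and the recursion for moments\<close>

locale haar_setting =
  fixes M :: "'a measure" and U :: "'a \<Rightarrow> complex^'N^'N"
  assumes haar: "haar_random_unitary M U"
begin

lemma prob_space_M: "prob_space M"
  using haar by (simp add: haar_random_unitary_def)

lemma measurable_U: "U \<in> borel_measurable M"
  using haar by (simp add: haar_random_unitary_def)

lemma AE_unitary: "AE \<omega> in M. unitary_matrix (U \<omega>)"
proof -
  let ?H = "distr M borel U"
  have H: "prob_space ?H" "emeasure ?H {A. unitary_matrix A} = 1"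
    using haar by (auto simp: haar_random_unitary_def haar_unitary_def)
  have "AE A in ?H. A \<in> {A. unitary_matrix A}"
    using H by (intro prob_space.AE_prob_1) (auto simp: measure_def)
  then have "AE A in ?H. unitary_matrix A" by simp
  then show ?thesis using measurable_U by (rule AE_distrD[rotated])
qed

lemma integrable_continuous:
  assumes f: "continuous_on UNIV (f :: complex^'N^'N \<Rightarrow> complex)"
  shows "integrable M (\<lambda>\<omega>. f (U \<omega>))"
proof -
  interpret prob_space M by (rule prob_space_M)
  have "compact (f ` cball 0 (real CARD('N)))"
    using f by (intro compact_continuous_image) (auto intro: continuous_on_subset)
  then have "bounded (f ` cball 0 (real CARD('N)))" by (rule compact_imp_bounded)
  then obtain B where B: "\<forall>y\<in>f ` cball 0 (real CARD('N)). norm y \<le> B" unfolding bounded_iff ..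
  have "(\<lambda>\<omega>. f (U \<omega>)) \<in> borel_measurable M"
    using borel_measurable_continuous_onI[OF f] measurable_U by (rule measurable_compose[rotated])
  moreover have "AE \<omega> in M. norm (f (U \<omega>)) \<le> B"
    using AE_unitary
  proof eventually_elim
    fix \<omega> assume "unitary_matrix (U \<omega>)"
    then have "U \<omega> \<in> cball 0 (real CARD('N))" using norm_unitary_le by simp
    then show "norm (f (U \<omega>)) \<le> B" using B by simp
  qed
  ultimately show ?thesis by (intro integrable_const_bound)
qed

lemma expectation_mix_rows:
  assumes f: "continuous_on UNIV (f :: complex^'N^'N \<Rightarrow> complex)"
    and "a \<noteq> b" "\<alpha> * cnj \<alpha> + \<beta> * cnj \<beta> = 1" "\<gamma> * cnj \<gamma> + \<delta> * cnj \<delta> = 1" "\<alpha> * cnj \<gamma> + \<beta> * cnj \<delta> = 0"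
  shows "(\<integral>\<omega>. f (mix_rows a b \<alpha> \<beta> \<gamma> \<delta> (U \<omega>)) \<partial>M) = (\<integral>\<omega>. f (U \<omega>) \<partial>M)"
proof -
  obtain V :: "complex^'N^'N" where V: "unitary_matrix V" "\<And>A :: complex^'N^'N. V ** A = mix_rows a b \<alpha> \<beta> \<gamma> \<delta> A"
    using mix_rows_unitary[OF assms(2-)] by metis
  let ?H = "distr M borel U"
  have H: "distr ?H borel (\<lambda>A. V ** A) = ?H"
    using haar V(1) by (auto simp: haar_random_unitary_def haar_unitary_def)
  have fm: "f \<in> borel_measurable borel" using f by (rule borel_measurable_continuous_onI)
  have "continuous_on UNIV (\<lambda>A :: complex^'N^'N. V ** A)"
    unfolding matrix_matrix_mult_def by (intro continuous_intros continuous_on_vec_lambda)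
  then have Vm: "(\<lambda>A :: complex^'N^'N. V ** A) \<in> borel_measurable borel" by (rule borel_measurable_continuous_onI)
  have "(\<integral>\<omega>. f (U \<omega>) \<partial>M) = (\<integral>A. f A \<partial>?H)"
    using measurable_U fm by (simp add: integral_distr)
  also have "\<dots> = (\<integral>A. f A \<partial>distr ?H borel (\<lambda>A. V ** A))" unfolding H ..
  also have "\<dots> = (\<integral>A. f (V ** A) \<partial>?H)"
    using Vm fm by (intro integral_distr) simp_all
  also have "\<dots> = (\<integral>\<omega>. f (V ** U \<omega>) \<partial>M)"
    using measurable_compose[OF Vm fm] measurable_U by (simp add: integral_distr)
  finally show ?thesis by (simp add: V(2))
qed

lemma expectation_swap_rows:
  assumes "continuous_on UNIV (f :: complex^'N^'N \<Rightarrow> complex)" "a \<noteq> b"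
  shows "(\<integral>\<omega>. f (mix_rows a b 0 1 1 0 (U \<omega>)) \<partial>M) = (\<integral>\<omega>. f (U \<omega>) \<partial>M)"
  using assms by (intro expectation_mix_rows) auto

text \<open>By invariance, row \<open>a\<close> may be replaced by row \<open>a\<close> plus
  \<open>\<theta>\<close> times row \<open>b\<close>, divided by the root of 2. Averaging over four
  phases leaves six expectations, which the exchange of \<open>a\<close> and \<open>b\<close>
  identifies in pairs. One pair is the left-hand side itself, with total weight one half, and
  solving for it gives the identity.\<close>

lemma expectation_repeated_row:
  fixes K :: "complex^'N^'N \<Rightarrow> complex"
  assumes ab: "a \<noteq> b" and K: "continuous_on UNIV K"
    and K_indep: "\<And>A B. (\<And>i. i \<noteq> a \<Longrightarrow> i \<noteq> b \<Longrightarrow> A $ i = B $ i) \<Longrightarrow> K A = K B"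
  shows "(\<integral>\<omega>. K (U \<omega>) * (U \<omega> $ a $ j * cnj (U \<omega> $ a $ l)) * (U \<omega> $ a $ j' * cnj (U \<omega> $ a $ l')) \<partial>M)
    = (\<integral>\<omega>. K (U \<omega>) * (U \<omega> $ a $ j * cnj (U \<omega> $ a $ l)) * (U \<omega> $ b $ j' * cnj (U \<omega> $ b $ l')) \<partial>M)
    + (\<integral>\<omega>. K (U \<omega>) * (U \<omega> $ a $ j * cnj (U \<omega> $ a $ l')) * (U \<omega> $ b $ j' * cnj (U \<omega> $ b $ l)) \<partial>M)"
proof -
  \<comment> \<open>\<open>r1\<close>, \<open>r2\<close> are the rows of the plain entries and
    \<open>r3\<close>, \<open>r4\<close> those of the conjugated ones, in the order of the columns
    \<open>j\<close>, \<open>j'\<close>, \<open>l\<close>, \<open>l'\<close>.\<close>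
  define F where "F r1 r2 r3 r4 A = K A * (A $ r1 $ j * cnj (A $ r3 $ l)) * (A $ r2 $ j' * cnj (A $ r4 $ l'))"
    for r1 r2 r3 r4 and A :: "complex^'N^'N"
  define E where "E r1 r2 r3 r4 = (\<integral>\<omega>. F r1 r2 r3 r4 (U \<omega>) \<partial>M)" for r1 r2 r3 r4
  have cont: "continuous_on UNIV (F r1 r2 r3 r4)" for r1 r2 r3 r4
    unfolding F_def by (intro continuous_intros K)
  have int: "integrable M (\<lambda>\<omega>. F r1 r2 r3 r4 (U \<omega>))" for r1 r2 r3 r4
    using cont by (rule integrable_continuous)
  have K_mix: "K (mix_rows a b \<alpha> \<beta> \<gamma> \<delta> A) = K A" for \<alpha> \<beta> \<gamma> \<delta> A
    by (rule K_indep) (simp add: mix_rows_def vec_eq_iff)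
  have rows: "mix_rows a b \<alpha> \<beta> \<gamma> \<delta> A $ a $ k = \<alpha> * A $ a $ k + \<beta> * A $ b $ k"
    "mix_rows a b \<alpha> \<beta> \<gamma> \<delta> A $ b $ k = \<gamma> * A $ a $ k + \<delta> * A $ b $ k" for \<alpha> \<beta> \<gamma> \<delta> and A :: "complex^'N^'N" and k
    using ab by (auto simp: mix_rows_def)
  have swap1: "E b b b b = E a a a a" and swap2: "E b a b a = E a b a b" and swap3: "E b a a b = E a b b a"
    unfolding E_def
    using expectation_swap_rows[OF cont ab, of a a a a] expectation_swap_rows[OF cont ab, of a b a b]
      expectation_swap_rows[OF cont ab, of a b b a]
    by (simp_all add: F_def K_mix rows)
  define \<sigma> where "\<sigma> = complex_of_real (sqrt 2)"
  have \<sigma>: "\<sigma> * \<sigma> = 2" "cnj \<sigma> = \<sigma>"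
    by (simp_all add: \<sigma>_def flip: of_real_mult)
  then have "\<sigma> \<noteq> 0" by auto
  \<comment> \<open>The second row of the block is chosen so that the block is unitary when
    \<open>\<theta>\<close> has modulus 1.\<close>
  define mix where "mix \<theta> A = F a a a a (mix_rows a b (1 / \<sigma>) (\<theta> / \<sigma>) (1 / \<sigma>) (- \<theta> / \<sigma>) A)"
    for \<theta> and A :: "complex^'N^'N"
  have mixed: "(\<integral>\<omega>. mix \<theta> (U \<omega>) \<partial>M) = E a a a a" if "\<theta> * cnj \<theta> = 1" for \<theta> :: complex
    unfolding E_def mix_def using that ab cont \<sigma>
    by (intro expectation_mix_rows) simp_all
  have mix_eq: "mix \<theta> A = K A * (((A $ a $ j + \<theta> * A $ b $ j) * (cnj (A $ a $ l) + cnj \<theta> * cnj (A $ b $ l)))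
      * ((A $ a $ j' + \<theta> * A $ b $ j') * (cnj (A $ a $ l') + cnj \<theta> * cnj (A $ b $ l')))) / 4" for \<theta> A
  proof -
    have lin: "1 / \<sigma> * u + \<theta> / \<sigma> * v = (u + \<theta> * v) / \<sigma>" for u v by (simp add: add_divide_distrib)
    have "mix \<theta> A = K A * (((A $ a $ j + \<theta> * A $ b $ j) * (cnj (A $ a $ l) + cnj \<theta> * cnj (A $ b $ l)))
      * ((A $ a $ j' + \<theta> * A $ b $ j') * (cnj (A $ a $ l') + cnj \<theta> * cnj (A $ b $ l')))) / ((\<sigma> * \<sigma>) * (\<sigma> * \<sigma>))"
      unfolding mix_def F_def K_mix rows lin by (simp add: \<sigma>(2))
    then show ?thesis unfolding \<sigma>(1) by simp
  qed
  have mix_int: "integrable M (\<lambda>\<omega>. mix \<theta> (U \<omega>))" for \<theta>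
    unfolding mix_eq by (intro integrable_continuous continuous_intros K) auto
  have phases: "mix 1 A + mix (- 1) A + mix \<i> A + mix (- \<i>) A
    = F a a a a A + F b b b b A + F a b a b A + F a b b a A + F b a a b A + F b a b a A" for A
  proof -
    let ?f = "\<lambda>\<theta> \<theta>'. ((A $ a $ j + \<theta> * A $ b $ j) * (cnj (A $ a $ l) + \<theta>' * cnj (A $ b $ l)))
      * ((A $ a $ j' + \<theta> * A $ b $ j') * (cnj (A $ a $ l') + \<theta>' * cnj (A $ b $ l')))"
    have "mix 1 A + mix (- 1) A + mix \<i> A + mix (- \<i>) A
      = K A * (?f 1 1 + ?f (- 1) (- 1) + ?f \<i> (- \<i>) + ?f (- \<i>) \<i>) / 4"
      unfolding mix_eq by (simp add: distrib_left add_divide_distrib)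
    also have "?f 1 1 + ?f (- 1) (- 1) + ?f \<i> (- \<i>) + ?f (- \<i>) \<i>
      = (\<Sum>(\<theta>, \<theta>')\<leftarrow>[(1, 1), (- 1, - 1), (\<i>, - \<i>), (- \<i>, \<i>)]. ?f \<theta> \<theta>')" by (simp only: list.map prod.case sum_list.Cons sum_list.Nil add.assoc add_0_right)
    also note sum_four_phases
    also have "K A * (4 * (A $ a $ j * cnj (A $ a $ l) * (A $ a $ j' * cnj (A $ a $ l'))
        + A $ b $ j * cnj (A $ b $ l) * (A $ b $ j' * cnj (A $ b $ l'))
        + A $ a $ j * cnj (A $ a $ l) * (A $ b $ j' * cnj (A $ b $ l'))
        + A $ a $ j * cnj (A $ b $ l) * (A $ b $ j' * cnj (A $ a $ l'))
        + A $ b $ j * cnj (A $ a $ l) * (A $ a $ j' * cnj (A $ b $ l'))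
        + A $ b $ j * cnj (A $ b $ l) * (A $ a $ j' * cnj (A $ a $ l')))) / 4
      = F a a a a A + F b b b b A + F a b a b A + F a b b a A + F b a a b A + F b a b a A"
      unfolding F_def by (simp only: distrib_left mult.assoc) simp
    finally show ?thesis .
  qed
  have "E a a a a + E a a a a + E a a a a + E a a a a
    = (\<integral>\<omega>. mix 1 (U \<omega>) \<partial>M) + (\<integral>\<omega>. mix (- 1) (U \<omega>) \<partial>M) + (\<integral>\<omega>. mix \<i> (U \<omega>) \<partial>M) + (\<integral>\<omega>. mix (- \<i>) (U \<omega>) \<partial>M)"
    using mixed[of 1] mixed[of "- 1"] mixed[of \<i>] mixed[of "- \<i>"] by simp
  also have "\<dots> = (\<integral>\<omega>. mix 1 (U \<omega>) + mix (- 1) (U \<omega>) + mix \<i> (U \<omega>) + mix (- \<i>) (U \<omega>) \<partial>M)"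
    using mix_int by (simp add: Bochner_Integration.integral_add Bochner_Integration.integrable_add)
  also have "\<dots> = (\<integral>\<omega>. F a a a a (U \<omega>) + F b b b b (U \<omega>) + F a b a b (U \<omega>) + F a b b a (U \<omega>)
      + F b a a b (U \<omega>) + F b a b a (U \<omega>) \<partial>M)"
    unfolding phases ..
  also have "\<dots> = E a a a a + E b b b b + E a b a b + E a b b a + E b a a b + E b a b a"
    unfolding E_def using int by (simp add: Bochner_Integration.integral_add Bochner_Integration.integrable_add)
  finally have "2 * E a a a a = 2 * (E a b a b + E a b b a)"
    unfolding swap1 swap2 swap3 by (simp add: algebra_simps)
  then have "E a a a a = E a b a b + E a b b a" by (simp only: mult_cancel_left) simp
  then show ?thesis unfolding E_def F_def by (simp add: mult_ac)
qed

text \<open>Rows and columns are labelled separately so that the row of the last factor can vary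
  while its columns stay in place.\<close>

definition moment :: "(nat \<Rightarrow> 'N) \<Rightarrow> (nat \<Rightarrow> 'N) \<Rightarrow> nat \<Rightarrow> (nat \<Rightarrow> nat) \<Rightarrow> complex" where
  "moment \<rho> \<iota> m p = (\<integral>\<omega>. (\<Prod>i=1..m. U \<omega> $ \<rho> i $ \<iota> i * cnj (U \<omega> $ \<rho> i $ \<iota> (p i))) \<partial>M)"

text \<open>No other factor uses row \<open>r\<close>, so exchanging the rows \<open>r\<close> and
  \<open>\<iota> m\<close> affects the last factor alone.\<close>

lemma moment_relabel_last_row:
  assumes inj: "inj_on \<iota> {1..m}" and r: "r \<notin> \<iota> ` {1..<m}" and m: "1 \<le> m"
  shows "moment (\<iota>(m := r)) \<iota> m p = moment \<iota> \<iota> m p"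
proof (cases "r = \<iota> m")
  case True
  then show ?thesis by (simp add: fun_upd_idem)
next
  case False
  let ?f = "\<lambda>\<rho> A. \<Prod>i=1..m. A $ \<rho> i $ \<iota> i * cnj (A $ \<rho> i $ \<iota> (p i)) :: complex"
  have "?f \<iota> (mix_rows r (\<iota> m) 0 1 1 0 A) = ?f (\<iota>(m := r)) A" for A :: "complex^'N^'N"
  proof (rule prod.cong[OF refl])
    fix i assume i: "i \<in> {1..m}"
    have "mix_rows r (\<iota> m) 0 1 1 0 A $ \<iota> i $ k = A $ (\<iota>(m := r)) i $ k" for k
    proof (cases "i = m")
      case True
      then show ?thesis using False by (simp add: mix_rows_def)
    next
      case ne: False
      then have "\<iota> i \<noteq> \<iota> m" using inj i m by (auto dest: inj_onD)
      moreover have "\<iota> i \<noteq> r" using ne i r by auto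
      ultimately show ?thesis using ne by (simp add: mix_rows_def)
    qed
    then show "mix_rows r (\<iota> m) 0 1 1 0 A $ \<iota> i $ \<iota> i * cnj (mix_rows r (\<iota> m) 0 1 1 0 A $ \<iota> i $ \<iota> (p i))
      = A $ (\<iota>(m := r)) i $ \<iota> i * cnj (A $ (\<iota>(m := r)) i $ \<iota> (p i))" by simp
  qed
  moreover have "continuous_on UNIV (?f \<iota>)" by (intro continuous_intros)
  from expectation_swap_rows[OF this False]
  have "(\<integral>\<omega>. ?f \<iota> (mix_rows r (\<iota> m) 0 1 1 0 (U \<omega>)) \<partial>M) = (\<integral>\<omega>. ?f \<iota> (U \<omega>) \<partial>M)" .
  ultimately show ?thesis unfolding moment_def by simp
qed

text \<open>\<open>expectation_repeated_row\<close> with the factors other than \<open>s\<close> and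
  \<open>m\<close> as the kernel; by injectivity they avoid both rows. Exchanging the two conjugated
  columns is right multiplication of \<open>p\<close> by \<open>(s, m)\<close>.\<close>

lemma moment_repeated_row:
  assumes inj: "inj_on \<iota> {1..m}" and s: "s \<in> {1..<m}"
  shows "moment (\<iota>(m := \<iota> s)) \<iota> m p = moment \<iota> \<iota> m p + moment \<iota> \<iota> m (p \<circ> swap s m)"
proof -
  let ?I = "{1..m} - {s, m}"
  define K where "K A = (\<Prod>i\<in>?I. A $ \<iota> i $ \<iota> i * cnj (A $ \<iota> i $ \<iota> (p i)))" for A :: "complex^'N^'N"
  have sm: "s \<in> {1..m}" "m \<in> {1..m}" "s \<noteq> m" using s by auto
  have split: "(\<Prod>i=1..m. g i) = (\<Prod>i\<in>?I. g i) * g s * g m" for g :: "nat \<Rightarrow> complex"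
  proof -
    have "{1..m} = insert s (insert m ?I)" using sm by auto
    then have "(\<Prod>i=1..m. g i) = (\<Prod>i\<in>insert s (insert m ?I). g i)" by simp
    also have "\<dots> = (\<Prod>i\<in>?I. g i) * g s * g m" using sm by (simp add: mult_ac)
    finally show ?thesis .
  qed
  have ne: "\<iota> s \<noteq> \<iota> m" using inj sm by (auto dest: inj_onD)
  have "continuous_on UNIV K" unfolding K_def by (intro continuous_intros)
  moreover have "K A = K B" if "\<And>i. i \<noteq> \<iota> s \<Longrightarrow> i \<noteq> \<iota> m \<Longrightarrow> A $ i = B $ i" for A B
  proof -
    have "A $ \<iota> i = B $ \<iota> i" if "i \<in> ?I" for i
      using that inj sm by (intro \<open>\<And>i. i \<noteq> \<iota> s \<Longrightarrow> i \<noteq> \<iota> m \<Longrightarrow> A $ i = B $ i\<close>) (auto dest: inj_onD)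
    then show ?thesis unfolding K_def by (intro prod.cong) auto
  qed
  ultimately have "(\<integral>\<omega>. K (U \<omega>) * (U \<omega> $ \<iota> s $ \<iota> s * cnj (U \<omega> $ \<iota> s $ \<iota> (p s))) * (U \<omega> $ \<iota> s $ \<iota> m * cnj (U \<omega> $ \<iota> s $ \<iota> (p m))) \<partial>M)
    = (\<integral>\<omega>. K (U \<omega>) * (U \<omega> $ \<iota> s $ \<iota> s * cnj (U \<omega> $ \<iota> s $ \<iota> (p s))) * (U \<omega> $ \<iota> m $ \<iota> m * cnj (U \<omega> $ \<iota> m $ \<iota> (p m))) \<partial>M)
    + (\<integral>\<omega>. K (U \<omega>) * (U \<omega> $ \<iota> s $ \<iota> s * cnj (U \<omega> $ \<iota> s $ \<iota> (p m))) * (U \<omega> $ \<iota> m $ \<iota> m * cnj (U \<omega> $ \<iota> m $ \<iota> (p s))) \<partial>M)"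
    by (rule expectation_repeated_row[OF ne])
  moreover have "(\<Prod>i=1..m. A $ \<iota> i $ \<iota> i * cnj (A $ \<iota> i $ \<iota> (p i)))
      = K A * (A $ \<iota> s $ \<iota> s * cnj (A $ \<iota> s $ \<iota> (p s))) * (A $ \<iota> m $ \<iota> m * cnj (A $ \<iota> m $ \<iota> (p m)))"
    for A :: "complex^'N^'N" unfolding split K_def ..
  moreover have "(\<Prod>i=1..m. A $ (\<iota>(m := \<iota> s)) i $ \<iota> i * cnj (A $ (\<iota>(m := \<iota> s)) i $ \<iota> (p i)))
      = K A * (A $ \<iota> s $ \<iota> s * cnj (A $ \<iota> s $ \<iota> (p s))) * (A $ \<iota> s $ \<iota> m * cnj (A $ \<iota> s $ \<iota> (p m)))"
    for A :: "complex^'N^'N"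
  proof -
    have "(\<Prod>i\<in>?I. A $ (\<iota>(m := \<iota> s)) i $ \<iota> i * cnj (A $ (\<iota>(m := \<iota> s)) i $ \<iota> (p i))) = K A"
      unfolding K_def by (intro prod.cong) auto
    then show ?thesis unfolding split using sm by simp
  qed
  moreover have "(\<Prod>i=1..m. A $ \<iota> i $ \<iota> i * cnj (A $ \<iota> i $ \<iota> ((p \<circ> swap s m) i)))
      = K A * (A $ \<iota> s $ \<iota> s * cnj (A $ \<iota> s $ \<iota> (p m))) * (A $ \<iota> m $ \<iota> m * cnj (A $ \<iota> m $ \<iota> (p s)))"
    for A :: "complex^'N^'N"
  proof -
    have "(\<Prod>i\<in>?I. A $ \<iota> i $ \<iota> i * cnj (A $ \<iota> i $ \<iota> ((p \<circ> swap s m) i))) = K A"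
      unfolding K_def by (intro prod.cong) auto
    then show ?thesis unfolding split by simp
  qed
  ultimately show ?thesis unfolding moment_def by (simp only:)
qed

text \<open>The row of the last factor runs over all rows. Orthogonality of the columns
  \<open>\<iota> m\<close> and \<open>\<iota> (p m)\<close> evaluates the total. Row by row, each of
  the \<open>m - 1\<close> rows already in use gives the moment plus a term with a transposition,
  and every other row gives the moment alone.\<close>

lemma moment_recursion:
  assumes bij: "bij_betw \<iota> {1..CARD('N)} UNIV" and m: "1 \<le> m" "m \<le> CARD('N)" and p: "p permutes {1..m}"
  shows "of_nat CARD('N) * moment \<iota> \<iota> m p + (\<Sum>s\<in>{1..<m}. moment \<iota> \<iota> m (p \<circ> swap s m))
    = (if p m = m then moment \<iota> \<iota> (m - 1) p else 0)"
proof -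
  let ?N = "CARD('N)"
  let ?g = "\<lambda>k A. (\<Prod>i=1..k. A $ \<iota> i $ \<iota> i * cnj (A $ \<iota> i $ \<iota> (p i)) :: complex)"
  have inj: "inj_on \<iota> {1..?N}" using bij by (simp add: bij_betw_def)
  then have injm: "inj_on \<iota> {1..m}" by (rule inj_on_subset) (use m in auto)
  have pm: "p m \<in> {1..m}" using permutes_in_image[OF p, of m] m by simp
  then have eq: "\<iota> m = \<iota> (p m) \<longleftrightarrow> p m = m" using injm m by (auto dest: inj_onD)
  have prod_upd: "(\<Prod>i=1..m. A $ (\<iota>(m := r)) i $ \<iota> i * cnj (A $ (\<iota>(m := r)) i $ \<iota> (p i)))
      = ?g (m - 1) A * (A $ r $ \<iota> m * cnj (A $ r $ \<iota> (p m)))" for r and A :: "complex^'N^'N"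
  proof -
    have "{1..m} = insert m {1..m - 1}" using m by auto
    moreover have "m \<notin> {1..m - 1}" using m by auto
    ultimately have "(\<Prod>i=1..m. A $ (\<iota>(m := r)) i $ \<iota> i * cnj (A $ (\<iota>(m := r)) i $ \<iota> (p i)))
      = (A $ r $ \<iota> m * cnj (A $ r $ \<iota> (p m))) * (\<Prod>i=1..m - 1. A $ (\<iota>(m := r)) i $ \<iota> i * cnj (A $ (\<iota>(m := r)) i $ \<iota> (p i)))"
      by simp
    also have "(\<Prod>i=1..m - 1. A $ (\<iota>(m := r)) i $ \<iota> i * cnj (A $ (\<iota>(m := r)) i $ \<iota> (p i))) = ?g (m - 1) A"
      using m by (intro prod.cong refl) auto
    finally show ?thesis by simp
  qed
  have int: "integrable M (\<lambda>\<omega>. ?g (m - 1) (U \<omega>) * (U \<omega> $ r $ \<iota> m * cnj (U \<omega> $ r $ \<iota> (p m))))" for r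
    by (rule integrable_continuous) (intro continuous_intros)
  have "(\<Sum>r\<in>UNIV. moment (\<iota>(m := r)) \<iota> m p)
    = (\<integral>\<omega>. (\<Sum>r\<in>UNIV. ?g (m - 1) (U \<omega>) * (U \<omega> $ r $ \<iota> m * cnj (U \<omega> $ r $ \<iota> (p m)))) \<partial>M)"
    unfolding moment_def prod_upd using int by (intro Bochner_Integration.integral_sum[symmetric])
  also have "\<dots> = (\<integral>\<omega>. ?g (m - 1) (U \<omega>) * of_bool (p m = m) \<partial>M)"
  proof (rule integral_cong_AE)
    show "(\<lambda>\<omega>. \<Sum>r\<in>UNIV. ?g (m - 1) (U \<omega>) * (U \<omega> $ r $ \<iota> m * cnj (U \<omega> $ r $ \<iota> (p m)))) \<in> borel_measurable M"
      by (intro borel_measurable_sum borel_measurable_integrable int)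
    show "(\<lambda>\<omega>. ?g (m - 1) (U \<omega>) * of_bool (p m = m)) \<in> borel_measurable M"
      by (intro borel_measurable_integrable integrable_continuous continuous_intros)
    show "AE \<omega> in M. (\<Sum>r\<in>UNIV. ?g (m - 1) (U \<omega>) * (U \<omega> $ r $ \<iota> m * cnj (U \<omega> $ r $ \<iota> (p m))))
      = ?g (m - 1) (U \<omega>) * of_bool (p m = m)"
      using AE_unitary
      by eventually_elim (simp only: sum_distrib_left[symmetric] unitary_matrix_column_orthogonality eq)
  qed
  also have "\<dots> = (if p m = m then moment \<iota> \<iota> (m - 1) p else 0)"
    by (simp add: moment_def)
  finally have total: "(\<Sum>r\<in>UNIV. moment (\<iota>(m := r)) \<iota> m p) = (if p m = m then moment \<iota> \<iota> (m - 1) p else 0)" .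
  have "(\<Sum>r\<in>UNIV. moment (\<iota>(m := r)) \<iota> m p) = (\<Sum>k=1..?N. moment (\<iota>(m := \<iota> k)) \<iota> m p)"
    by (rule sum.reindex_bij_betw[OF bij, symmetric])
  also have "{1..?N} = {1..<m} \<union> {m..?N}" using m by auto
  also have "(\<Sum>k\<in>\<dots>. moment (\<iota>(m := \<iota> k)) \<iota> m p)
    = (\<Sum>k\<in>{1..<m}. moment (\<iota>(m := \<iota> k)) \<iota> m p) + (\<Sum>k\<in>{m..?N}. moment (\<iota>(m := \<iota> k)) \<iota> m p)"
    by (rule sum.union_disjoint) auto
  also have "(\<Sum>k\<in>{1..<m}. moment (\<iota>(m := \<iota> k)) \<iota> m p)
    = (\<Sum>k\<in>{1..<m}. moment \<iota> \<iota> m p + moment \<iota> \<iota> m (p \<circ> swap k m))"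
    by (intro sum.cong refl moment_repeated_row[OF injm])
  also have "(\<Sum>k\<in>{m..?N}. moment (\<iota>(m := \<iota> k)) \<iota> m p) = (\<Sum>k\<in>{m..?N}. moment \<iota> \<iota> m p)"
  proof (intro sum.cong refl moment_relabel_last_row[OF injm _ m(1)])
    fix k assume k: "k \<in> {m..?N}"
    show "\<iota> k \<notin> \<iota> ` {1..<m}"
    proof
      assume "\<iota> k \<in> \<iota> ` {1..<m}"
      then obtain i where i: "i \<in> {1..<m}" "\<iota> k = \<iota> i" by blast
      have "k = i" by (rule inj_onD[OF inj i(2)]) (use i k m in auto)
      then show False using i k by simp
    qed
  qed
  also have "(\<Sum>k\<in>{1..<m}. moment \<iota> \<iota> m p + moment \<iota> \<iota> m (p \<circ> swap k m)) + (\<Sum>k\<in>{m..?N}. moment \<iota> \<iota> m p)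
    = (of_nat (m - 1) + of_nat (Suc ?N - m)) * moment \<iota> \<iota> m p + (\<Sum>s\<in>{1..<m}. moment \<iota> \<iota> m (p \<circ> swap s m))"
    by (simp add: sum.distrib distrib_right)
  also have "of_nat (m - 1) + of_nat (Suc ?N - m) = (of_nat ?N :: complex)"
    unfolding of_nat_add[symmetric] using m by (intro arg_cong[where f = of_nat]) simp
  finally show ?thesis unfolding total by (rule sym)
qed

text \<open>The moment recursion multiplied by a power of \<open>N\<close>. Extension by 0 places
  the \<open>m\<close>-th function, an element of the group algebra of S(m), in that of
  S(n).\<close>

lemma jm_inverse_moment:
  assumes bij: "bij_betw \<iota> {1..CARD('N)} UNIV" and n: "n \<le> CARD('N)"
  shows "jm_inverse n (- 1 / of_nat CARD('N))
    (\<lambda>m p. if p permutes {1..m} then of_nat CARD('N) ^ m * moment \<iota> \<iota> m p else 0)"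
proof
  interpret prob_space M by (rule prob_space_M)
  let ?N = "of_nat CARD('N) :: complex"
  let ?X = "\<lambda>m p. if p permutes {1..m} then ?N ^ m * moment \<iota> \<iota> m p else 0"
  fix p assume p: "p permutes {1..n}"
  show "?X 0 p = of_bool (p = id)"
    by (simp add: moment_def prob_space)
  fix m assume m: "m \<in> {1..n}"
  have swap_m: "swap s m permutes {1..m}" if "s \<in> {1..<m}" for s
    using that m by (intro permutes_swap_id) auto
  show "?X m p - - 1 / ?N * (\<Sum>s\<in>{1..<m}. ?X m (p \<circ> swap s m)) = ?X (m - 1) p"
  proof (cases "p permutes {1..m}")
    case True
    have "(\<Sum>s\<in>{1..<m}. ?X m (p \<circ> swap s m)) = ?N ^ m * (\<Sum>s\<in>{1..<m}. moment \<iota> \<iota> m (p \<circ> swap s m))"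
      unfolding sum_distrib_left using True swap_m by (intro sum.cong refl) (auto simp: permutes_compose)
    then have "?X m p - - 1 / ?N * (\<Sum>s\<in>{1..<m}. ?X m (p \<circ> swap s m))
      = ?N ^ m / ?N * (?N * moment \<iota> \<iota> m p + (\<Sum>s\<in>{1..<m}. moment \<iota> \<iota> m (p \<circ> swap s m)))"
      using True by (simp add: distrib_left)
    also have "\<dots> = ?N ^ (m - 1) * (if p m = m then moment \<iota> \<iota> (m - 1) p else 0)"
      using m n by (subst moment_recursion[OF bij _ _ True]) (auto simp: power_eq_if)
    \<comment> \<open>The case distinction produced by column orthogonality coincides with the one
      in the extension by 0 at \<open>m - 1\<close>.\<close>
    also have "p m = m \<longleftrightarrow> p permutes {1..m - 1}"
    proof
      assume "p m = m"
      moreover have "{1..m} = insert m {1..m - 1}" using m by auto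
      ultimately show "p permutes {1..m - 1}"
        using permutes_insert_lemma[of p m "{1..m - 1}"] True by simp
    next
      assume "p permutes {1..m - 1}"
      then show "p m = m" by (rule permutes_not_in) (use m in auto)
    qed
    also have "?N ^ (m - 1) * (if p permutes {1..m - 1} then moment \<iota> \<iota> (m - 1) p else 0) = ?X (m - 1) p"
      by simp
    finally show ?thesis .
  next
    case False
    have "\<not> p permutes {1..m - 1}"
    proof
      assume "p permutes {1..m - 1}"
      then have "p permutes {1..m}" by (rule permutes_subset) auto
      then show False using False by simp
    qed
    moreover have "\<not> (p \<circ> swap s m) permutes {1..m}" if "s \<in> {1..<m}" for s
    proof
      assume "(p \<circ> swap s m) permutes {1..m}"
      then have "(p \<circ> swap s m) \<circ> swap s m permutes {1..m}"
        by (rule permutes_compose[OF swap_m[OF that]])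
      then show False using False by (simp add: comp_assoc)
    qed
    ultimately show ?thesis using False by simp
  qed
qed

end

section \<open>The moment of the cyclic shift\<close>

definition cyclic_shift :: "nat \<Rightarrow> nat \<Rightarrow> nat" where
  "cyclic_shift n i = (if i \<in> {1..n} then if i = n then 1 else i + 1 else i)"

lemma cyclic_shift_permutes:
  shows "cyclic_shift n permutes {1..n}"
proof (rule inj_imp_permutes)
  show "inj_on (cyclic_shift n) {1..n}"
    by (auto simp: inj_on_def cyclic_shift_def split: if_splits)
qed (auto simp: cyclic_shift_def)

lemma card_orbits_cyclic_shift:
  assumes "1 \<le> n"
  shows "card (orbit (cyclic_shift n) ` {1..n}) = 1"
proof -
  have perm: "permutation (cyclic_shift n)"
    using cyclic_shift_permutes by (auto simp: permutation_permutes)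
  have "Suc i \<in> orbit (cyclic_shift n) 1" if "Suc i \<le> n" for i
    using that
  proof (induction i)
    case 0
    then show ?case using permutation_self_in_orbit[OF perm, of 1] by simp
  next
    case (Suc i)
    then have "cyclic_shift n (Suc i) \<in> orbit (cyclic_shift n) 1" by (intro orbit.step) simp
    moreover have "cyclic_shift n (Suc i) = Suc (Suc i)" using Suc.prems by (simp add: cyclic_shift_def)
    ultimately show ?case by (simp only:)
  qed
  then have "x \<in> orbit (cyclic_shift n) 1" if "x \<in> {1..n}" for x
    using that by (cases x) auto
  then have "orbit (cyclic_shift n) x = orbit (cyclic_shift n) 1" if "x \<in> {1..n}" for x
    using that orbit_eq_if_mem[OF perm] by blast
  then have "orbit (cyclic_shift n) ` {1..n} = (\<lambda>_. orbit (cyclic_shift n) 1) ` {1..n}"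
    by (rule image_cong[OF refl])
  then show ?thesis using assms by (simp add: image_constant_conv)
qed

lemma cancel_common_power:
  fixes x y w d c e :: complex
  assumes "y \<noteq> 0" "x * y * w * (d / (y * y)) = c * (e / y)"
  shows "x * d * w = e * c"
  using assms by (simp add: field_simps)

lemma haar_cyclic_moment:
  fixes U :: "'a \<Rightarrow> complex^'N^'N"
  assumes n: "1 \<le> n" "n \<le> CARD('N)" and haar: "haar_random_unitary M U"
    and bij: "bij_betw \<iota> {1..CARD('N)} UNIV"
  shows "(\<integral>\<omega>. (\<Prod>i=1..n. U \<omega> $ \<iota> i $ \<iota> i * cnj (U \<omega> $ \<iota> i $ \<iota> (if i = n then 1 else i + 1))) \<partial>M)
    = (- 1) ^ (n - 1) * catalan (n - 1) /
      (of_nat CARD('N) * (\<Prod>i=1..n - 1. of_nat CARD('N) ^ 2 - of_nat i ^ 2))"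
proof -
  interpret haar_setting M U by unfold_locales (rule haar)
  let ?N = "of_nat CARD('N) :: complex" and ?c = "cyclic_shift n"
  interpret jm_inverse n "- 1 / ?N" "\<lambda>m p. if p permutes {1..m} then ?N ^ m * moment \<iota> \<iota> m p else 0"
    using bij n(2) by (rule jm_inverse_moment)
  let ?D = "\<Prod>i=1..n - 1. ?N ^ 2 - of_nat i ^ 2"
  have N: "?N \<noteq> 0" using n by simp
  \<comment> \<open>Here the bound on \<open>n\<close> enters: no index of the product reaches the
    dimension, so the denominator does not vanish.\<close>
  have "?N ^ 2 - of_nat i ^ 2 \<noteq> 0" if "i \<in> {1..n - 1}" for i
  proof -
    have "i < CARD('N)" using that n by auto
    then have "CARD('N) ^ 2 \<noteq> i ^ 2" by (simp add: power2_eq_iff_nonneg)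
    then have "(of_nat (CARD('N) ^ 2) :: complex) \<noteq> of_nat (i ^ 2)" by (metis of_nat_eq_iff)
    then show ?thesis by simp
  qed
  then have D: "?D \<noteq> 0" by (simp add: prod_zero_iff)
  let ?K = "of_nat (fact n * fact (n - 1)) :: complex"
  have K: "?K \<noteq> 0" by simp
  \<comment> \<open>At \<open>z = - 1 / N\<close> each factor is
    \<open>(N\<^sup>2 - i\<^sup>2) / N\<^sup>2\<close>, the origin of the denominator of the moment;
    the sign \<open>(-1) ^ (n - 1)\<close> comes from \<open>z ^ (n - 1)\<close>.\<close>
  have "(\<Prod>i=1..n - 1. 1 - of_nat i ^ 2 * (- 1 / ?N) ^ 2) = (\<Prod>i=1..n - 1. (?N ^ 2 - of_nat i ^ 2) / ?N ^ 2)"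
    using N by (intro prod.cong refl) (simp add: field_simps)
  also have "\<dots> = ?D / (?N ^ 2) ^ (n - 1)" by (simp add: prod_dividef)
  finally have prod_eq: "(\<Prod>i=1..n - 1. 1 - of_nat i ^ 2 * (- 1 / ?N) ^ 2) = ?D / (?N ^ 2) ^ (n - 1)" .
  have "?K * (?N ^ n * moment \<iota> \<iota> n ?c * (?D / (?N ^ 2) ^ (n - 1))) = of_nat (fact (2 * (n - 1))) * (- 1 / ?N) ^ (n - 1)"
    using X_single_orbit[OF n(1) cyclic_shift_permutes card_orbits_cyclic_shift[OF n(1)]] cyclic_shift_permutes
    unfolding prod_eq by simp
  also have "\<dots> = ?K * (catalan (n - 1) * (- 1 / ?N) ^ (n - 1))"
    unfolding of_nat_fact_mult_catalan[OF n(1), symmetric] by (rule mult.assoc)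
  finally have "?N ^ n * moment \<iota> \<iota> n ?c * (?D / (?N ^ 2) ^ (n - 1)) = catalan (n - 1) * (- 1 / ?N) ^ (n - 1)"
    using K by (simp only: mult_cancel_left) simp
  moreover have "?N ^ n = ?N * ?N ^ (n - 1)" using n by (simp add: power_eq_if)
  ultimately have "?N * ?N ^ (n - 1) * moment \<iota> \<iota> n ?c * (?D / (?N ^ (n - 1) * ?N ^ (n - 1)))
    = catalan (n - 1) * ((- 1) ^ (n - 1) / ?N ^ (n - 1))"
    by (simp only: power_divide power2_eq_square power_mult_distrib)
  then have "?N * ?D * moment \<iota> \<iota> n ?c = (- 1) ^ (n - 1) * catalan (n - 1)"
    by (rule cancel_common_power[OF power_not_zero[OF N]])
  then have "moment \<iota> \<iota> n ?c = (- 1) ^ (n - 1) * catalan (n - 1) / (?N * ?D)"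
    using N D by (metis mult_eq_0_iff nonzero_mult_div_cancel_left)
  moreover have "moment \<iota> \<iota> n ?c
    = (\<integral>\<omega>. (\<Prod>i=1..n. U \<omega> $ \<iota> i $ \<iota> i * cnj (U \<omega> $ \<iota> i $ \<iota> (if i = n then 1 else i + 1))) \<partial>M)"
    unfolding moment_def cyclic_shift_def by (intro Bochner_Integration.integral_cong refl prod.cong) auto
  ultimately show ?thesis by simp
qed

theorem theorem6p7:
  fixes n :: nat
  assumes "2 \<le> n"
  shows "class_gf n {#n - 1#} =
           fps_const (catalan (n - 1)) * fps_X ^ (n - 1) /
             (\<Prod>i=1..n - 1. 1 - fps_const (of_nat i ^ 2) * fps_X ^ 2)
       \<and> (\<forall>(M :: 'a measure) (U :: 'a \<Rightarrow> complex^'N^'N) (\<iota> :: nat \<Rightarrow> 'N).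
            n \<le> CARD('N) \<longrightarrow> haar_random_unitary M U \<longrightarrow> bij_betw \<iota> {1..CARD('N)} UNIV \<longrightarrow>
            prob_space.expectation M
              (\<lambda>\<omega>. \<Prod>i=1..n. U \<omega> $ \<iota> i $ \<iota> i * cnj (U \<omega> $ \<iota> i $ \<iota> (if i = n then 1 else i + 1))) =
            (- 1) ^ (n - 1) * catalan (n - 1) /
              (of_nat CARD('N) * (\<Prod>i=1..n - 1. of_nat CARD('N) ^ 2 - of_nat i ^ 2)))"
proof (intro conjI allI impI)
  show "class_gf n {#n - 1#} =
           fps_const (catalan (n - 1)) * fps_X ^ (n - 1) /
             (\<Prod>i=1..n - 1. 1 - fps_const (of_nat i ^ 2) * fps_X ^ 2)"
    using assms by (rule class_gf_single_cycle)
next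
  fix M :: "'a measure" and U :: "'a \<Rightarrow> complex^'N^'N" and \<iota> :: "nat \<Rightarrow> 'N"
  assume "n \<le> CARD('N)" "haar_random_unitary M U" "bij_betw \<iota> {1..CARD('N)} UNIV"
  with assms show "prob_space.expectation M
              (\<lambda>\<omega>. \<Prod>i=1..n. U \<omega> $ \<iota> i $ \<iota> i * cnj (U \<omega> $ \<iota> i $ \<iota> (if i = n then 1 else i + 1))) =
            (- 1) ^ (n - 1) * catalan (n - 1) /
              (of_nat CARD('N) * (\<Prod>i=1..n - 1. of_nat CARD('N) ^ 2 - of_nat i ^ 2))"
    by (intro haar_cyclic_moment) auto
qed

end
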